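(* There is a universal constant $C>0$ such that the following holds. For any $\varepsilon\in(0,1)$, under the condition $$\kappa\le d\le\eta\log n\quad\text{and}\quad p_{\max}\le n^{-1+\eta},$$ with high probability $$\|\underline A\|\le(1+\varepsilon)\sqrt{L_1}+C\sqrt{n\,p_{\max}}.$$
   Context: Setting: $G$ is a random undirected graph on the vertex set $\{1,\dots,n\}$ (loops allowed) in which each edge $\{i,j\}$ (including $i=j$) is present with probability $p_{ij}=p_{ji}\in[0,1]$, independently of the others; $A$ is its adjacency matrix, $(\mathbb E A)_{ij}=p_{ij}$, and $\underline A=A-\mathbb E A$. Set $p_{\max}=\max_{i\ne j}p_{ij}$, $d_i=\sum_j p_{ij}$, $d=\max_i d_i$. $\|\cdot\|$ is the operator norm. Set $$L_1=\frac{\log n}{\log((\log n)/d)}.$$ Parameters: $\kappa>0$ and $\eta\in(0,1)$. An admissible error function is a function $\psi(n,\kappa,\eta)$ such that for every $\kappa>0$, $\psi(n,\kappa,\eta)\to0$ as $n\to\infty$ and $\eta\to0$ (joint limit). "Under a condition $\mathcal A$ on the parameters $\kappa,\eta,(p_{ij})$, an event $E$ holds with high probability" means: there is an admissible error function $\psi$ with $\mathbb P(E)\ge1-\psi(n,\kappa,\eta)$ for all $n,\kappa,\eta,(p_{ij})_{i,j\in[n]}$ satisfying $\mathcal A$ ($\psi$ may depend on $\varepsilon$, but not on $(p_{ij})$). *)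

theory Defs
  imports "HOL-Probability.Probability"
begin

definition potential_edges :: "nat \<Rightarrow> nat set set" where
  "potential_edges n = {{i, j} |i j. i \<in> {1..n} \<and> j \<in> {1..n}}"

definition edge_probabilities :: "nat \<Rightarrow> (nat \<Rightarrow> nat \<Rightarrow> real) \<Rightarrow> bool" where
  "edge_probabilities n p \<longleftrightarrow>
     (\<forall>i\<in>{1..n}. \<forall>j\<in>{1..n}. p i j = p j i \<and> 0 \<le> p i j \<and> p i j \<le> 1)"

text \<open>A graph is the indicator function of its edge set, an edge being the set \<open>{i, j}\<close> of its
  end points, so that a loop at \<open>i\<close> is the singleton \<open>{i}\<close>. For such an \<open>e\<close> the value
  \<open>p (Min e) (Max e)\<close> is \<open>p i j\<close>, by symmetry of \<open>p\<close>.\<close>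

definition random_graph :: "nat \<Rightarrow> (nat \<Rightarrow> nat \<Rightarrow> real) \<Rightarrow> (nat set \<Rightarrow> bool) pmf" where
  "random_graph n p =
     Pi_pmf (potential_edges n) False (\<lambda>e. bernoulli_pmf (p (Min e) (Max e)))"

definition adjacency :: "(nat set \<Rightarrow> bool) \<Rightarrow> nat \<Rightarrow> nat \<Rightarrow> real" where
  "adjacency G i j = of_bool (G {i, j})"

definition mean_adjacency :: "nat \<Rightarrow> (nat \<Rightarrow> nat \<Rightarrow> real) \<Rightarrow> nat \<Rightarrow> nat \<Rightarrow> real" where
  "mean_adjacency n p i j = measure_pmf.expectation (random_graph n p) (\<lambda>G. adjacency G i j)"

lemma mean_adjacency_eq:
  assumes "edge_probabilities n p" "i \<in> {1..n}" "j \<in> {1..n}"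
  shows "mean_adjacency n p i j = p i j"
proof -
  have fin: "finite (potential_edges n)"
    by (rule finite_subset[of _ "Pow {1..n}"]) (auto simp: potential_edges_def)
  have mem: "{i, j} \<in> potential_edges n"
    using assms by (auto simp: potential_edges_def)
  have p: "p (Min {i, j}) (Max {i, j}) = p i j"
    using assms by (cases "i \<le> j") (auto simp: edge_probabilities_def min_def max_def)
  have "mean_adjacency n p i j =
      measure_pmf.expectation (map_pmf (\<lambda>G. G {i, j}) (random_graph n p)) of_bool"
    by (simp add: mean_adjacency_def adjacency_def)
  also have "map_pmf (\<lambda>G. G {i, j}) (random_graph n p) = bernoulli_pmf (p i j)"
    unfolding random_graph_def by (subst Pi_pmf_component) (use fin mem p in auto)
  also have "measure_pmf.expectation (bernoulli_pmf (p i j)) of_bool = p i j"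
    using assms by (subst integral_bernoulli_pmf) (auto simp: edge_probabilities_def)
  finally show ?thesis .
qed

definition centered_adjacency ::
    "nat \<Rightarrow> (nat \<Rightarrow> nat \<Rightarrow> real) \<Rightarrow> (nat set \<Rightarrow> bool) \<Rightarrow> nat \<Rightarrow> nat \<Rightarrow> real" where
  "centered_adjacency n p G i j = adjacency G i j - mean_adjacency n p i j"

text \<open>The operator norm of an \<open>n \<times> n\<close> matrix with respect to the Euclidean norm. The set of values
  is nonempty and bounded (\<open>op_norm_bdd_above\<close>), so the supremum is a genuine one.\<close>

definition op_norm :: "nat \<Rightarrow> (nat \<Rightarrow> nat \<Rightarrow> real) \<Rightarrow> real" where
  "op_norm n B =
     (SUP x\<in>{x. L2_set x {1..n} \<le> 1}. L2_set (\<lambda>i. \<Sum>j\<in>{1..n}. B i j * x j) {1..n})"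

lemma op_norm_bdd_above:
  fixes B :: "nat \<Rightarrow> nat \<Rightarrow> real"
  shows "bdd_above ((\<lambda>x. L2_set (\<lambda>i. \<Sum>j\<in>{1..n}. B i j * x j) {1..n}) ` {x. L2_set x {1..n} \<le> 1})"
proof (rule bdd_aboveI2)
  fix x :: "nat \<Rightarrow> real" assume "x \<in> {x. L2_set x {1..n} \<le> 1}"
  then have x: "L2_set x {1..n} \<le> 1" by simp
  have le: "\<bar>\<Sum>j\<in>{1..n}. B i j * x j\<bar> \<le> L2_set (B i) {1..n}" for i
  proof -
    have "\<bar>\<Sum>j\<in>{1..n}. B i j * x j\<bar> \<le> (\<Sum>j\<in>{1..n}. \<bar>B i j\<bar> * \<bar>x j\<bar>)"
      by (rule order.trans[OF sum_abs]) (simp add: abs_mult)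
    also have "\<dots> \<le> L2_set (B i) {1..n} * L2_set x {1..n}"
      by (rule L2_set_mult_ineq)
    also have "\<dots> \<le> L2_set (B i) {1..n} * 1"
      by (rule mult_left_mono[OF x L2_set_nonneg])
    finally show ?thesis by simp
  qed
  have "L2_set (\<lambda>i. \<Sum>j\<in>{1..n}. B i j * x j) {1..n} \<le>
      (\<Sum>i\<in>{1..n}. \<bar>\<Sum>j\<in>{1..n}. B i j * x j\<bar>)"
    by (rule L2_set_le_sum_abs)
  also have "\<dots> \<le> (\<Sum>i\<in>{1..n}. L2_set (B i) {1..n})"
    by (rule sum_mono[OF le])
  finally show "L2_set (\<lambda>i. \<Sum>j\<in>{1..n}. B i j * x j) {1..n} \<le>
      (\<Sum>i\<in>{1..n}. L2_set (B i) {1..n})" .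
qed

text \<open>The maximum is over the empty set if \<open>n = 1\<close>. That value is never used, as
  \<open>0 < \<kappa> \<le> max_degree n p \<le> \<eta> * ln n\<close> implies \<open>n \<ge> 2\<close>.\<close>

definition p_max :: "nat \<Rightarrow> (nat \<Rightarrow> nat \<Rightarrow> real) \<Rightarrow> real" where
  "p_max n p = Max {p i j |i j. i \<in> {1..n} \<and> j \<in> {1..n} \<and> i \<noteq> j}"

definition max_degree :: "nat \<Rightarrow> (nat \<Rightarrow> nat \<Rightarrow> real) \<Rightarrow> real" where
  "max_degree n p = Max ((\<lambda>i. \<Sum>j\<in>{1..n}. p i j) ` {1..n})"

definition L\<^sub>1 :: "nat \<Rightarrow> (nat \<Rightarrow> nat \<Rightarrow> real) \<Rightarrow> real" where
  "L\<^sub>1 n p = ln (real n) / ln (ln (real n) / max_degree n p)"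

definition admissible_error :: "(nat \<Rightarrow> real \<Rightarrow> real \<Rightarrow> real) \<Rightarrow> bool" where
  "admissible_error \<psi> \<longleftrightarrow>
     (\<forall>\<kappa>>0. ((\<lambda>(n, \<eta>). \<psi> n \<kappa> \<eta>) \<longlongrightarrow> 0) (sequentially \<times>\<^sub>F at_right 0))"

definition holds_whp_under ::
    "(nat \<Rightarrow> real \<Rightarrow> real \<Rightarrow> (nat \<Rightarrow> nat \<Rightarrow> real) \<Rightarrow> bool) \<Rightarrow>
     (nat \<Rightarrow> (nat \<Rightarrow> nat \<Rightarrow> real) \<Rightarrow> (nat set \<Rightarrow> bool) \<Rightarrow> bool) \<Rightarrow> bool" where
  "holds_whp_under cond E \<longleftrightarrow>
     (\<exists>\<psi>. admissible_error \<psi> \<and>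
        (\<forall>n \<kappa> \<eta> p. n \<ge> 1 \<and> \<kappa> > 0 \<and> 0 < \<eta> \<and> \<eta> < 1 \<and> edge_probabilities n p \<and> cond n \<kappa> \<eta> p \<longrightarrow>
           measure_pmf.prob (random_graph n p) {G. E n p G} \<ge> 1 - \<psi> n \<kappa> \<eta>))"

end

theory Submission
  imports Defs "HOL-Real_Asymp.Real_Asymp"
begin

text \<open>Let \<open>\<tau> = \<delta> L\<^sub>1\<close> for a small \<open>\<delta>\<close> depending on \<open>\<epsilon>\<close>, and call a vertex high if its degree exceeds
  \<open>\<tau>\<close>. On the remaining vertices all degrees are at most \<open>D = max \<tau> (n p_max)\<close>, and the
  Kahn-Szemeredi argument in the form of Feige and Ofek bounds the centered matrix there by
  \<open>O(\<surd>D)\<close>: products \<open>x\<^sub>i x\<^sub>j\<close> below \<open>\<surd>D / n\<close> are treated by an exponential moment and a union bound over a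
  net, the larger ones by a discrepancy estimate for the edge counts between dyadic level sets of
  \<open>x\<close>. The edges that meet high vertices form an almost disjoint union of stars: with high
  probability a vertex has boundedly many high neighbours, and boundedly many paths of length two
  lead from a high vertex to other high vertices. Hence this part has norm at most
  \<open>\<surd>(\<Delta> + O(1)) + O(1)\<close>, where the maximal degree \<open>\<Delta>\<close> is at most \<open>(1 + \<epsilon>/2) L\<^sub>1\<close> by a
  Chernoff bound. By a first moment bound \<open>p_max\<close> times the number of high
  vertices is at most 1, so the entries of the mean matrix that belong to them contribute at most
  \<open>2 \<surd>(n p_max)\<close>.\<close>


section \<open>Quadratic forms and the operator norm\<close>

text \<open>Only the stars may carry the leading constant, so everything else must cost a small
  multiple of sqrt \<open>L\<^sub>1\<close>, a multiple of sqrt (n p_max), or O(1). The net and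
  discrepancy argument loses a factor 42500, hence \<delta> = (\<epsilon> / 170000)^2: the threshold
  then contributes only \<epsilon> / 4 times sqrt \<open>L\<^sub>1\<close>. The bound for a single
  vertex being high is about n^(-\<delta>/4), too weak to exclude high vertices by a union bound;
  but k of them in one local configuration cost n^(-k \<delta>/4), and k \<ge> 16 / \<delta> beats
  the n choices of a centre. The resulting constants depend on k, yet d \<ge> \<kappa> forces
  \<open>L\<^sub>1\<close> \<ge> ln n / ln (ln n / \<kappa>), which diverges and absorbs them. A low
  vertex may have several high neighbours, so row sums times column sums would bound the star part
  only by sqrt (k \<Delta>). Therefore the Gram matrix of the high-to-low block is used: its
  diagonal gives \<Delta>, and its other entries count paths of length two, which add only O(1) to
  each row.\<close>

definition bilin :: "nat \<Rightarrow> (nat \<Rightarrow> nat \<Rightarrow> real) \<Rightarrow> (nat \<Rightarrow> real) \<Rightarrow> (nat \<Rightarrow> real) \<Rightarrow> real" where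
  "bilin n B x y = (\<Sum>i\<in>{1..n}. \<Sum>j\<in>{1..n}. B i j * x i * y j)"

lemma L2_set_power2: "(L2_set x A)\<^sup>2 = (\<Sum>i\<in>A. (x i)\<^sup>2)"
  by (simp add: L2_set_def sum_nonneg)

lemma L2_set_le_1_iff: "L2_set x A \<le> 1 \<longleftrightarrow> (\<Sum>i\<in>A. (x i)\<^sup>2) \<le> 1"
  by (simp add: L2_set_def)

lemma bilin_eq_inner:
  "bilin n B y x = (\<Sum>i\<in>{1..n}. y i * (\<Sum>j\<in>{1..n}. B i j * x j))"
  by (simp add: bilin_def sum_distrib_left mult_ac)

lemma bilin_scale: "bilin n B (\<lambda>i. c * x i) (\<lambda>i. d * y i) = c * d * bilin n B x y"
  by (simp add: bilin_def sum_distrib_left mult_ac)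

lemma bilin_add_left: "bilin n B (\<lambda>i. x i + x' i) y = bilin n B x y + bilin n B x' y"
  by (simp add: bilin_def sum.distrib algebra_simps)

lemma bilin_add_right: "bilin n B x (\<lambda>i. y i + y' i) = bilin n B x y + bilin n B x y'"
  by (simp add: bilin_def sum.distrib algebra_simps)

lemma bilin_diff_left: "bilin n B (\<lambda>i. x i - x' i) y = bilin n B x y - bilin n B x' y"
  by (simp add: bilin_def sum_subtractf algebra_simps)

lemma bilin_diff_right: "bilin n B x (\<lambda>i. y i - y' i) = bilin n B x y - bilin n B x y'"
  by (simp add: bilin_def sum_subtractf algebra_simps)

lemma bilin_commute:
  assumes "\<And>i j. B i j = B j i"
  shows "bilin n B x y = bilin n B y x"
  unfolding bilin_def
  by (subst sum.swap) (auto intro!: sum.cong simp: mult_ac assms)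

lemma L2_set_apply_le_op_norm:
  "L2_set (\<lambda>i. \<Sum>j\<in>{1..n}. B i j * x j) {1..n} \<le> op_norm n B * L2_set x {1..n}"
proof (cases "L2_set x {1..n} = 0")
  case True
  then have "x j = 0" if "j \<in> {1..n}" for j
    using that by (subst (asm) L2_set_eq_0_iff) auto
  then have "L2_set (\<lambda>i. \<Sum>j\<in>{1..n}. B i j * x j) {1..n} = 0"
    by (simp add: L2_set_eq_0_iff)
  then show ?thesis using True by simp
next
  case False
  define r where "r = L2_set x {1..n}"
  have r: "r > 0" using False L2_set_nonneg[of x "{1..n}"] unfolding r_def by linarith
  have scale: "L2_set (\<lambda>i. inverse r * f i) {1..n} = inverse r * L2_set f {1..n}" for f
    using r by (subst L2_set_right_distrib) auto
  have "inverse r * L2_set (\<lambda>i. \<Sum>j\<in>{1..n}. B i j * x j) {1..n} =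
      L2_set (\<lambda>i. \<Sum>j\<in>{1..n}. B i j * (inverse r * x j)) {1..n}"
    unfolding scale[symmetric] sum_distrib_left by (simp only: mult_ac)
  also have "\<dots> \<le> op_norm n B"
    unfolding op_norm_def
  proof (rule cSUP_upper[OF _ op_norm_bdd_above], rule CollectI)
    show "L2_set (\<lambda>i. inverse r * x i) {1..n} \<le> 1"
      unfolding scale r_def[symmetric] using r by simp
  qed
  finally have "r * (inverse r * L2_set (\<lambda>i. \<Sum>j\<in>{1..n}. B i j * x j) {1..n}) \<le> r * op_norm n B"
    using r by (intro mult_left_mono) auto
  then show ?thesis using r by (simp only: r_def[symmetric] mult.assoc[symmetric]) (simp add: mult.commute)
qed

lemma op_norm_nonneg: "0 \<le> op_norm n B"
proof -
  have "0 \<le> L2_set (\<lambda>i. \<Sum>j\<in>{1..n}. B i j * 0) {1..n}" by simp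
  also have "\<dots> \<le> op_norm n B"
    unfolding op_norm_def by (rule cSUP_upper[OF _ op_norm_bdd_above]) (simp add: L2_set_def)
  finally show ?thesis .
qed

lemma bilin_le_op_norm:
  "\<bar>bilin n B y x\<bar> \<le> op_norm n B * L2_set y {1..n} * L2_set x {1..n}"
proof -
  have "\<bar>bilin n B y x\<bar> \<le> (\<Sum>i\<in>{1..n}. \<bar>y i\<bar> * \<bar>\<Sum>j\<in>{1..n}. B i j * x j\<bar>)"
    unfolding bilin_eq_inner by (rule order.trans[OF sum_abs]) (simp add: abs_mult)
  also have "\<dots> \<le> L2_set y {1..n} * L2_set (\<lambda>i. \<Sum>j\<in>{1..n}. B i j * x j) {1..n}"
    by (rule L2_set_mult_ineq)
  also have "\<dots> \<le> L2_set y {1..n} * (op_norm n B * L2_set x {1..n})"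
    by (intro mult_left_mono L2_set_apply_le_op_norm L2_set_nonneg)
  finally show ?thesis by (simp add: mult_ac)
qed

text \<open>Polarization and the parallelogram identity extend a bound on the quadratic form of a
  symmetric matrix to the bilinear form without loss. Testing against y = B x / |B x| then bounds
  the norm of B x.\<close>

lemma op_norm_leI:
  assumes sym: "\<And>i j. B i j = B j i"
    and quad: "\<And>x. (\<Sum>i\<in>{1..n}. (x i)\<^sup>2) \<le> 1 \<Longrightarrow> \<bar>bilin n B x x\<bar> \<le> q"
  shows "op_norm n B \<le> q"
proof -
  define N2 where "N2 x = (\<Sum>i\<in>{1..n}. (x i)\<^sup>2)" for x :: "nat \<Rightarrow> real"
  have q0: "0 \<le> q" using quad[of "\<lambda>_. 0"] by (simp add: bilin_def)
  have quad': "\<bar>bilin n B x x\<bar> \<le> q * N2 x" for x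
  proof (cases "N2 x = 0")
    case True
    then have "\<forall>i\<in>{1..n}. x i = 0" unfolding N2_def by (subst (asm) sum_nonneg_eq_0_iff) auto
    then show ?thesis using True by (simp add: bilin_def)
  next
    case False
    have pos: "N2 x > 0" using False unfolding N2_def by (meson antisym_conv not_le sum_nonneg zero_le_power2)
    define c where "c = 1 / sqrt (N2 x)"
    have c2: "c * c = 1 / N2 x" using pos by (simp add: c_def)
    have "(\<Sum>i\<in>{1..n}. (c * x i)\<^sup>2) = c * c * N2 x"
      by (simp add: N2_def sum_distrib_left power2_eq_square mult_ac)
    then have "\<bar>bilin n B (\<lambda>i. c * x i) (\<lambda>i. c * x i)\<bar> \<le> q"
      using quad[of "\<lambda>i. c * x i"] pos c2 by simp
    then have "\<bar>c * c * bilin n B x x\<bar> \<le> q" by (simp add: bilin_scale)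
    then show ?thesis using pos by (simp add: c2 abs_mult field_simps)
  qed
  have bil: "bilin n B y x \<le> q" if "N2 x \<le> 1" "N2 y \<le> 1" for x y
  proof -
    let ?p = "\<lambda>i. x i + y i" and ?m = "\<lambda>i. x i - y i"
    have "4 * bilin n B y x = bilin n B ?p ?p - bilin n B ?m ?m"
      by (simp add: bilin_add_left bilin_add_right bilin_diff_left bilin_diff_right
          bilin_commute[of B n x y, OF sym])
    also have "\<dots> \<le> q * N2 ?p + q * N2 ?m" using quad'[of ?p] quad'[of ?m] by linarith
    also have "\<dots> = q * (2 * N2 x + 2 * N2 y)"
    proof -
      have "N2 ?p + N2 ?m = 2 * N2 x + 2 * N2 y"
        unfolding N2_def sum.distrib[symmetric] sum_distrib_left
        by (intro sum.cong) (auto simp: power2_eq_square algebra_simps)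
      then show ?thesis by (simp add: distrib_left[symmetric] del: distrib_left_numeral)
    qed
    also have "\<dots> \<le> q * 4" using that q0 by (intro mult_left_mono) auto
    finally show ?thesis by simp
  qed
  show ?thesis
    unfolding op_norm_def
  proof (rule cSUP_least)
    have "(\<lambda>_. 0) \<in> {x. L2_set x {1..n} \<le> 1}" by (simp add: L2_set_def)
    then show "{x. L2_set x {1..n} \<le> 1} \<noteq> {}" by blast
  next
    fix x assume "x \<in> {x. L2_set x {1..n} \<le> 1}"
    then have x: "N2 x \<le> 1" by (simp add: L2_set_le_1_iff N2_def)
    define f where "f = (\<lambda>i. \<Sum>j\<in>{1..n}. B i j * x j)"
    define r where "r = L2_set f {1..n}"
    show "L2_set (\<lambda>i. \<Sum>j\<in>{1..n}. B i j * x j) {1..n} \<le> q"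
    proof (cases "r = 0")
      case True then show ?thesis using q0 by (simp add: r_def f_def)
    next
      case False
      have r: "r > 0" using False L2_set_nonneg[of f "{1..n}"] unfolding r_def by linarith
      have rr: "r * r = (\<Sum>i\<in>{1..n}. (f i)\<^sup>2)"
        using L2_set_power2[of f "{1..n}"] by (simp add: r_def power2_eq_square)
      have "bilin n B (\<lambda>i. inverse r * f i) x = (\<Sum>i\<in>{1..n}. inverse r * f i * f i)"
        unfolding bilin_eq_inner f_def ..
      also have "\<dots> = inverse r * (r * r)"
        unfolding rr sum_distrib_left by (simp add: power2_eq_square mult.assoc)
      finally have "bilin n B (\<lambda>i. inverse r * f i) x = inverse r * (r * r)" .
      moreover have "N2 (\<lambda>i. inverse r * f i) = inverse r * inverse r * (r * r)"
        by (simp add: N2_def rr sum_distrib_left power2_eq_square mult_ac)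
      moreover have "inverse r * inverse r * (r * r) = 1" "inverse r * (r * r) = r"
        using r by (simp_all add: field_simps)
      ultimately have "r \<le> q" using bil[OF x, of "\<lambda>i. inverse r * f i"] by simp
      then show ?thesis by (simp add: r_def f_def)
    qed
  qed
qed


section \<open>Summation over dyadic levels\<close>

text \<open>The cut-off at 1 makes the bound independent of \<open>N\<close> and \<open>c\<close>:
  the largest surviving term is at most 1, and the terms below it are dominated by 1/q, 1/q^2, and
  so on.\<close>

lemma sum_geometric_up_le:
  fixes q c :: real
  assumes q: "1 < q" and c: "0 \<le> c"
  shows "(\<Sum>b<N. if c * q ^ b \<le> 1 then c * q ^ b else 0) \<le> q / (q - 1)"
proof -
  have geo: "(\<Sum>b<N. c * q ^ b) \<le> c * q ^ N / (q - 1)" for N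
  proof -
    have "(\<Sum>b<N. c * q ^ b) = c * (q ^ N - 1) / (q - 1)"
      using q by (simp add: sum_distrib_left[symmetric] geometric_sum)
    also have "\<dots> \<le> c * q ^ N / (q - 1)"
      using q c by (intro divide_right_mono mult_left_mono) auto
    finally show ?thesis .
  qed
  show ?thesis
  proof (induction N)
    case 0 then show ?case using q by simp
  next
    case (Suc N)
    show ?case
    proof (cases "c * q ^ N \<le> 1")
      case True
      have "(\<Sum>b<Suc N. if c * q ^ b \<le> 1 then c * q ^ b else 0) \<le> (\<Sum>b<Suc N. c * q ^ b)"
        using q c by (intro sum_mono) auto
      also have "\<dots> \<le> q * (c * q ^ N) / (q - 1)" using geo[of "Suc N"] by (simp add: mult_ac)
      also have "\<dots> \<le> q * 1 / (q - 1)" using True q by (intro divide_right_mono mult_left_mono) auto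
      finally show ?thesis by simp
    next
      case False then show ?thesis using Suc by simp
    qed
  qed
qed

text \<open>Reversing the order of summation turns the decreasing sequence into an increasing
  one.\<close>

lemma sum_geometric_down_le:
  fixes q c :: real
  assumes q: "1 < q" and c: "0 \<le> c"
  shows "(\<Sum>b<N. if c / q ^ b \<le> 1 then c / q ^ b else 0) \<le> q / (q - 1)"
proof (cases N)
  case 0 then show ?thesis using q by simp
next
  case (Suc k)
  have eq: "c / q ^ (k - b) = c / q ^ k * q ^ b" if "b \<le> k" for b
    using q that by (simp add: power_diff)
  have "(\<Sum>b<N. if c / q ^ b \<le> 1 then c / q ^ b else 0) =
      (\<Sum>b<N. if c / q ^ (k - b) \<le> 1 then c / q ^ (k - b) else 0)"
    by (subst sum.nat_diff_reindex[symmetric]) (use Suc in \<open>auto intro!: sum.cong\<close>)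
  also have "\<dots> = (\<Sum>b<N. if c / q ^ k * q ^ b \<le> 1 then c / q ^ k * q ^ b else 0)"
    using Suc by (intro sum.cong) (auto simp: eq)
  also have "\<dots> \<le> q / (q - 1)" using q c by (intro sum_geometric_up_le) auto
  finally show ?thesis .
qed

text \<open>Contribution of the levels \<open>a\<close> and \<open>b\<close>, per unit of squared mass in level \<open>a\<close>: the first summand
  covers \<open>2\<^bsup>a\<^esup> \<ge> h 2\<^bsup>b\<^esup>\<close>, where the degree bound suffices, the other two come from the discrepancy
  estimate. Each decays geometrically in \<open>b\<close>.\<close>

definition pair_weight :: "real \<Rightarrow> nat \<Rightarrow> nat \<Rightarrow> real" where
  "pair_weight h a b =
     (if h * 2 ^ b / 2 ^ a \<le> 1 then h * 2 ^ b / 2 ^ a else 0) +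
     (if 2 ^ b / (h * 2 ^ a) \<le> 1 then sqrt (2 ^ b / (h * 2 ^ a)) else 0) +
     (if h / 2 ^ (a + b) \<le> 1 then h / 2 ^ (a + b) else 0)"

lemma pair_weight_nonneg: "0 \<le> h \<Longrightarrow> 0 \<le> pair_weight h a b"
  by (auto simp: pair_weight_def)

text \<open>The three summands are geometric in \<open>b\<close> with ratios 2, sqrt 2 and 1/2. Each
  is cut off at 1, so the sums are at most 2, 4 and 2.\<close>

lemma sum_pair_weight_le:
  assumes "1 \<le> h"
  shows "(\<Sum>b<N. pair_weight h a b) \<le> 8"
proof -
  have "(\<Sum>b<N. if h * 2 ^ b / 2 ^ a \<le> 1 then h * 2 ^ b / 2 ^ a else 0) \<le> 2"
    using sum_geometric_up_le[of 2 "h / 2 ^ a" N] assms by (simp only: times_divide_eq_left) simp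
  moreover have "(\<Sum>b<N. if 2 ^ b / (h * 2 ^ a) \<le> 1 then sqrt (2 ^ b / (h * 2 ^ a)) else 0) \<le> 4"
  proof -
    let ?c = "1 / sqrt (h * 2 ^ a)"
    have eq: "sqrt (2 ^ b / (h * 2 ^ a)) = ?c * sqrt 2 ^ b" for b
      by (simp add: real_sqrt_divide real_sqrt_power real_sqrt_mult)
    have le: "2 ^ b / (h * 2 ^ a) \<le> 1 \<longleftrightarrow> ?c * sqrt 2 ^ b \<le> 1" for b
      unfolding eq[symmetric] by simp
    \<comment> \<open>4/3 is exactly the lower bound on sqrt 2 that makes sqrt 2 / (sqrt 2 - 1) at
      most 4.\<close>
    have s: "4 / 3 \<le> sqrt (2::real)" by (rule real_le_rsqrt) (simp add: power2_eq_square)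
    have "(\<Sum>b<N. if 2 ^ b / (h * 2 ^ a) \<le> 1 then sqrt (2 ^ b / (h * 2 ^ a)) else 0) =
        (\<Sum>b<N. if ?c * sqrt 2 ^ b \<le> 1 then ?c * sqrt 2 ^ b else 0)"
      by (simp only: eq le)
    also have "\<dots> \<le> sqrt 2 / (sqrt 2 - 1)" using s by (intro sum_geometric_up_le) (use assms in auto)
    also have "\<dots> \<le> 4" using s by (simp add: field_simps)
    finally show ?thesis .
  qed
  moreover have "(\<Sum>b<N. if h / 2 ^ (a + b) \<le> 1 then h / 2 ^ (a + b) else 0) \<le> 2"
    using sum_geometric_down_le[of 2 "h / 2 ^ a" N] assms by (simp only: power_add divide_divide_eq_left) simp
  ultimately show ?thesis by (simp add: pair_weight_def sum.distrib)
qed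

text \<open>Trades a factor linear in \<open>b\<close> for a square root of \<open>r\<close>. If r
  2^b \<ge> 1, then r 4^b \<ge> 2^b and so b \<le> 2 l; otherwise r < 2^(-b), and sqrt r decays
  faster than b grows.\<close>

lemma level_ratio_le:
  fixes r l :: real
  assumes r: "0 < r" "r \<le> 1" and l: "1 \<le> l" "ln (r * 4 ^ b) \<le> l"
  shows "r * (1 + 3 * real b) \<le> 8 * l * sqrt r"
proof (cases "1 \<le> r * 2 ^ b")
  case True
  have "real b * ln 2 = ln (2 ^ b)" by (simp add: ln_realpow)
  also have "\<dots> \<le> ln (r * 4 ^ b)"
  proof -
    have "(2::real) ^ b * 1 \<le> 2 ^ b * (r * 2 ^ b)" using True by (intro mult_left_mono) auto
    also have "\<dots> = r * 4 ^ b" by (simp add: power_mult_distrib[symmetric] mult_ac)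
    finally show ?thesis using r by simp
  qed
  finally have bl: "real b * ln 2 \<le> l" using l by linarith
  have "real b * (1/2) \<le> real b * ln 2" by (intro mult_left_mono) (use ln2_ge_two_thirds in auto)
  then have "1 + 3 * real b \<le> 8 * l" using bl l by linarith
  then have "r * (1 + 3 * real b) \<le> r * (8 * l)" using r by (intro mult_left_mono) auto
  also have "\<dots> \<le> sqrt r * (8 * l)"
    using r l by (intro mult_right_mono) (auto intro: real_le_rsqrt simp: power2_eq_square mult_le_one)
  finally show ?thesis by (simp add: mult_ac)
next
  case False
  have b: "(1 + 3 * real b)\<^sup>2 \<le> 64 * 2 ^ b"
  proof -
    \<comment> \<open>A polynomial that dominates (1 + 3 b)^2 and at most doubles from b to b + 1,
      as the induction needs.\<close>
    have "10 * real b ^ 2 + 20 * real b + 60 \<le> 64 * 2 ^ b"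
    proof (induction b)
      case (Suc b)
      then have "2 * (10 * real b ^ 2 + 20 * real b + 60) \<le> 64 * 2 ^ Suc b" by simp
      moreover have "10 * real (Suc b) ^ 2 + 20 * real (Suc b) + 60 \<le> 2 * (10 * real b ^ 2 + 20 * real b + 60)"
        by (simp add: power2_eq_square algebra_simps)
      ultimately show ?case by linarith
    qed simp
    moreover have "(1 + 3 * real b)\<^sup>2 \<le> 10 * real b ^ 2 + 20 * real b + 60"
      by (simp add: power2_eq_square algebra_simps)
    ultimately show ?thesis by linarith
  qed
  have "sqrt r * (1 + 3 * real b) \<le> 8"
  proof -
    have "(sqrt r * (1 + 3 * real b))\<^sup>2 = r * (1 + 3 * real b)\<^sup>2" using r by (simp add: power_mult_distrib)
    also have "\<dots> \<le> r * (64 * 2 ^ b)" using b r by (intro mult_left_mono) auto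
    also have "\<dots> \<le> 8\<^sup>2" using False by (simp add: mult_ac)
    finally show ?thesis by (rule power2_le_imp_le) simp
  qed
  then have "sqrt r * (sqrt r * (1 + 3 * real b)) \<le> sqrt r * 8"
    using r by (intro mult_left_mono) auto
  then have "r * (1 + 3 * real b) \<le> 8 * sqrt r" using r by (simp add: mult.assoc[symmetric])
  also have "\<dots> \<le> 8 * l * sqrt r" using l r by (intro mult_right_mono) auto
  finally show ?thesis .
qed

text \<open>Here \<open>h = \<surd>D\<close>, the levels contain \<open>x\<close> and \<open>y\<close> vertices, and \<open>e\<close> counts the edges between them.
  The logarithm in \<open>disc\<close> has two sources, the height \<open>2\<^bsup>b\<^esup>\<close> and the mass \<open>\<beta>\<close> of the level; the case
  distinction at the end is on which of the two dominates.\<close>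

lemma heavy_pair_le:
  fixes h n x y e :: real
  assumes h: "1 \<le> h" and n: "0 < n" and x: "0 < x" and y: "0 < y" and e: "0 \<le> e"
    and ex: "e \<le> h\<^sup>2 * x" and ey: "e \<le> h\<^sup>2 * y" and hv: "4 * h \<le> 2 ^ (a + b)"
    and disc: "e \<le> 8 * (h\<^sup>2 * x * y / n) \<or>
      e * ln (e / (h\<^sup>2 * x * y / n)) \<le> 20 * (y * ln (exp 1 * n / y))"
  shows "2 ^ (a + b) * e / (n * h) \<le>
    2 * (x * 4 ^ a / n) * (y * 4 ^ b / n) +
    160 * (x * 4 ^ a / n * pair_weight h a b + y * 4 ^ b / n * pair_weight h b a)"
proof -
  define \<alpha> where "\<alpha> = x * 4 ^ a / n"
  define \<beta> where "\<beta> = y * 4 ^ b / n"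
  define T where "T = 2 ^ (a + b) * e / (n * h)"
  define \<mu> where "\<mu> = h\<^sup>2 * x * y / n"
  define \<rho> where "\<rho> = e / \<mu>"
  have pos: "0 < \<alpha>" "0 < \<beta>" "0 < \<mu>" using h n x y by (auto simp: \<alpha>_def \<beta>_def \<mu>_def)
  have w: "0 \<le> pair_weight h a b" "0 \<le> pair_weight h b a" using h by (auto intro: pair_weight_nonneg)
  have four: "(4::real) ^ k = 2 ^ k * 2 ^ k" for k by (simp flip: power_mult_distrib)
  have T: "T = h * \<rho> * \<alpha> * \<beta> / 2 ^ (a + b)"
    using h n x y by (simp add: T_def \<rho>_def \<mu>_def \<alpha>_def \<beta>_def four power_add power2_eq_square field_simps)
  have \<rho>0: "0 \<le> \<rho>" using e pos by (simp add: \<rho>_def)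
  have hq: "h / 2 ^ (a + b) \<le> 1 / 4" using hv by (simp add: field_simps)
  have goal_w: "T \<le> 2 * \<alpha> * \<beta> + 160 * (\<alpha> * pair_weight h a b + \<beta> * pair_weight h b a)"
    if "T \<le> 160 * (\<alpha> * pair_weight h a b) \<or> T \<le> 160 * (\<beta> * pair_weight h b a) \<or> T \<le> 2 * \<alpha> * \<beta>"
  proof -
    have "0 \<le> 2 * \<alpha> * \<beta>" "0 \<le> \<alpha> * pair_weight h a b" "0 \<le> \<beta> * pair_weight h b a"
      using pos w by auto
    then show ?thesis using that by (auto simp: distrib_left)
  qed
  have wI: "T \<le> 160 * (\<gamma> * pair_weight h c d)" if "T \<le> 160 * (\<gamma> * z)" "z \<le> pair_weight h c d" "0 < \<gamma>" for \<gamma> c d z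
  proof -
    have "160 * (\<gamma> * z) \<le> 160 * (\<gamma> * pair_weight h c d)"
      using that by (intro mult_left_mono) auto
    then show ?thesis using that by linarith
  qed
  have w1: "h * 2 ^ d / 2 ^ c \<le> pair_weight h c d" if "h * 2 ^ d \<le> 2 ^ c" for c d
    using that h by (auto simp: pair_weight_def)
  have "T \<le> 160 * (\<alpha> * pair_weight h a b) \<or> T \<le> 160 * (\<beta> * pair_weight h b a) \<or> T \<le> 2 * \<alpha> * \<beta>"
  proof -
    \<comment> \<open>\<open>\<rho>\<close> compares \<open>e\<close> with the reference value
      \<open>\<mu>\<close>. If it is at most 8 or at most 2^(a+b) / h, the product of the masses
      suffices; if one height exceeds the other by the factor h, the degree bound does. The
      remaining case has ln \<rho> \<ge> 1 and 2^a / (h 2^b) \<le> 1, and only there is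
      \<open>disc\<close> used.\<close>
    consider (small) "\<rho> \<le> 8" | (mod) "\<rho> \<le> 2 ^ (a + b) / h"
      | (dega) "h * 2 ^ b \<le> 2 ^ a" | (degb) "h * 2 ^ a \<le> 2 ^ b"
      | (main) "8 < \<rho>" "2 ^ (a + b) / h < \<rho>" "2 ^ a < h * 2 ^ b" "2 ^ b < h * 2 ^ a"
      by linarith
    then show ?thesis
    proof cases
      case small
      have "T = (h / 2 ^ (a + b)) * (\<rho> * (\<alpha> * \<beta>))" by (simp add: T)
      also have "\<dots> \<le> (1 / 4) * (8 * (\<alpha> * \<beta>))"
        using small hq \<rho>0 pos h by (intro mult_mono mult_right_mono) auto
      finally show ?thesis by simp
    next
      case mod
      have "T = (h / 2 ^ (a + b)) * \<rho> * (\<alpha> * \<beta>)" by (simp add: T)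
      also have "\<dots> \<le> (h / 2 ^ (a + b)) * (2 ^ (a + b) / h) * (\<alpha> * \<beta>)"
        using mod pos h by (intro mult_mono mult_right_mono mult_left_mono) auto
      also have "\<dots> = \<alpha> * \<beta>" using h by simp
      finally have "T \<le> 2 * \<alpha> * \<beta>" using mult_pos_pos[OF pos(1,2)] by linarith
      then show ?thesis by blast
    next
      case dega
      have "T \<le> 2 ^ (a + b) * (h\<^sup>2 * x) / (n * h)"
        unfolding T_def using ex n h by (intro divide_right_mono mult_left_mono) auto
      also have "\<dots> = \<alpha> * (h * 2 ^ b / 2 ^ a)"
        using n h by (simp add: \<alpha>_def four power_add power2_eq_square field_simps)
      finally have "T \<le> 160 * (\<alpha> * (h * 2 ^ b / 2 ^ a))"
        using pos h by (smt (verit) mult_nonneg_nonneg divide_nonneg_nonneg zero_le_power)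
      then show ?thesis using wI w1[OF dega] pos by blast
    next
      case degb
      have "T \<le> 2 ^ (a + b) * (h\<^sup>2 * y) / (n * h)"
        unfolding T_def using ey n h by (intro divide_right_mono mult_left_mono) auto
      also have "\<dots> = \<beta> * (h * 2 ^ a / 2 ^ b)"
        using n h by (simp add: \<beta>_def four power_add power2_eq_square field_simps)
      finally have "T \<le> 160 * (\<beta> * (h * 2 ^ a / 2 ^ b))"
        using pos h by (smt (verit) mult_nonneg_nonneg divide_nonneg_nonneg zero_le_power)
      then show ?thesis using wI w1[OF degb] pos by blast
    next
      case main
      define r where "r = 2 ^ a / (h * 2 ^ b)"
      define l where "l = ln \<rho>"
      define L where "L = ln (exp 1 * n / y)"
      have r: "0 < r" "r \<le> 1" using main h by (auto simp: r_def)
      have rw: "sqrt r \<le> pair_weight h b a"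
        using r h by (auto simp: pair_weight_def r_def)
      have l1: "1 \<le> l"
      proof -
        have "exp 1 \<le> \<rho>" using main(1) exp_le by linarith
        then show ?thesis unfolding l_def using main(1) by (subst ln_ge_iff) auto
      qed
      \<comment> \<open>Since the case \<open>mod\<close> is excluded, r 4^b = 2^(a+b) / h lies
        below \<rho>, which is the logarithmic hypothesis of \<open>level_ratio_le\<close>.\<close>
      have r4: "r * 4 ^ b = 2 ^ (a + b) / h" using h by (simp add: r_def four power_add field_simps)
      have lr: "ln (r * 4 ^ b) \<le> l"
        unfolding l_def r4 using main h by (intro ln_mono) auto
      have Tl: "T * l \<le> 20 * (\<beta> * r * L)"
      proof -
        have "\<not> e \<le> 8 * \<mu>" using main(1) pos by (simp add: \<rho>_def field_simps)
        then have "e * l \<le> 20 * (y * L)"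
          using disc by (auto simp: l_def \<rho>_def \<mu>_def L_def)
        then have "2 ^ (a + b) / (n * h) * (e * l) \<le> 2 ^ (a + b) / (n * h) * (20 * (y * L))"
          using n h by (intro mult_left_mono) auto
        moreover have "2 ^ (a + b) / (n * h) * (20 * (y * L)) = 20 * (\<beta> * r * L)"
          using n h by (simp add: \<beta>_def r_def four power_add field_simps)
        ultimately show ?thesis by (simp add: T_def mult_ac)
      qed
      have L: "L = 1 + real b * ln 4 - ln \<beta>"
      proof -
        have "exp 1 * n / y = exp 1 * 4 ^ b / \<beta>" using n y by (simp add: \<beta>_def field_simps)
        then show ?thesis using pos by (simp add: L_def ln_div ln_mult ln_realpow)
      qed
      have ln4: "ln (4::real) \<le> 3 / 2"
        using ln2_le_25_over_36 ln_realpow[of 2 2] by simp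
      consider (large) "- ln \<beta> \<le> real b * ln 4" | (sl) "real b * ln 4 < - ln \<beta>" "- ln \<beta> \<le> 2 * l"
        | (ss) "real b * ln 4 < - ln \<beta>" "2 * l < - ln \<beta>" by linarith
      then show ?thesis
      proof cases
        case large
        have "real b * ln 4 \<le> real b * (3 / 2)" using ln4 by (intro mult_left_mono) auto
        then have "L \<le> 1 + 3 * real b" using large L by linarith
        then have "\<beta> * (r * L) \<le> \<beta> * (r * (1 + 3 * real b))"
          using pos r by (intro mult_left_mono) auto
        also have "\<dots> \<le> \<beta> * (8 * l * sqrt r)"
          using pos level_ratio_le[OF r l1 lr] by (intro mult_left_mono) auto
        finally have "T * l \<le> (160 * (\<beta> * sqrt r)) * l" using Tl by (simp add: mult_ac)
        then have "T \<le> 160 * (\<beta> * sqrt r)" using l1 by simp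
        then show ?thesis using wI rw pos by blast
      next
        case sl
        have "L \<le> 5 * l" using sl L l1 by linarith
        then have "\<beta> * r * L \<le> \<beta> * r * (5 * l)"
          using pos r by (intro mult_left_mono) auto
        then have "T * l \<le> (100 * (\<beta> * r)) * l" using Tl by (simp add: mult_ac)
        then have "T \<le> 100 * (\<beta> * r)" using l1 by simp
        also have "\<dots> \<le> 160 * (\<beta> * sqrt r)"
          using pos r by (intro mult_mono mult_left_mono)
            (auto intro: real_le_rsqrt simp: power2_eq_square mult_le_one)
        finally show ?thesis using wI rw pos by blast
      next
        case ss
        \<comment> \<open>Here \<beta> < \<rho>^(-2): the tiny mass of the level pays for the excess
          \<rho>, and T falls to \<alpha> h / 2^(a+b), the third summand of
          \<open>pair_weight\<close>.\<close>
        have "ln (\<rho> * \<beta>) < 0"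
          using ss main(1) pos l1 by (simp add: ln_mult l_def)
        then have lb: "\<rho> * \<beta> \<le> 1" using main(1) pos by (subst (asm) ln_less_zero_iff) auto
        have "T = \<alpha> * (h / 2 ^ (a + b)) * (\<rho> * \<beta>)" by (simp add: T)
        also have "\<dots> \<le> \<alpha> * (h / 2 ^ (a + b)) * 1"
          using lb pos h by (intro mult_left_mono) auto
        finally have "T \<le> 160 * (\<alpha> * (h / 2 ^ (a + b)))"
          using pos h by (smt (verit) mult_nonneg_nonneg divide_nonneg_nonneg zero_le_power)
        moreover have "h / 2 ^ (a + b) \<le> pair_weight h a b"
          using hq h by (auto simp: pair_weight_def)
        ultimately show ?thesis using wI pos by blast
      qed
    qed
  qed
  from goal_w[OF this] show ?thesis by (simp add: T_def \<alpha>_def \<beta>_def)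
qed

text \<open>The level that attains the maximum in \<open>disc\<close> takes the role of
  \<open>y\<close> in \<open>heavy_pair_le\<close>; the resulting bound \<open>R\<close> is
  symmetric in the two levels. Total mass 16 and row sums 8 of \<open>pair_weight\<close> give 2 *
  16 * 16 + 160 * (128 + 128) = 41472.\<close>

lemma heavy_sum_le:
  fixes h n :: real and s :: "nat \<Rightarrow> real" and e :: "nat \<Rightarrow> nat \<Rightarrow> real"
  assumes h: "1 \<le> h" and n: "0 < n" and s: "\<And>a. 0 \<le> s a"
    and mass: "(\<Sum>a<N. s a * 4 ^ a) \<le> 16 * n"
    and e: "\<And>a b. 0 \<le> e a b"
    and ex: "\<And>a b. e a b \<le> h\<^sup>2 * s a" and ey: "\<And>a b. e a b \<le> h\<^sup>2 * s b"
    and disc: "\<And>a b. 0 < s a \<Longrightarrow> 0 < s b \<Longrightarrow> e a b \<le> 8 * (h\<^sup>2 * s a * s b / n) \<or>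
      e a b * ln (e a b / (h\<^sup>2 * s a * s b / n)) \<le>
        20 * max (s a * ln (exp 1 * n / s a)) (s b * ln (exp 1 * n / s b))"
  shows "(\<Sum>a<N. \<Sum>b<N. if 4 * h \<le> 2 ^ (a + b) then 2 ^ (a + b) * e a b else 0) \<le> 42000 * (n * h)"
proof -
  define \<alpha> where "\<alpha> a = s a * 4 ^ a / n" for a
  define w where "w = pair_weight h"
  have \<alpha>: "0 \<le> \<alpha> a" for a using s n by (simp add: \<alpha>_def)
  have w: "0 \<le> w a b" for a b using h by (simp add: w_def pair_weight_nonneg)
  have sum\<alpha>: "(\<Sum>a<N. \<alpha> a) \<le> 16"
    using mass n by (simp add: \<alpha>_def sum_divide_distrib[symmetric] field_simps)
  have sum\<alpha>0: "0 \<le> (\<Sum>a<N. \<alpha> a)" using \<alpha> by (simp add: sum_nonneg)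
  have sumw: "(\<Sum>a<N. \<Sum>b<N. \<alpha> a * w a b) \<le> 128"
  proof -
    have "(\<Sum>a<N. \<Sum>b<N. \<alpha> a * w a b) = (\<Sum>a<N. \<alpha> a * (\<Sum>b<N. w a b))"
      by (simp add: sum_distrib_left)
    also have "\<dots> \<le> (\<Sum>a<N. \<alpha> a * 8)"
      unfolding w_def using \<alpha> sum_pair_weight_le[OF h] by (intro sum_mono mult_left_mono) auto
    also have "\<dots> \<le> 128" using sum\<alpha> by (simp add: sum_distrib_right[symmetric])
    finally show ?thesis .
  qed
  define R where "R a b = 2 * \<alpha> a * \<alpha> b + 160 * (\<alpha> a * w a b + \<alpha> b * w b a)" for a b
  have R0: "0 \<le> R a b" for a b unfolding R_def by (intro add_nonneg_nonneg mult_nonneg_nonneg \<alpha> w) auto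
  have Rsym: "R a b = R b a" for a b by (simp add: R_def)
  have pt: "2 ^ (a + b) * e a b / (n * h) \<le> R a b" if hv: "4 * h \<le> 2 ^ (a + b)" for a b
  proof (cases "s a = 0 \<or> s b = 0")
    case True
    then have "e a b = 0" using e[of a b] ex[of a b] ey[of a b] by (metis antisym mult_zero_right)
    then show ?thesis using R0 by simp
  next
    case False
    then have pos: "0 < s a" "0 < s b" using s by (auto simp: less_le)
    have hv': "4 * h \<le> 2 ^ (b + a)" using hv by (simp add: add.commute)
    from disc[OF pos] consider
      "e a b \<le> 8 * (h\<^sup>2 * s a * s b / n) \<or>
        e a b * ln (e a b / (h\<^sup>2 * s a * s b / n)) \<le> 20 * (s b * ln (exp 1 * n / s b))" |
      "e a b \<le> 8 * (h\<^sup>2 * s b * s a / n) \<or>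
        e a b * ln (e a b / (h\<^sup>2 * s b * s a / n)) \<le> 20 * (s a * ln (exp 1 * n / s a))"
      by (auto simp: max_def mult_ac split: if_splits)
    then show ?thesis
    proof cases
      case 1
      from heavy_pair_le[OF h n pos e ex ey hv 1] show ?thesis by (simp add: R_def \<alpha>_def w_def)
    next
      case 2
      from heavy_pair_le[OF h n pos(2,1) e ey ex hv' 2] show ?thesis
        by (subst Rsym) (simp add: R_def \<alpha>_def w_def add.commute)
    qed
  qed
  have "(\<Sum>a<N. \<Sum>b<N. if 4 * h \<le> 2 ^ (a + b) then 2 ^ (a + b) * e a b else 0) \<le>
      (\<Sum>a<N. \<Sum>b<N. (n * h) * R a b)"
  proof (intro sum_mono)
    fix a b
    show "(if 4 * h \<le> 2 ^ (a + b) then 2 ^ (a + b) * e a b else 0) \<le> n * h * R a b"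
      using pt[of a b] n h R0[of a b] by (auto simp: field_simps)
  qed
  also have "\<dots> = (n * h) * (\<Sum>a<N. \<Sum>b<N. R a b)" by (simp add: sum_distrib_left)
  also have "(\<Sum>a<N. \<Sum>b<N. R a b) = 2 * ((\<Sum>a<N. \<alpha> a) * (\<Sum>b<N. \<alpha> b)) +
      160 * ((\<Sum>a<N. \<Sum>b<N. \<alpha> a * w a b) + (\<Sum>a<N. \<Sum>b<N. \<alpha> b * w b a))"
    by (simp add: R_def sum.distrib sum_distrib_left[symmetric] sum_product mult.assoc)
  also have "(\<Sum>a<N. \<Sum>b<N. \<alpha> b * w b a) = (\<Sum>a<N. \<Sum>b<N. \<alpha> a * w a b)"
    by (rule sum.swap)
  also have "(n * h) * (2 * ((\<Sum>a<N. \<alpha> a) * (\<Sum>b<N. \<alpha> b)) + 160 * (\<dots> + \<dots>)) \<le> (n * h) * 42000"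
  proof (intro mult_left_mono)
    have "(\<Sum>a<N. \<alpha> a) * (\<Sum>b<N. \<alpha> b) \<le> 16 * 16" using sum\<alpha> sum\<alpha>0 by (intro mult_mono) auto
    then show "2 * ((\<Sum>a<N. \<alpha> a) * (\<Sum>b<N. \<alpha> b)) +
        160 * ((\<Sum>a<N. \<Sum>b<N. \<alpha> a * w a b) + (\<Sum>a<N. \<Sum>b<N. \<alpha> a * w a b)) \<le> 42000"
      using sumw by (simp add: algebra_simps)
  qed (use n h in auto)
  finally show ?thesis by (simp add: mult_ac)
qed


section \<open>Exponential moments of edge functionals\<close>

lemma finite_potential_edges: "finite (potential_edges n)"
  by (rule finite_subset[of _ "Pow {1..n}"]) (auto simp: potential_edges_def)

lemma finite_set_random_graph: "finite (set_pmf (random_graph n p))"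
  unfolding random_graph_def set_Pi_pmf[OF finite_potential_edges]
  by (rule finite_PiE_dflt[OF finite_potential_edges]) simp

definition edge_prob :: "(nat \<Rightarrow> nat \<Rightarrow> real) \<Rightarrow> nat set \<Rightarrow> real" where
  "edge_prob p e = p (Min e) (Max e)"

text \<open>Loops are left out: the diagonal changes the norm by at most 1 and is split off at the
  end, in \<open>op_norm_centered_le\<close>.\<close>

definition off_degree :: "nat \<Rightarrow> (nat set \<Rightarrow> bool) \<Rightarrow> nat \<Rightarrow> real" where
  "off_degree n G i = (\<Sum>j\<in>{1..n} - {i}. adjacency G i j)"

lemma adjacency_commute: "adjacency G i j = adjacency G j i"
  by (simp add: adjacency_def insert_commute)

lemma adjacency_bounds: "0 \<le> adjacency G i j" "adjacency G i j \<le> 1"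
  by (auto simp: adjacency_def)

text \<open>For negative u this combines exp u \<le> 1 / (1 - u) with (1 - u) (1 + u + u^2) = 1 -
  u^3 \<ge> 1.\<close>

lemma exp_le_quadratic:
  fixes u :: real
  assumes "\<bar>u\<bar> \<le> 1"
  shows "exp u \<le> 1 + u + u\<^sup>2"
proof (cases "0 \<le> u")
  case True then show ?thesis using assms exp_bound[of u] by auto
next
  case False
  have "0 \<le> - (u * u\<^sup>2)" using False by (simp add: mult_le_0_iff)
  then have "1 \<le> (1 - u) * (1 + u + u\<^sup>2)" by (simp add: algebra_simps power2_eq_square)
  then have "1 / (1 - u) \<le> 1 + u + u\<^sup>2" using False by (simp add: field_simps)
  moreover have "exp u \<le> 1 / (1 - u)"
  proof -
    have "1 - u \<le> exp (- u)" using exp_ge_add_one_self[of "- u"] by simp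
    then have "1 / exp (- u) \<le> 1 / (1 - u)" using False by (intro divide_left_mono) auto
    then show ?thesis by (simp add: exp_minus inverse_eq_divide)
  qed
  ultimately show ?thesis by simp
qed

text \<open>The left side is an elementary symmetric polynomial, a coefficient of the generating
  function that multiplies the factors 1 + x g(a). The free parameter x is later 1 for stars, 1/d
  for paths and s/n for counting subsets.\<close>

lemma sum_prod_subsets_le:
  fixes g :: "'a \<Rightarrow> real"
  assumes A: "finite A" and g: "\<And>a. a \<in> A \<Longrightarrow> 0 \<le> g a" and x: "0 < x"
  shows "(\<Sum>P | P \<subseteq> A \<and> card P = k. \<Prod>a\<in>P. g a) \<le> exp (x * (\<Sum>a\<in>A. g a)) / x ^ k"
proof -
  have "x ^ k * (\<Sum>P | P \<subseteq> A \<and> card P = k. \<Prod>a\<in>P. g a) =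
      (\<Sum>P | P \<subseteq> A \<and> card P = k. \<Prod>a\<in>P. x * g a)"
    unfolding sum_distrib_left by (intro sum.cong) (auto simp: prod.distrib)
  also have "\<dots> \<le> (\<Sum>P\<in>Pow A. \<Prod>a\<in>P. x * g a)"
    using A g x by (intro sum_mono2 prod_nonneg) auto
  also have "\<dots> = (\<Prod>a\<in>A. x * g a + 1)"
    using prod_add[OF A, of "\<lambda>a. x * g a" "\<lambda>_. 1"] by simp
  also have "\<dots> \<le> (\<Prod>a\<in>A. exp (x * g a))"
    using g x by (intro prod_mono) (auto intro: add_nonneg_nonneg simp: add.commute)
  also have "\<dots> = exp (x * (\<Sum>a\<in>A. g a))" by (simp add: exp_sum A sum_distrib_left)
  finally show ?thesis using x by (simp add: field_simps)
qed

text \<open>Upper bounds \<open>q\<close> and \<open>d\<close> in place of the maxima keep the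
  estimates free of \<open>Max\<close>. Loops are exempt from \<open>q\<close> because
  \<open>p_max\<close> ranges over i \<noteq> j only.\<close>

locale sparse_graph =
  fixes n :: nat and p :: "nat \<Rightarrow> nat \<Rightarrow> real" and q d :: real
  assumes probs: "edge_probabilities n p"
    and q_nonneg: "0 \<le> q" and p_le_q: "\<And>i j. i \<in> {1..n} \<Longrightarrow> j \<in> {1..n} \<Longrightarrow> i \<noteq> j \<Longrightarrow> p i j \<le> q"
    and degree_le: "\<And>i. i \<in> {1..n} \<Longrightarrow> (\<Sum>j\<in>{1..n}. p i j) \<le> d"
begin

abbreviation Pr :: "((nat set \<Rightarrow> bool) \<Rightarrow> bool) \<Rightarrow> real" where
  "Pr E \<equiv> measure_pmf.prob (random_graph n p) {G. E G}"

lemma p_bounds: "i \<in> {1..n} \<Longrightarrow> j \<in> {1..n} \<Longrightarrow> 0 \<le> p i j \<and> p i j \<le> 1"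
  using probs by (auto simp: edge_probabilities_def)

lemma p_commute: "i \<in> {1..n} \<Longrightarrow> j \<in> {1..n} \<Longrightarrow> p i j = p j i"
  using probs by (auto simp: edge_probabilities_def)

lemma edge_prob_pair: "i \<in> {1..n} \<Longrightarrow> j \<in> {1..n} \<Longrightarrow> edge_prob p {i, j} = p i j"
  using p_commute by (cases "i \<le> j") (auto simp: edge_prob_def min_def max_def)

lemma edge_prob_bounds: "e \<in> potential_edges n \<Longrightarrow> 0 \<le> edge_prob p e \<and> edge_prob p e \<le> 1"
  using edge_prob_pair p_bounds by (auto simp: potential_edges_def)

lemma expectation_prod_edges:
  assumes I: "I \<subseteq> potential_edges n" and f: "\<And>e b. e \<in> I \<Longrightarrow> 0 \<le> f e b"
  shows "measure_pmf.expectation (random_graph n p) (\<lambda>G. \<Prod>e\<in>I. f e (G e)) =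
    (\<Prod>e\<in>I. edge_prob p e * f e True + (1 - edge_prob p e) * f e False)"
proof -
  define g where "g e b = (if e \<in> I then f e b else (1::real))" for e b
  have "(\<Prod>e\<in>I. f e (G e)) = (\<Prod>e\<in>potential_edges n. g e (G e))" for G
    using I finite_potential_edges
    by (intro prod.mono_neutral_cong_left) (auto simp: g_def)
  then have "measure_pmf.expectation (random_graph n p) (\<lambda>G. \<Prod>e\<in>I. f e (G e)) =
      measure_pmf.expectation (random_graph n p) (\<lambda>G. \<Prod>e\<in>potential_edges n. g e (G e))"
    by simp
  also have "\<dots> = (\<Prod>e\<in>potential_edges n.
      measure_pmf.expectation (bernoulli_pmf (p (Min e) (Max e))) (g e))"
    unfolding random_graph_def
    by (rule expectation_prod_Pi_pmf[OF finite_potential_edges])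
      (auto intro: integrable_measure_pmf_finite simp: g_def f)
  also have "\<dots> = (\<Prod>e\<in>potential_edges n. edge_prob p e * g e True + (1 - edge_prob p e) * g e False)"
    using edge_prob_bounds by (intro prod.cong) (auto simp: edge_prob_def)
  also have "\<dots> = (\<Prod>e\<in>I. edge_prob p e * f e True + (1 - edge_prob p e) * f e False)"
    using I finite_potential_edges
    by (intro prod.mono_neutral_cong_right) (auto simp: g_def)
  finally show ?thesis .
qed

text \<open>Markov's inequality for a product of independent factors. A factor may be an exponential
  or an indicator, so this one form serves Chernoff bounds, prescribed edges and mixtures of
  both.\<close>

lemma prob_le_prod_edges:
  assumes I: "I \<subseteq> potential_edges n" and f: "\<And>e b. e \<in> I \<Longrightarrow> 0 \<le> f e b" and c: "0 \<le> c"
    and dom: "\<And>G. E G \<Longrightarrow> 1 \<le> c * (\<Prod>e\<in>I. f e (G e))"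
    and g: "\<And>e. e \<in> I \<Longrightarrow> edge_prob p e * f e True + (1 - edge_prob p e) * f e False \<le> g e"
  shows "Pr E \<le> c * (\<Prod>e\<in>I. g e)"
proof -
  let ?M = "random_graph n p"
  have int: "integrable (measure_pmf ?M) h" for h :: "_ \<Rightarrow> real"
    by (rule integrable_measure_pmf_finite[OF finite_set_random_graph])
  have Z: "0 \<le> c * (\<Prod>e\<in>I. f e (G e))" for G using f c by (intro mult_nonneg_nonneg prod_nonneg) auto
  have "Pr E = measure_pmf.expectation ?M (indicator {G. E G})" by simp
  also have "\<dots> \<le> measure_pmf.expectation ?M (\<lambda>G. c * (\<Prod>e\<in>I. f e (G e)))"
    by (intro integral_mono int) (auto simp: indicator_def dom Z)
  also have "\<dots> = c * (\<Prod>e\<in>I. edge_prob p e * f e True + (1 - edge_prob p e) * f e False)"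
    by (simp add: expectation_prod_edges[OF I, of f] f)
  also have "\<dots> \<le> c * (\<Prod>e\<in>I. g e)"
    using c g f edge_prob_bounds I
    by (intro mult_left_mono prod_mono conjI add_nonneg_nonneg mult_nonneg_nonneg) auto
  finally show ?thesis .
qed

lemma prob_mono: "(\<And>G. E G \<Longrightarrow> F G) \<Longrightarrow> Pr E \<le> Pr F"
  by (intro measure_pmf.finite_measure_mono) auto

lemma prob_disj_le: "Pr (\<lambda>G. E G \<or> F G) \<le> Pr E + Pr F"
proof -
  have "{G. E G \<or> F G} = {G. E G} \<union> {G. F G}" by auto
  then show ?thesis by (simp add: measure_Un_le)
qed

lemma prob_ex_le:
  assumes "finite A"
  shows "Pr (\<lambda>G. \<exists>a\<in>A. E a G) \<le> (\<Sum>a\<in>A. Pr (E a))"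
proof -
  have "{G. \<exists>a\<in>A. E a G} = (\<Union>a\<in>A. {G. E a G})" by auto
  then show ?thesis using assms by (simp add: measure_pmf.finite_measure_subadditive_finite)
qed

lemma bernoulli_exp_le:
  fixes \<theta> :: real
  shows "t * exp (\<theta> * of_bool True) + (1 - t) * exp (\<theta> * of_bool False) \<le> exp (t * (exp \<theta> - 1))"
proof -
  have "t * exp \<theta> + (1 - t) = 1 + t * (exp \<theta> - 1)" by (simp add: algebra_simps)
  also have "\<dots> \<le> exp (t * (exp \<theta> - 1))" by (rule exp_ge_add_one_self)
  finally show ?thesis by simp
qed

text \<open>The exponential moment only involves edges leaving \<open>F\<close>, which are disjoint from \<open>E\<close> and for
  different \<open>h\<close> from each other; the edges inside \<open>F\<close> cost the term \<open>card F\<close>.\<close>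

lemma prob_edges_and_high_le:
  assumes F: "F \<subseteq> {1..n}" and H: "H \<subseteq> F" and E: "E \<subseteq> {{i, j} |i j. i \<in> F \<and> j \<in> F}"
    and \<theta>: "0 \<le> \<theta>"
  shows "Pr (\<lambda>G. (\<forall>e\<in>E. G e) \<and> (\<forall>h\<in>H. \<tau> < off_degree n G h)) \<le>
    (\<Prod>e\<in>E. edge_prob p e) * exp (\<theta> * (real (card F) - \<tau>) + d * (exp \<theta> - 1)) ^ card H"
proof -
  define K where "K = (\<lambda>(h, j). {h, j}) ` (H \<times> ({1..n} - F))"
  have finF: "finite F" by (rule finite_subset[OF F]) simp
  then have finH: "finite H" by (rule finite_subset[OF H])
  have inj: "inj_on (\<lambda>(h, j). {h, j}) (H \<times> ({1..n} - F))"
    using H by (auto simp: inj_on_def doubleton_eq_iff)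
  have "e \<subseteq> F" if "e \<in> E" for e using E that by blast
  moreover have "\<not> e \<subseteq> F" if "e \<in> K" for e using that by (auto simp: K_def)
  ultimately have disj: "E \<inter> K = {}" by blast
  have sub: "E \<subseteq> potential_edges n" "K \<subseteq> potential_edges n"
  proof -
    have "{{i, j} |i j. i \<in> F \<and> j \<in> F} \<subseteq> potential_edges n"
      using F unfolding potential_edges_def by blast
    then show "E \<subseteq> potential_edges n" using E by blast
    show "K \<subseteq> potential_edges n"
    proof
      fix e assume "e \<in> K"
      then obtain h j where "h \<in> H" "j \<in> {1..n} - F" "e = {h, j}" unfolding K_def by blast
      then show "e \<in> potential_edges n" using H F unfolding potential_edges_def by blast
    qed
  qed
  have fin: "finite E" "finite K" by (rule finite_subset[OF _ finite_potential_edges], fact)+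
  \<comment> \<open>An indicator on the prescribed edges, an exponential on those from
    \<open>H\<close> to the outside of \<open>F\<close>.\<close>
  define f where "f e b = (if e \<in> E then of_bool b else exp (\<theta> * of_bool b))" for e b
  define g where "g e = (if e \<in> E then edge_prob p e else exp (edge_prob p e * (exp \<theta> - 1)))" for e
  define c where "c = exp (\<theta> * (real (card F) - \<tau>)) ^ card H"
  have splitE: "prod F (E \<union> K) = prod F E * prod F K" for F :: "nat set \<Rightarrow> real"
    using fin disj by (rule prod.union_disjoint)
  have KH: "(\<Prod>e\<in>K. u e) = (\<Prod>h\<in>H. \<Prod>j\<in>{1..n} - F. u {h, j})" for u :: "nat set \<Rightarrow> real"
    unfolding K_def by (subst prod.reindex[OF inj]) (auto simp: prod.cartesian_product intro!: prod.cong)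
  have "Pr (\<lambda>G. (\<forall>e\<in>E. G e) \<and> (\<forall>h\<in>H. \<tau> < off_degree n G h)) \<le> c * (\<Prod>e\<in>E \<union> K. g e)"
  proof (rule prob_le_prod_edges)
    show "E \<union> K \<subseteq> potential_edges n" using sub by blast
    show "0 \<le> f e b" for e b by (simp add: f_def)
    show "0 \<le> c" by (simp add: c_def)
    show "edge_prob p e * f e True + (1 - edge_prob p e) * f e False \<le> g e" for e
      using bernoulli_exp_le[of "edge_prob p e" \<theta>] by (auto simp: f_def g_def)
  next
    fix G assume G: "(\<forall>e\<in>E. G e) \<and> (\<forall>h\<in>H. \<tau> < off_degree n G h)"
    have E1: "(\<Prod>e\<in>E. f e (G e)) = 1" using G by (intro prod.neutral) (auto simp: f_def)
    have notE: "{h, j} \<notin> E" if "h \<in> H" "j \<in> {1..n} - F" for h j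
    proof -
      have "{h, j} \<in> K" unfolding K_def using that by (intro image_eqI[of _ _ "(h, j)"]) auto
      then show ?thesis using disj by blast
    qed
    have deg: "off_degree n G h \<le> real (card F) + (\<Sum>j\<in>{1..n} - F. adjacency G h j)" if "h \<in> H" for h
    proof -
      have "off_degree n G h \<le> (\<Sum>j\<in>F \<union> ({1..n} - F). adjacency G h j)"
        unfolding off_degree_def using finF F by (intro sum_mono2) (auto simp: adjacency_bounds)
      also have "\<dots> = (\<Sum>j\<in>F. adjacency G h j) + (\<Sum>j\<in>{1..n} - F. adjacency G h j)"
        using finF by (intro sum.union_disjoint) auto
      also have "(\<Sum>j\<in>F. adjacency G h j) \<le> real (card F)"
        using sum_bounded_above[of F "adjacency G h" 1] by (simp add: adjacency_bounds)
      finally show ?thesis by simp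
    qed
    have "1 \<le> (\<Prod>h\<in>H. exp (\<theta> * (real (card F) - \<tau>)) * (\<Prod>j\<in>{1..n} - F. f {h, j} (G {h, j})))"
    proof (rule prod_ge_1)
      fix h assume h: "h \<in> H"
      have "(\<Prod>j\<in>{1..n} - F. f {h, j} (G {h, j})) = (\<Prod>j\<in>{1..n} - F. exp (\<theta> * adjacency G h j))"
        using notE[OF h] by (intro prod.cong) (auto simp: f_def adjacency_def)
      also have "\<dots> = exp (\<theta> * (\<Sum>j\<in>{1..n} - F. adjacency G h j))"
        by (simp add: exp_sum sum_distrib_left)
      finally have "exp (\<theta> * (real (card F) - \<tau>)) * (\<Prod>j\<in>{1..n} - F. f {h, j} (G {h, j})) =
          exp (\<theta> * (real (card F) - \<tau> + (\<Sum>j\<in>{1..n} - F. adjacency G h j)))"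
        by (simp add: exp_add[symmetric] distrib_left)
      moreover have "0 \<le> \<theta> * (real (card F) - \<tau> + (\<Sum>j\<in>{1..n} - F. adjacency G h j))"
        using \<theta> deg[OF h] G h by (intro mult_nonneg_nonneg) auto
      ultimately show "1 \<le> exp (\<theta> * (real (card F) - \<tau>)) * (\<Prod>j\<in>{1..n} - F. f {h, j} (G {h, j}))"
        by simp
    qed
    then show "1 \<le> c * (\<Prod>e\<in>E \<union> K. f e (G e))"
      by (simp add: splitE E1 KH prod.distrib c_def)
  qed
  also have "c * (\<Prod>e\<in>E \<union> K. g e) = (\<Prod>e\<in>E. edge_prob p e) * (c * (\<Prod>e\<in>K. g e))"
  proof -
    have "(\<Prod>e\<in>E. g e) = (\<Prod>e\<in>E. edge_prob p e)" by (intro prod.cong) (auto simp: g_def)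
    then show ?thesis by (simp add: splitE)
  qed
  also have "\<dots> \<le> (\<Prod>e\<in>E. edge_prob p e) * (c * exp (d * (exp \<theta> - 1)) ^ card H)"
  proof (intro mult_left_mono)
    have "(\<Prod>e\<in>K. g e) = (\<Prod>e\<in>K. exp (edge_prob p e * (exp \<theta> - 1)))"
      using disj by (intro prod.cong) (auto simp: g_def)
    also have "\<dots> = (\<Prod>h\<in>H. \<Prod>j\<in>{1..n} - F. exp (p h j * (exp \<theta> - 1)))"
      unfolding KH using H F by (intro prod.cong) (auto simp: edge_prob_pair subset_eq)
    also have "\<dots> = (\<Prod>h\<in>H. exp ((\<Sum>j\<in>{1..n} - F. p h j) * (exp \<theta> - 1)))"
      by (simp add: exp_sum sum_distrib_right)
    also have "\<dots> \<le> (\<Prod>h\<in>H. exp (d * (exp \<theta> - 1)))"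
    proof (intro prod_mono conjI)
      fix h assume "h \<in> H"
      then have h: "h \<in> {1..n}" using H F by auto
      have "(\<Sum>j\<in>{1..n} - F. p h j) \<le> (\<Sum>j\<in>{1..n}. p h j)"
        using h p_bounds by (intro sum_mono2) auto
      then show "exp ((\<Sum>j\<in>{1..n} - F. p h j) * (exp \<theta> - 1)) \<le> exp (d * (exp \<theta> - 1))"
        using degree_le[OF h] \<theta> by (auto intro!: mult_right_mono)
    qed auto
    finally show "(\<Prod>e\<in>K. g e) \<le> exp (d * (exp \<theta> - 1)) ^ card H" by simp
    show "0 \<le> c" by (simp add: c_def)
    show "0 \<le> (\<Prod>e\<in>E. edge_prob p e)" using sub edge_prob_bounds by (intro prod_nonneg) auto
  qed
  also have "c * exp (d * (exp \<theta> - 1)) ^ card H =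
      exp (\<theta> * (real (card F) - \<tau>) + d * (exp \<theta> - 1)) ^ card H"
    by (simp add: c_def exp_add power_mult_distrib)
  finally show ?thesis .
qed

end


section \<open>Light couples and edge counts\<close>

text \<open>Passes from ordered pairs to edges, that is, from entries that occur twice to
  independent variables.\<close>

lemma sum_pairs_symmetric:
  fixes f :: "nat \<Rightarrow> nat \<Rightarrow> real"
  assumes sym: "\<And>i j. f i j = f j i" and diag: "\<And>i. f i i = 0" and A: "finite A"
  shows "(\<Sum>i\<in>A. \<Sum>j\<in>A. f i j) = 2 * (\<Sum>(i, j) | i \<in> A \<and> j \<in> A \<and> i < j. f i j)"
proof -
  let ?L = "{(i, j). i \<in> A \<and> j \<in> A \<and> i < j}" and ?U = "{(i, j). i \<in> A \<and> j \<in> A \<and> j < i}"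
  have fin: "finite ?L" "finite ?U"
    using A by (auto intro: finite_subset[of _ "A \<times> A"])
  have "(\<Sum>i\<in>A. \<Sum>j\<in>A. f i j) = (\<Sum>(i, j)\<in>A \<times> A. f i j)"
    by (simp add: sum.cartesian_product)
  also have "\<dots> = (\<Sum>(i, j)\<in>?L \<union> ?U. f i j)"
    using A diag by (intro sum.mono_neutral_right) (auto simp: not_less intro: ccontr dest: le_neq_implies_less)
  also have "\<dots> = (\<Sum>(i, j)\<in>?L. f i j) + (\<Sum>(i, j)\<in>?U. f i j)"
    using fin by (intro sum.union_disjoint) auto
  also have "(\<Sum>(i, j)\<in>?U. f i j) = (\<Sum>(i, j)\<in>?L. f i j)"
    by (rule sum.reindex_bij_witness[of _ "\<lambda>(i, j). (j, i)" "\<lambda>(i, j). (j, i)"]) (auto simp: sym)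
  finally show ?thesis by simp
qed

text \<open>Vectors are scaled by 4 sqrt n to have integer entries, so the cut-off 16 sqrt D on z i
  z j is sqrt D / n on the unit ball.\<close>

definition light_form ::
    "nat \<Rightarrow> (nat \<Rightarrow> nat \<Rightarrow> real) \<Rightarrow> real \<Rightarrow> (nat set \<Rightarrow> bool) \<Rightarrow> (nat \<Rightarrow> real) \<Rightarrow> real" where
  "light_form n p D G z = (\<Sum>i\<in>{1..n}. \<Sum>j\<in>{1..n}.
     if i \<noteq> j \<and> \<bar>z i * z j\<bar> \<le> 16 * sqrt D then (adjacency G i j - p i j) * z i * z j else 0)"

text \<open>Edges are sets, so an edge with both ends in \<open>S\<close> \<inter> \<open>T\<close>
  counts once and the counted variables are independent.\<close>

definition edges_between :: "nat set \<Rightarrow> nat set \<Rightarrow> nat set set" where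
  "edges_between S T = {{i, j} |i j. i \<in> S \<and> j \<in> T \<and> i \<noteq> j}"

definition edge_count :: "(nat set \<Rightarrow> bool) \<Rightarrow> nat set \<Rightarrow> nat set \<Rightarrow> nat" where
  "edge_count G S T = card {e \<in> edges_between S T. G e}"

lemma edges_between_image: "edges_between S T \<subseteq> (\<lambda>(i, j). {i, j}) ` (S \<times> T)"
  by (auto simp: edges_between_def)

lemma finite_edges_between: "finite S \<Longrightarrow> finite T \<Longrightarrow> finite (edges_between S T)"
  by (rule finite_subset[OF edges_between_image]) auto

lemma card_edges_between: "finite S \<Longrightarrow> finite T \<Longrightarrow> card (edges_between S T) \<le> card S * card T"
  using surj_card_le[OF _ edges_between_image[of S T]] by (simp add: card_cartesian_product)

text \<open>The points of the unit ball with coordinates in the integer multiples of 1 / (4 sqrt n),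
  stored as integer vectors. Rounding each coordinate by at most one unit moves a vector by at most
  1/4. Functions are extensional so that the set is finite.\<close>

definition int_net :: "nat \<Rightarrow> (nat \<Rightarrow> int) set" where
  "int_net n = {m \<in> {1..n} \<rightarrow>\<^sub>E UNIV. (\<Sum>i\<in>{1..n}. (real_of_int (m i))\<^sup>2) \<le> 16 * real n}"

lemma int_net_subset: "int_net n \<subseteq> ({1..n} \<rightarrow>\<^sub>E {- int (16 * n)..int (16 * n)})"
proof
  fix m assume m: "m \<in> int_net n"
  have "m i \<in> {- int (16 * n)..int (16 * n)}" if i: "i \<in> {1..n}" for i
  proof -
    have "(real_of_int (m i))\<^sup>2 \<le> (\<Sum>i\<in>{1..n}. (real_of_int (m i))\<^sup>2)"
      using i by (intro member_le_sum) auto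
    then have "real_of_int ((m i)\<^sup>2) \<le> real_of_int (int (16 * n))" using m by (simp add: int_net_def)
    then have sq: "(m i)\<^sup>2 \<le> int (16 * n)" by linarith
    have "\<bar>m i\<bar> \<le> (m i)\<^sup>2"
    proof (cases "m i = 0")
      case False
      then have "\<bar>m i\<bar> * 1 \<le> \<bar>m i\<bar> * \<bar>m i\<bar>" by (intro mult_left_mono) auto
      then show ?thesis by (simp add: power2_eq_square)
    qed simp
    then show ?thesis using sq by auto
  qed
  then show "m \<in> {1..n} \<rightarrow>\<^sub>E {- int (16 * n)..int (16 * n)}"
    using m by (auto simp: int_net_def PiE_def Pi_def)
qed

lemma finite_int_net: "finite (int_net n)"
  by (rule finite_subset[OF int_net_subset]) (auto intro: finite_PiE)

text \<open>Subtracting 2 exp (-N) makes the bound inductive: the two new terms are at most 2 exp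
  (-(N+1)), and the slack gained is at least that, since e \<ge> 2.\<close>

lemma sum_gauss_int_le: "(\<Sum>y\<in>{- int N..int N}. exp (- (real_of_int y)\<^sup>2)) \<le> 3 - 2 * exp (- real N)"
proof (induction N)
  case (Suc N)
  have eq: "{- int (Suc N)..int (Suc N)} = insert (- int (Suc N)) (insert (int (Suc N)) {- int N..int N})"
    by auto
  have sq: "exp (- (real (Suc N))\<^sup>2) \<le> exp (- real (Suc N))"
    by (simp add: self_le_power del: of_nat_Suc)
  have "2 * exp (- real (Suc N)) + 2 * exp (- real (Suc N)) \<le> 2 * exp (- real N)"
  proof -
    have "exp (- real N) = exp 1 * exp (- real (Suc N))" by (simp flip: exp_add)
    moreover have "2 * exp (- real (Suc N)) \<le> exp 1 * exp (- real (Suc N))"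
      using exp_ge_add_one_self[of 1] by (intro mult_right_mono) auto
    ultimately show ?thesis by simp
  qed
  moreover have "(\<Sum>y\<in>{- int (Suc N)..int (Suc N)}. exp (- (real_of_int y)\<^sup>2)) =
      2 * exp (- (real (Suc N))\<^sup>2) + (\<Sum>y\<in>{- int N..int N}. exp (- (real_of_int y)\<^sup>2))"
    unfolding eq by (subst sum.insert; simp del: of_nat_Suc)+
  ultimately show ?case using Suc sq by linarith
qed simp

text \<open>Each net point has weight at least 1 under exp (16 n) times a product of Gaussian
  factors. Over the enclosing box this weight factorizes into one-dimensional sums, each at most 3
  \<le> exp 2; hence 18 = 16 + 2.\<close>

lemma card_int_net: "real (card (int_net n)) \<le> exp (18 * real n)"
proof -
  let ?B = "{- int (16 * n)..int (16 * n)}"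
  have "real (card (int_net n)) = (\<Sum>m\<in>int_net n. 1)" by simp
  also have "\<dots> \<le> (\<Sum>m\<in>int_net n. exp (16 * real n) * (\<Prod>i\<in>{1..n}. exp (- (real_of_int (m i))\<^sup>2)))"
  proof (rule sum_mono)
    fix m assume "m \<in> int_net n"
    then have "0 \<le> 16 * real n + (\<Sum>i\<in>{1..n}. - (real_of_int (m i))\<^sup>2)"
      by (simp add: int_net_def sum_negf)
    then have "1 \<le> exp (16 * real n + (\<Sum>i\<in>{1..n}. - (real_of_int (m i))\<^sup>2))" by simp
    then show "1 \<le> exp (16 * real n) * (\<Prod>i\<in>{1..n}. exp (- (real_of_int (m i))\<^sup>2))"
      by (simp only: exp_add exp_sum finite_atLeastAtMost)
  qed
  also have "\<dots> \<le> (\<Sum>m\<in>{1..n} \<rightarrow>\<^sub>E ?B. exp (16 * real n) * (\<Prod>i\<in>{1..n}. exp (- (real_of_int (m i))\<^sup>2)))"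
    by (intro sum_mono2 int_net_subset finite_PiE mult_nonneg_nonneg prod_nonneg) auto
  also have "\<dots> = exp (16 * real n) * (\<Prod>i\<in>{1..n}. \<Sum>y\<in>?B. exp (- (real_of_int y)\<^sup>2))"
    by (subst prod_sum_PiE) (auto simp: sum_distrib_left)
  also have "\<dots> \<le> exp (16 * real n) * (\<Prod>i\<in>{1..n}. exp 2)"
  proof (intro mult_left_mono prod_mono conjI sum_nonneg)
    have "(3::real) \<le> exp 2" using exp_ge_add_one_self[of 2] by simp
    then show "(\<Sum>y\<in>?B. exp (- (real_of_int y)\<^sup>2)) \<le> exp 2"
      using sum_gauss_int_le[of "16 * n"] exp_gt_zero[of "- real (16 * n)"] by linarith
  qed auto
  also have "\<dots> = exp (18 * real n)" by (simp add: exp_of_nat_mult[symmetric] exp_add[symmetric])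
  finally show ?thesis .
qed

context sparse_graph
begin

text \<open>The choice t = 1 / (32 sqrt D) is the largest for which lightness gives |t c e| \<le> 1,
  so that \<open>exp_le_quadratic\<close> applies. The quadratic terms sum to at most q / (256 D) *
  (16 n)^2 \<le> n, while the threshold contributes t * 640 n sqrt D = 20 n. The result, exp (-19
  n), beats the exp (18 n) points of the net. The sign \<open>s\<close> treats both tails.\<close>

lemma prob_light_form_le:
  assumes D: "0 < D" "real n * q \<le> D" and z: "(\<Sum>i\<in>{1..n}. (z i)\<^sup>2) \<le> 16 * real n"
    and s: "\<bar>s\<bar> = 1"
  shows "Pr (\<lambda>G. 640 * real n * sqrt D < s * light_form n p D G z) \<le> exp (- 19 * real n)"
proof -
  define V where "V = {1..n}"
  define I where "I = {(i, j). i \<in> V \<and> j \<in> V \<and> i < j \<and> \<bar>z i * z j\<bar> \<le> 16 * sqrt D}"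
  define K where "K = (\<lambda>(i, j). {i, j}) ` I"
  define t where "t = 1 / (32 * sqrt D)"
  define c where "c e = 2 * s * z (Min e) * z (Max e)" for e :: "nat set"
  have s2: "s * s = 1" using s by (auto simp: abs_if split: if_splits)
  have finI: "finite I" by (rule finite_subset[of _ "V \<times> V"]) (auto simp: I_def V_def)
  have inj: "inj_on (\<lambda>(i, j). {i, j}) I" by (auto simp: inj_on_def I_def doubleton_eq_iff)
  have reix: "(\<Sum>e\<in>K. h e) = (\<Sum>(i, j)\<in>I. h {i, j})" for h :: "nat set \<Rightarrow> real"
    unfolding K_def by (subst sum.reindex[OF inj]) (auto intro!: sum.cong)
  have cij: "c {i, j} = 2 * s * z i * z j" if "(i, j) \<in> I" for i j
    using that by (auto simp: c_def I_def min_def max_def)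
  have finK: "finite K" using finI by (simp add: K_def)
  have K: "K \<subseteq> potential_edges n"
    by (auto simp: K_def I_def V_def potential_edges_def)
  have form: "s * light_form n p D G z = (\<Sum>e\<in>K. c e * (of_bool (G e) - edge_prob p e))" for G
  proof -
    let ?f = "\<lambda>i j. if i \<noteq> j \<and> \<bar>z i * z j\<bar> \<le> 16 * sqrt D
      then (adjacency G i j - edge_prob p {i, j}) * z i * z j else 0"
    have "light_form n p D G z = (\<Sum>i\<in>V. \<Sum>j\<in>V. ?f i j)"
      unfolding light_form_def V_def by (intro sum.cong) (auto simp: edge_prob_pair)
    also have "\<dots> = 2 * (\<Sum>(i, j) | i \<in> V \<and> j \<in> V \<and> i < j. ?f i j)"
      by (rule sum_pairs_symmetric) (auto simp: V_def mult_ac adjacency_commute insert_commute)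
    also have "(\<Sum>(i, j) | i \<in> V \<and> j \<in> V \<and> i < j. ?f i j) =
        (\<Sum>(i, j)\<in>I. (adjacency G i j - edge_prob p {i, j}) * z i * z j)"
    proof (rule sum.mono_neutral_cong_right)
      show "finite {(i, j). i \<in> V \<and> j \<in> V \<and> i < j}"
        by (rule finite_subset[of _ "V \<times> V"]) (auto simp: V_def)
    qed (auto simp: I_def split: if_splits)
    finally have "s * light_form n p D G z =
        (\<Sum>(i, j)\<in>I. 2 * s * z i * z j * (of_bool (G {i, j}) - edge_prob p {i, j}))"
      by (simp add: sum_distrib_left adjacency_def mult_ac case_prod_unfold del: right_diff_distrib_numeral)
    also have "\<dots> = (\<Sum>(i, j)\<in>I. c {i, j} * (of_bool (G {i, j}) - edge_prob p {i, j}))"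
      by (intro sum.cong) (auto simp: cij)
    finally show ?thesis by (simp add: reix)
  qed
  have tc: "\<bar>t * c e\<bar> \<le> 1" if e: "e \<in> K" for e
  proof -
    obtain x where x: "x \<in> I" "e = (\<lambda>(i, j). {i, j}) x" using e unfolding K_def by blast
    obtain i j where "x = (i, j)" by (cases x)
    with x have ij: "(i, j) \<in> I" "e = {i, j}" by auto
    have "\<bar>t * c e\<bar> = \<bar>z i * z j\<bar> / (16 * sqrt D)"
      using ij D s by (simp add: cij t_def abs_mult)
    also have "\<dots> \<le> 1" using ij D by (simp add: I_def)
    finally show ?thesis .
  qed
  define f where "f e b = exp (t * (c e * (of_bool b - edge_prob p e)))" for e b
  define g where "g e = exp (edge_prob p e * (t * c e)\<^sup>2)" for e
  have "Pr (\<lambda>G. 640 * real n * sqrt D < s * light_form n p D G z) \<le> exp (- 20 * real n) * (\<Prod>e\<in>K. g e)"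
  proof (rule prob_le_prod_edges[OF K])
    show "0 \<le> f e b" for e b by (simp add: f_def)
    show "0 \<le> exp (- 20 * real n)" by simp
  next
    fix G assume "640 * real n * sqrt D < s * light_form n p D G z"
    then have "t * (640 * real n * sqrt D) \<le> t * (s * light_form n p D G z)"
      using D by (intro mult_left_mono) (auto simp: t_def)
    moreover have "t * (640 * real n * sqrt D) = 20 * real n" using D by (simp add: t_def)
    ultimately have "1 \<le> exp (- 20 * real n + t * (s * light_form n p D G z))" by simp
    also have "\<dots> = exp (- 20 * real n) * (\<Prod>e\<in>K. f e (G e))"
      by (simp only: exp_add form sum_distrib_left exp_sum[OF finK] f_def)
    finally show "1 \<le> exp (- 20 * real n) * (\<Prod>e\<in>K. f e (G e))" .
  next
    fix e assume e: "e \<in> K"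
    define u where "u = t * c e"
    define r where "r = edge_prob p e"
    have r: "0 \<le> r" "r \<le> 1" using edge_prob_bounds e K by (auto simp: r_def)
    have "r * f e True + (1 - r) * f e False = exp (- u * r) * (1 + r * (exp u - 1))"
      by (simp add: f_def u_def r_def algebra_simps flip: exp_add)
    also have "\<dots> \<le> exp (- u * r) * exp (r * (exp u - 1))"
      by (intro mult_left_mono exp_ge_add_one_self) auto
    also have "\<dots> \<le> exp (- u * r) * exp (r * (u + u\<^sup>2))"
    proof -
      have "r * (exp u - 1) \<le> r * (u + u\<^sup>2)"
        using exp_le_quadratic[of u] tc[OF e] r by (intro mult_left_mono) (auto simp: u_def)
      then show ?thesis by simp
    qed
    also have "\<dots> = g e" by (simp add: g_def u_def r_def algebra_simps flip: exp_add)
    finally show "edge_prob p e * f e True + (1 - edge_prob p e) * f e False \<le> g e"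
      by (simp add: r_def)
  qed
  also have "(\<Prod>e\<in>K. g e) \<le> exp (real n)"
  proof -
    have "(\<Prod>e\<in>K. g e) = exp (\<Sum>e\<in>K. edge_prob p e * (t * c e)\<^sup>2)"
      by (simp add: g_def exp_sum finK)
    also have "(\<Sum>e\<in>K. edge_prob p e * (t * c e)\<^sup>2) \<le> real n"
    proof -
      have "(\<Sum>e\<in>K. edge_prob p e * (t * c e)\<^sup>2) = (\<Sum>(i, j)\<in>I. edge_prob p {i, j} * (t * c {i, j})\<^sup>2)"
        by (simp add: reix)
      also have "\<dots> \<le> (\<Sum>(i, j)\<in>I. q / (256 * D) * ((z i)\<^sup>2 * (z j)\<^sup>2))"
      proof (intro sum_mono, clarify)
        fix i j assume ij: "(i, j) \<in> I"
        have "(t * c {i, j})\<^sup>2 = (z i)\<^sup>2 * (z j)\<^sup>2 * (s * s) / (256 * D)"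
          using D by (simp add: cij[OF ij] t_def power2_eq_square field_simps)
        moreover have "edge_prob p {i, j} \<le> q"
          using ij by (auto simp: I_def V_def edge_prob_pair intro: p_le_q)
        ultimately show "edge_prob p {i, j} * (t * c {i, j})\<^sup>2 \<le> q / (256 * D) * ((z i)\<^sup>2 * (z j)\<^sup>2)"
          using D mult_right_mono[of "edge_prob p {i, j}" q "(z i)\<^sup>2 * (z j)\<^sup>2 / (256 * D)"] by (simp add: s2)
      qed
      also have "\<dots> \<le> (\<Sum>(i, j)\<in>V \<times> V. q / (256 * D) * ((z i)\<^sup>2 * (z j)\<^sup>2))"
        using D q_nonneg by (intro sum_mono2) (auto simp: V_def I_def)
      also have "\<dots> = q / (256 * D) * ((\<Sum>i\<in>V. (z i)\<^sup>2) * (\<Sum>j\<in>V. (z j)\<^sup>2))"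
        unfolding sum_product unfolding sum.cartesian_product sum_distrib_left case_prod_unfold ..
      also have "\<dots> \<le> q / (256 * D) * ((16 * real n) * (16 * real n))"
        using z D q_nonneg by (intro mult_left_mono mult_mono) (auto simp: V_def sum_nonneg)
      also have "\<dots> = real n * (real n * q / D)" by simp
      also have "\<dots> \<le> real n * 1" using D by (intro mult_left_mono) auto
      finally show ?thesis by simp
    qed
    finally show ?thesis by simp
  qed
  also have "exp (- 20 * real n) * exp (real n) = exp (- 19 * real n)" by (simp flip: exp_add)
  finally show ?thesis by simp
qed

lemma prob_net_le:
  assumes D: "0 < D" "real n * q \<le> D"
  shows "Pr (\<lambda>G. \<exists>m\<in>int_net n. 640 * real n * sqrt D < \<bar>light_form n p D G (\<lambda>i. real_of_int (m i))\<bar>)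
    \<le> 2 * exp (- real n)"
proof -
  let ?E = "\<lambda>m G. 640 * real n * sqrt D < \<bar>light_form n p D G (\<lambda>i. real_of_int (m i))\<bar>"
  have each: "Pr (?E m) \<le> 2 * exp (- 19 * real n)" if m: "m \<in> int_net n" for m
  proof -
    let ?z = "\<lambda>i. real_of_int (m i)"
    have "Pr (?E m) \<le> Pr (\<lambda>G. 640 * real n * sqrt D < 1 * light_form n p D G ?z \<or>
        640 * real n * sqrt D < (-1) * light_form n p D G ?z)"
      by (rule prob_mono) auto
    also have "\<dots> \<le> exp (- 19 * real n) + exp (- 19 * real n)"
      using m by (intro order.trans[OF prob_disj_le] add_mono prob_light_form_le[OF D])
        (auto simp: int_net_def)
    finally show ?thesis by simp
  qed
  have "Pr (\<lambda>G. \<exists>m\<in>int_net n. ?E m G) \<le> (\<Sum>m\<in>int_net n. Pr (?E m))"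
    by (rule prob_ex_le[OF finite_int_net])
  also have "\<dots> \<le> (\<Sum>m\<in>int_net n. 2 * exp (- 19 * real n))" by (intro sum_mono each)
  also have "\<dots> \<le> exp (18 * real n) * (2 * exp (- 19 * real n))"
    using card_int_net[of n] by (simp add: mult_right_mono)
  also have "\<dots> = 2 * exp (- real n)" by (simp flip: exp_add)
  finally show ?thesis .
qed

text \<open>Chernoff's bound at \<theta> = ln (k / \<mu>). Since k \<ge> 8 \<mu>, \<theta> is at
  least ln 8 \<ge> 2, so the compensating term, at most \<mu> exp \<theta> = k, uses up at most half
  of k \<theta>.\<close>

lemma prob_edge_count_ge:
  assumes S: "S \<subseteq> {1..n}" and T: "T \<subseteq> {1..n}" and D: "real n * q \<le> D" and n: "0 < n"
    and \<mu>: "\<mu> = D * real (card S) * real (card T) / real n" "0 < \<mu>" and k: "8 * \<mu> \<le> k"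
  shows "Pr (\<lambda>G. k \<le> real (edge_count G S T)) \<le> exp (- (k * ln (k / \<mu>)) / 2)"
proof -
  define \<theta> where "\<theta> = ln (k / \<mu>)"
  let ?K = "edges_between S T"
  have k8: "8 \<le> k / \<mu>" using k \<mu>(2) by (simp add: le_divide_eq)
  have k0: "0 < k" using k \<mu> by linarith
  have "2 \<le> ln (8::real)" using ln2_ge_two_thirds ln_realpow[of 2 3] by simp
  also have "\<dots> \<le> \<theta>" unfolding \<theta>_def using k8 by (intro ln_mono) auto
  finally have \<theta>: "2 \<le> \<theta>" .
  have e\<theta>: "exp \<theta> = k / \<mu>" using k8 by (simp add: \<theta>_def)
  have fin: "finite S" "finite T" using S T by (auto intro: finite_subset)
  have finK: "finite ?K" by (intro finite_edges_between fin)
  have K: "?K \<subseteq> potential_edges n" using S T unfolding edges_between_def potential_edges_def by blast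
  have "Pr (\<lambda>G. k \<le> real (edge_count G S T)) \<le>
      exp (- \<theta> * k) * (\<Prod>e\<in>?K. exp (edge_prob p e * (exp \<theta> - 1)))"
  proof (rule prob_le_prod_edges[OF K, where f = "\<lambda>e b. exp (\<theta> * of_bool b)"])
    fix G assume G: "k \<le> real (edge_count G S T)"
    have "(\<Sum>e\<in>?K. of_bool (G e)) = real (edge_count G S T)"
      using finK by (simp add: edge_count_def Int_def)
    then have "0 \<le> - \<theta> * k + (\<Sum>e\<in>?K. \<theta> * of_bool (G e))"
      using G \<theta> by (simp add: sum_distrib_left[symmetric] mult_left_mono)
    then have "1 \<le> exp (- \<theta> * k + (\<Sum>e\<in>?K. \<theta> * of_bool (G e)))" by simp
    then show "1 \<le> exp (- \<theta> * k) * (\<Prod>e\<in>?K. exp (\<theta> * of_bool (G e)))"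
      by (simp only: exp_add exp_sum[OF finK])
  qed (use bernoulli_exp_le in auto)
  also have "(\<Prod>e\<in>?K. exp (edge_prob p e * (exp \<theta> - 1))) = exp (\<Sum>e\<in>?K. edge_prob p e * (exp \<theta> - 1))"
    by (simp add: exp_sum finK)
  also have "(\<Sum>e\<in>?K. edge_prob p e * (exp \<theta> - 1)) \<le> k"
  proof -
    have "(\<Sum>e\<in>?K. edge_prob p e * (exp \<theta> - 1)) \<le> (\<Sum>e\<in>?K. q * exp \<theta>)"
    proof (rule sum_mono)
      fix e assume "e \<in> ?K"
      then have "edge_prob p e \<le> q" "0 \<le> edge_prob p e"
        using S T edge_prob_bounds K by (auto simp: edges_between_def edge_prob_pair subset_eq intro!: p_le_q)
      then show "edge_prob p e * (exp \<theta> - 1) \<le> q * exp \<theta>"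
        using \<theta> by (intro mult_mono) auto
    qed
    also have "\<dots> = real (card ?K) * (q * exp \<theta>)" by simp
    also have "\<dots> \<le> real (card S * card T) * (q * exp \<theta>)"
      using card_edges_between[OF fin] q_nonneg by (intro mult_right_mono of_nat_mono) auto
    also have "\<dots> \<le> real (card S * card T) * (D / real n * exp \<theta>)"
      using D n by (intro mult_left_mono mult_right_mono) (auto simp: field_simps)
    also have "\<dots> = \<mu> * exp \<theta>" by (simp add: \<mu>(1))
    also have "\<dots> = k" using \<mu>(2) by (simp add: e\<theta>)
    finally show ?thesis .
  qed
  also have "exp (- \<theta> * k) * exp k \<le> exp (- (k * \<theta>) / 2)"
  proof -
    have "k * 2 \<le> k * \<theta>" using \<theta> k0 by (intro mult_left_mono) auto
    then have "- \<theta> * k + k \<le> - (k * \<theta>) / 2" by (simp add: mult.commute)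
    then show ?thesis by (simp only: exp_add[symmetric] exp_le_cancel_iff)
  qed
  finally show ?thesis by (simp add: \<theta>_def)
qed

end


section \<open>Probabilities of the exceptional events\<close>

text \<open>A bound for the logarithm of n choose s, the price of a union bound over sets of size
  s.\<close>

definition set_entropy :: "nat \<Rightarrow> nat \<Rightarrow> real" where
  "set_entropy n s = real s * ln (exp 1 * real n / real s)"

text \<open>The maximum of the two entropies replaces their sum at the cost of turning 10 into 20,
  so that later a single level has to be weighed against the logarithm.\<close>

definition discrepancy :: "nat \<Rightarrow> real \<Rightarrow> (nat set \<Rightarrow> bool) \<Rightarrow> bool" where
  "discrepancy n D G \<longleftrightarrow> (\<forall>S T. S \<subseteq> {1..n} \<and> T \<subseteq> {1..n} \<and> S \<noteq> {} \<and> T \<noteq> {} \<longrightarrow>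
     real (edge_count G S T) \<le> 8 * (D * real (card S) * real (card T) / real n) \<or>
     real (edge_count G S T) * ln (real (edge_count G S T) / (D * real (card S) * real (card T) / real n))
       \<le> 20 * max (set_entropy n (card S)) (set_entropy n (card T)))"

text \<open>The generating function bound at x = s / n.\<close>

lemma card_subsets_le_exp_entropy:
  assumes s: "0 < s" "s \<le> n"
  shows "real (card {S. S \<subseteq> {1..n} \<and> card S = s}) \<le> exp (set_entropy n s)"
proof -
  have "real (card {S. S \<subseteq> {1..n} \<and> card S = s}) = (\<Sum>S | S \<subseteq> {1..n} \<and> card S = s. \<Prod>a\<in>S. 1)"
    by simp
  also have "\<dots> \<le> exp (real s / real n * (\<Sum>a\<in>{1..n}. 1)) / (real s / real n) ^ s"
    using s by (intro sum_prod_subsets_le) auto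
  also have "\<dots> = exp (real s) * (real n / real s) ^ s"
    using s by (simp add: power_divide)
  also have "(real n / real s) ^ s = exp (real s * ln (real n / real s))"
    using s by (simp add: exp_of_nat_mult)
  also have "exp (real s) * \<dots> = exp (set_entropy n s)"
    using s by (simp add: set_entropy_def exp_add[symmetric] ln_mult ln_div algebra_simps)
  finally show ?thesis .
qed

text \<open>Lets spare multiples of the entropy pay for powers of n, also for small sets.\<close>

lemma ln_le_set_entropy:
  assumes s: "0 < s" "s \<le> n"
  shows "ln (real n) \<le> set_entropy n s"
proof -
  have "ln (real s) \<le> real s - 1" using ln_le_minus_one[of "real s"] s by simp
  moreover have "(real s - 1) * ln (real s) \<le> (real s - 1) * ln (real n)"
    using s by (intro mult_left_mono) auto
  moreover have "set_entropy n s = real s + real s * ln (real n) - real s * ln (real s)"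
    using s by (simp add: set_entropy_def ln_mult ln_div algebra_simps)
  ultimately show ?thesis by (simp add: algebra_simps)
qed

text \<open>Of the five multiples of the entropy, one pays for the number of sets of a given size
  and four give n^(-4); summing over the n sizes leaves n^(-3).\<close>

lemma sum_exp_entropy_le:
  assumes n: "0 < n"
  shows "(\<Sum>S\<in>Pow {1..n} - {{}}. exp (- 5 * set_entropy n (card S))) \<le> 1 / real n ^ 3"
proof -
  let ?P = "Pow {1..n} - {{}}"
  have "(\<Sum>S\<in>?P. exp (- 5 * set_entropy n (card S))) =
      (\<Sum>s\<in>{1..n}. \<Sum>S | S \<in> ?P \<and> card S = s. exp (- 5 * set_entropy n (card S)))"
  proof (rule sum.group[symmetric])
    show "card ` ?P \<subseteq> {1..n}"
    proof (rule image_subsetI)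
      fix S assume "S \<in> ?P"
      then have S: "S \<subseteq> {1..n}" "S \<noteq> {}" by auto
      then have "finite S" by (auto intro: finite_subset)
      then show "card S \<in> {1..n}" using S card_mono[OF _ S(1)] by (auto simp: Suc_le_eq card_gt_0_iff)
    qed
  qed auto
  also have "\<dots> \<le> (\<Sum>s\<in>{1..n}. 1 / real n ^ 4)"
  proof (rule sum_mono)
    fix s assume "s \<in> {1..n}"
    then have s: "0 < s" "s \<le> n" by auto
    have "(\<Sum>S | S \<in> ?P \<and> card S = s. exp (- 5 * set_entropy n (card S))) \<le>
        (\<Sum>S | S \<subseteq> {1..n} \<and> card S = s. exp (- 5 * set_entropy n s))"
    proof -
      have "(\<Sum>S | S \<in> ?P \<and> card S = s. exp (- 5 * set_entropy n (card S))) =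
          (\<Sum>S | S \<in> ?P \<and> card S = s. exp (- 5 * set_entropy n s))"
        by (rule sum.cong) auto
      also have "\<dots> \<le> (\<Sum>S | S \<subseteq> {1..n} \<and> card S = s. exp (- 5 * set_entropy n s))"
        by (rule sum_mono2) (auto intro: finite_subset[of _ "Pow {1..n}"])
      finally show ?thesis .
    qed
    also have "\<dots> = real (card {S. S \<subseteq> {1..n} \<and> card S = s}) * exp (- 5 * set_entropy n s)" by simp
    also have "\<dots> \<le> exp (set_entropy n s) * exp (- 5 * set_entropy n s)"
      by (intro mult_right_mono card_subsets_le_exp_entropy s) auto
    also have "\<dots> = exp (- 4 * set_entropy n s)" by (simp flip: exp_add)
    also have "\<dots> \<le> exp (- (real 4 * ln (real n)))"
      using ln_le_set_entropy[OF s] by simp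
    also have "\<dots> = 1 / real n ^ 4"
      using n by (simp only: exp_minus exp_of_nat_mult) (simp add: inverse_eq_divide)
    finally show "(\<Sum>S | S \<in> ?P \<and> card S = s. exp (- 5 * set_entropy n (card S))) \<le> 1 / real n ^ 4" .
  qed
  also have "\<dots> = 1 / real n ^ 3" using n by (simp add: power_numeral_reduce)
  finally show ?thesis .
qed

context sparse_graph
begin

text \<open>The event concerns a function of the random count itself. A union over the at most n^2
  positive values of the count avoids inverting k ln (k / \<mu>).\<close>

lemma prob_bad_pair_le:
  assumes S: "S \<subseteq> {1..n}" "S \<noteq> {}" and T: "T \<subseteq> {1..n}" "T \<noteq> {}"
    and D: "0 < D" "real n * q \<le> D" and n: "0 < n"
  defines "\<mu> \<equiv> D * real (card S) * real (card T) / real n"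
  defines "\<phi> \<equiv> set_entropy n (card S) + set_entropy n (card T)"
  shows "Pr (\<lambda>G. 8 * \<mu> < real (edge_count G S T) \<and>
      10 * \<phi> < real (edge_count G S T) * ln (real (edge_count G S T) / \<mu>)) \<le> real n ^ 2 * exp (- 5 * \<phi>)"
proof -
  let ?c = "\<lambda>k::nat. 8 * \<mu> < real k \<and> 10 * \<phi> < real k * ln (real k / \<mu>)"
  have fin: "finite S" "finite T" using S T by (auto intro: finite_subset)
  have pos: "0 < \<mu>" using S T fin D n by (simp add: \<mu>_def card_gt_0_iff)
  have le: "edge_count G S T \<le> n ^ 2" for G
  proof -
    have "edge_count G S T \<le> card (edges_between S T)"
      unfolding edge_count_def by (intro card_mono finite_edges_between fin) auto
    also have "\<dots> \<le> card S * card T" by (rule card_edges_between[OF fin])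
    also have "\<dots> \<le> n * n" using S T card_mono[of "{1..n}"] by (intro mult_mono) fastforce+
    finally show ?thesis by (simp add: power2_eq_square)
  qed
  have "Pr (\<lambda>G. ?c (edge_count G S T)) \<le> Pr (\<lambda>G. \<exists>k\<in>{1..n ^ 2}. ?c k \<and> real k \<le> real (edge_count G S T))"
  proof (rule prob_mono)
    fix G assume G: "?c (edge_count G S T)"
    then have "0 < edge_count G S T" using pos by (cases "edge_count G S T") auto
    then show "\<exists>k\<in>{1..n ^ 2}. ?c k \<and> real k \<le> real (edge_count G S T)"
      using G le by (intro bexI[of _ "edge_count G S T"]) auto
  qed
  also have "\<dots> \<le> (\<Sum>k\<in>{1..n ^ 2}. Pr (\<lambda>G. ?c k \<and> real k \<le> real (edge_count G S T)))"
    by (rule prob_ex_le) simp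
  also have "\<dots> \<le> (\<Sum>k\<in>{1..n ^ 2}. exp (- 5 * \<phi>))"
  proof (rule sum_mono)
    fix k
    show "Pr (\<lambda>G. ?c k \<and> real k \<le> real (edge_count G S T)) \<le> exp (- 5 * \<phi>)"
    proof (cases "?c k")
      case True
      have "Pr (\<lambda>G. ?c k \<and> real k \<le> real (edge_count G S T)) \<le> Pr (\<lambda>G. real k \<le> real (edge_count G S T))"
        by (rule prob_mono) simp
      also have "\<dots> \<le> exp (- (real k * ln (real k / \<mu>)) / 2)"
        using True pos by (intro prob_edge_count_ge[OF S(1) T(1) D(2) n]) (auto simp: \<mu>_def)
      also have "\<dots> \<le> exp (- 5 * \<phi>)" using True by simp
      finally show ?thesis .
    next
      case False
      then have empty: "{G. ?c k \<and> real k \<le> real (edge_count G S T)} = {}" by blast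
      show ?thesis unfolding empty by simp
    qed
  qed
  also have "\<dots> = real n ^ 2 * exp (- 5 * \<phi>)" by simp
  finally show ?thesis .
qed

lemma prob_not_discrepancy_le:
  assumes D: "0 < D" "real n * q \<le> D" and n: "0 < n"
  shows "Pr (\<lambda>G. \<not> discrepancy n D G) \<le> 1 / real n"
proof -
  let ?P = "Pow {1..n} - {{}}"
  let ?\<mu> = "\<lambda>S T. D * real (card S) * real (card T) / real n"
  let ?\<phi> = "\<lambda>S T. set_entropy n (card S) + set_entropy n (card T)"
  let ?B = "\<lambda>(S, T) G. 8 * ?\<mu> S T < real (edge_count G S T) \<and>
      10 * ?\<phi> S T < real (edge_count G S T) * ln (real (edge_count G S T) / ?\<mu> S T)"
  have "Pr (\<lambda>G. \<not> discrepancy n D G) \<le> Pr (\<lambda>G. \<exists>x\<in>?P \<times> ?P. ?B x G)"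
  proof (rule prob_mono)
    fix G assume "\<not> discrepancy n D G"
    then obtain S T where ST: "S \<subseteq> {1..n}" "T \<subseteq> {1..n}" "S \<noteq> {}" "T \<noteq> {}"
      and b: "8 * ?\<mu> S T < real (edge_count G S T)"
        "20 * max (set_entropy n (card S)) (set_entropy n (card T)) <
          real (edge_count G S T) * ln (real (edge_count G S T) / ?\<mu> S T)"
      unfolding discrepancy_def by (auto simp: not_le)
    have "10 * ?\<phi> S T \<le> 20 * max (set_entropy n (card S)) (set_entropy n (card T))"
      by (auto simp: max_def)
    with b(2) have "10 * ?\<phi> S T < real (edge_count G S T) * ln (real (edge_count G S T) / ?\<mu> S T)"
      by linarith
    with ST b(1) show "\<exists>x\<in>?P \<times> ?P. ?B x G" by (intro bexI[of _ "(S, T)"]) auto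
  qed
  also have "\<dots> \<le> (\<Sum>x\<in>?P \<times> ?P. Pr (?B x))" by (rule prob_ex_le) auto
  also have "\<dots> \<le> (\<Sum>(S, T)\<in>?P \<times> ?P. real n ^ 2 *
      (exp (- 5 * set_entropy n (card S)) * exp (- 5 * set_entropy n (card T))))"
  proof (rule sum_mono)
    fix x assume "x \<in> ?P \<times> ?P"
    then obtain S T where x: "x = (S, T)"
      and ST: "S \<subseteq> {1..n}" "T \<subseteq> {1..n}" "S \<noteq> {}" "T \<noteq> {}" by auto
    have "Pr (?B (S, T)) \<le> real n ^ 2 * exp (- 5 * ?\<phi> S T)"
      using prob_bad_pair_le[OF ST(1,3,2,4) D n] by simp
    also have "exp (- 5 * ?\<phi> S T) = exp (- 5 * set_entropy n (card S)) * exp (- 5 * set_entropy n (card T))"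
      by (simp add: exp_add[symmetric] algebra_simps)
    finally show "Pr (?B x) \<le> (case x of (S, T) \<Rightarrow> real n ^ 2 *
      (exp (- 5 * set_entropy n (card S)) * exp (- 5 * set_entropy n (card T))))"
      unfolding x prod.case .
  qed
  also have "\<dots> = real n ^ 2 * ((\<Sum>S\<in>?P. exp (- 5 * set_entropy n (card S))) *
      (\<Sum>T\<in>?P. exp (- 5 * set_entropy n (card T))))"
    unfolding sum_product unfolding sum.cartesian_product sum_distrib_left case_prod_unfold ..
  also have "\<dots> \<le> real n ^ 2 * ((1 / real n ^ 3) * (1 / real n ^ 3))"
    using n by (intro mult_left_mono mult_mono sum_exp_entropy_le sum_nonneg) auto
  also have "\<dots> = 1 / real n ^ 4" using n by (simp add: field_simps power_numeral_reduce)
  also have "\<dots> \<le> 1 / real n" using n by (intro divide_left_mono self_le_power) auto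
  finally show ?thesis .
qed

section \<open>Union bounds for configurations of high vertices\<close>

lemma prob_high_le:
  assumes i: "i \<in> {1..n}" and \<theta>: "0 \<le> \<theta>"
  shows "Pr (\<lambda>G. \<tau> < off_degree n G i) \<le> exp (\<theta> * (1 - \<tau>) + d * (exp \<theta> - 1))"
  using prob_edges_and_high_le[of "{i}" "{i}" "{}" \<theta> \<tau>] i \<theta> by simp

lemma prob_ex_high_le:
  assumes \<theta>: "0 \<le> \<theta>"
  shows "Pr (\<lambda>G. \<exists>i\<in>{1..n}. \<tau> < off_degree n G i) \<le> real n * exp (\<theta> * (1 - \<tau>) + d * (exp \<theta> - 1))"
proof -
  have "Pr (\<lambda>G. \<exists>i\<in>{1..n}. \<tau> < off_degree n G i) \<le> (\<Sum>i\<in>{1..n}. Pr (\<lambda>G. \<tau> < off_degree n G i))"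
    by (rule prob_ex_le) simp
  also have "\<dots> \<le> (\<Sum>i\<in>{1..n}. exp (\<theta> * (1 - \<tau>) + d * (exp \<theta> - 1)))"
    by (intro sum_mono prob_high_le \<theta>)
  finally show ?thesis by simp
qed

lemma prob_many_high_le:
  assumes \<theta>: "0 \<le> \<theta>"
  shows "Pr (\<lambda>G. 1 < q * real (card {i \<in> {1..n}. \<tau> < off_degree n G i}))
    \<le> real n * q * exp (\<theta> * (1 - \<tau>) + d * (exp \<theta> - 1))"
proof -
  let ?M = "random_graph n p"
  let ?E = "\<lambda>i. {G. \<tau> < off_degree n G i}"
  have int: "integrable (measure_pmf ?M) h" for h :: "_ \<Rightarrow> real"
    by (rule integrable_measure_pmf_finite[OF finite_set_random_graph])
  have card: "real (card {i \<in> {1..n}. \<tau> < off_degree n G i}) = (\<Sum>i\<in>{1..n}. indicator (?E i) G)" for G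
    by (simp add: indicator_def of_bool_def[symmetric] Int_def)
  have "Pr (\<lambda>G. 1 < q * real (card {i \<in> {1..n}. \<tau> < off_degree n G i})) =
      measure_pmf.expectation ?M (indicator {G. 1 < q * real (card {i \<in> {1..n}. \<tau> < off_degree n G i})})"
    by simp
  also have "\<dots> \<le> measure_pmf.expectation ?M (\<lambda>G. q * (\<Sum>i\<in>{1..n}. indicator (?E i) G))"
    unfolding card[symmetric] using q_nonneg
    by (intro integral_mono int) (auto simp: indicator_def)
  also have "\<dots> = q * (\<Sum>i\<in>{1..n}. Pr (\<lambda>G. \<tau> < off_degree n G i))"
    using int by simp
  also have "\<dots> \<le> q * (\<Sum>i\<in>{1..n}. exp (\<theta> * (1 - \<tau>) + d * (exp \<theta> - 1)))"
    by (intro mult_left_mono sum_mono prob_high_le \<theta> q_nonneg)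
  finally show ?thesis by (simp add: mult_ac)
qed

definition high_neighbours :: "real \<Rightarrow> nat \<Rightarrow> (nat set \<Rightarrow> bool) \<Rightarrow> bool" where
  "high_neighbours \<tau> k G \<longleftrightarrow> (\<exists>v\<in>{1..n}. \<exists>W. W \<subseteq> {1..n} - {v} \<and> card W = k \<and>
     (\<forall>w\<in>W. G {v, w} \<and> \<tau> < off_degree n G w))"

text \<open>The star with centre \<open>v\<close> and high leaves \<open>W\<close> exposes k + 1
  vertices. Summing the edge weights over all \<open>W\<close> with x = 1 in
  \<open>sum_prod_subsets_le\<close> costs exp d instead of n^k.\<close>

lemma prob_high_neighbours_le:
  assumes \<theta>: "0 \<le> \<theta>"
  shows "Pr (high_neighbours \<tau> k) \<le>
    real n * (exp d * exp (\<theta> * (real (k + 1) - \<tau>) + d * (exp \<theta> - 1)) ^ k)"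
proof -
  define Q where "Q = exp (\<theta> * (real (k + 1) - \<tau>) + d * (exp \<theta> - 1)) ^ k"
  let ?Ws = "\<lambda>v. {W. W \<subseteq> {1..n} - {v} \<and> card W = k}"
  have fin: "finite (?Ws v)" for v by (rule finite_subset[of _ "Pow {1..n}"]) auto
  have one: "Pr (\<lambda>G. \<forall>w\<in>W. G {v, w} \<and> \<tau> < off_degree n G w) \<le> (\<Prod>w\<in>W. p v w) * Q"
    if v: "v \<in> {1..n}" and W: "W \<in> ?Ws v" for v W
  proof -
    have finW: "finite W" by (rule finite_subset[of _ "{1..n}"]) (use W in auto)
    let ?E = "(\<lambda>w. {v, w}) ` W"
    have inj: "inj_on (\<lambda>w. {v, w}) W" by (auto simp: inj_on_def doubleton_eq_iff)
    have "Pr (\<lambda>G. \<forall>w\<in>W. G {v, w} \<and> \<tau> < off_degree n G w) \<le>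
        Pr (\<lambda>G. (\<forall>e\<in>?E. G e) \<and> (\<forall>h\<in>W. \<tau> < off_degree n G h))"
      by (rule prob_mono) auto
    also have "\<dots> \<le> (\<Prod>e\<in>?E. edge_prob p e) *
        exp (\<theta> * (real (card (insert v W)) - \<tau>) + d * (exp \<theta> - 1)) ^ card W"
      using v W \<theta> by (intro prob_edges_and_high_le) auto
    also have "card (insert v W) = k + 1" using W finW by (subst card_insert_disjoint) auto
    also have "card W = k" using W by simp
    also have "(\<Prod>e\<in>?E. edge_prob p e) = (\<Prod>w\<in>W. p v w)"
      using v W by (subst prod.reindex[OF inj]) (auto simp: edge_prob_pair subset_eq intro!: prod.cong)
    finally show ?thesis by (simp add: Q_def)
  qed
  have "Pr (high_neighbours \<tau> k) \<le> Pr (\<lambda>G. \<exists>v\<in>{1..n}. \<exists>W\<in>?Ws v. \<forall>w\<in>W. G {v, w} \<and> \<tau> < off_degree n G w)"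
    by (rule prob_mono) (auto simp: high_neighbours_def)
  also have "\<dots> \<le> (\<Sum>v\<in>{1..n}. \<Sum>W\<in>?Ws v. Pr (\<lambda>G. \<forall>w\<in>W. G {v, w} \<and> \<tau> < off_degree n G w))"
    by (intro order.trans[OF prob_ex_le] sum_mono prob_ex_le fin) simp
  also have "\<dots> \<le> (\<Sum>v\<in>{1..n}. \<Sum>W\<in>?Ws v. (\<Prod>w\<in>W. p v w) * Q)"
    by (intro sum_mono one)
  also have "\<dots> \<le> (\<Sum>v\<in>{1..n}. exp d * Q)"
  proof (rule sum_mono)
    fix v assume v: "v \<in> {1..n}"
    have "(\<Sum>W\<in>?Ws v. \<Prod>w\<in>W. p v w) \<le> exp (1 * (\<Sum>w\<in>{1..n} - {v}. p v w)) / 1 ^ k"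
      using v p_bounds by (intro sum_prod_subsets_le) auto
    also have "\<dots> \<le> exp d"
    proof -
      have "(\<Sum>w\<in>{1..n} - {v}. p v w) \<le> (\<Sum>w\<in>{1..n}. p v w)"
        using v p_bounds by (intro sum_mono2) auto
      then show ?thesis using degree_le[OF v] by simp
    qed
    finally show "(\<Sum>W\<in>?Ws v. (\<Prod>w\<in>W. p v w) * Q) \<le> exp d * Q"
      by (simp add: sum_distrib_right[symmetric] Q_def)
  qed
  finally show ?thesis by (simp add: Q_def)
qed

text \<open>Three common neighbours are the least number that can be excluded: five vertices and six
  edges give n^5 q^6 \<le> n^(-1 + 6 \<eta>), whereas for two the same count gives n^4 q^4, which
  need not be small.\<close>

definition large_codegree :: "(nat set \<Rightarrow> bool) \<Rightarrow> bool" where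
  "large_codegree G \<longleftrightarrow> (\<exists>u\<in>{1..n}. \<exists>v\<in>{1..n}. u \<noteq> v \<and> (\<exists>W. W \<subseteq> {1..n} - {u, v} \<and> card W = 3 \<and>
     (\<forall>w\<in>W. G {u, w} \<and> G {v, w})))"

lemma prob_large_codegree_le: "Pr large_codegree \<le> real n ^ 5 * q ^ 6"
proof -
  let ?Ws = "\<lambda>u v. {W. W \<subseteq> {1..n} - {u, v} \<and> card W = 3}"
  let ?X = "{(u, v). u \<in> {1..n} \<and> v \<in> {1..n} \<and> u \<noteq> v}"
  have fin: "finite (?Ws u v)" for u v by (rule finite_subset[of _ "Pow {1..n}"]) auto
  have subX: "?X \<subseteq> {1..n} \<times> {1..n}" by auto
  have one: "Pr (\<lambda>G. \<forall>w\<in>W. G {u, w} \<and> G {v, w}) \<le> q ^ 6"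
    if uv: "u \<in> {1..n}" "v \<in> {1..n}" "u \<noteq> v" and W: "W \<in> ?Ws u v" for u v W
  proof -
    have finW: "finite W" by (rule finite_subset[of _ "{1..n}"]) (use W in auto)
    let ?E1 = "(\<lambda>w. {u, w}) ` W" and ?E2 = "(\<lambda>w. {v, w}) ` W"
    have "card ?E1 = 3" "card ?E2 = 3"
      using W by (subst card_image; auto simp: inj_on_def doubleton_eq_iff)+
    moreover have "?E1 \<inter> ?E2 = {}" using W uv by (auto simp: doubleton_eq_iff)
    ultimately have card: "card (?E1 \<union> ?E2) = 6" using finW by (subst card_Un_disjoint) auto
    have sub: "?E1 \<union> ?E2 \<subseteq> potential_edges n"
      using W uv unfolding potential_edges_def by blast
    have "Pr (\<lambda>G. \<forall>w\<in>W. G {u, w} \<and> G {v, w}) \<le>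
        Pr (\<lambda>G. (\<forall>e\<in>?E1 \<union> ?E2. G e) \<and> (\<forall>h\<in>{}. 0 < off_degree n G h))"
      by (rule prob_mono) auto
    also have "\<dots> \<le> (\<Prod>e\<in>?E1 \<union> ?E2. edge_prob p e) *
        exp (0 * (real (card ({u, v} \<union> W)) - 0) + d * (exp 0 - 1)) ^ card ({} :: nat set)"
      using uv W by (intro prob_edges_and_high_le) auto
    also have "\<dots> = (\<Prod>e\<in>?E1 \<union> ?E2. edge_prob p e)" by simp
    also have "\<dots> \<le> (\<Prod>e\<in>?E1 \<union> ?E2. q)"
    proof (intro prod_mono conjI)
      fix e assume e: "e \<in> ?E1 \<union> ?E2"
      then show "0 \<le> edge_prob p e" using sub edge_prob_bounds by blast
      show "edge_prob p e \<le> q" using e W uv by (auto simp: edge_prob_pair subset_eq intro!: p_le_q)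
    qed
    also have "\<dots> = q ^ 6" by (simp add: card)
    finally show ?thesis .
  qed
  have "Pr large_codegree \<le> Pr (\<lambda>G. \<exists>x\<in>?X. \<exists>W\<in>?Ws (fst x) (snd x). \<forall>w\<in>W. G {fst x, w} \<and> G {snd x, w})"
    by (rule prob_mono) (fastforce simp: large_codegree_def)
  also have "\<dots> \<le> (\<Sum>x\<in>?X. \<Sum>W\<in>?Ws (fst x) (snd x). Pr (\<lambda>G. \<forall>w\<in>W. G {fst x, w} \<and> G {snd x, w}))"
    by (intro order.trans[OF prob_ex_le] sum_mono prob_ex_le fin finite_subset[OF subX]) auto
  also have "\<dots> \<le> (\<Sum>x\<in>?X. \<Sum>W\<in>?Ws (fst x) (snd x). q ^ 6)"
    by (intro sum_mono one) auto
  also have "\<dots> \<le> (\<Sum>x\<in>?X. real n ^ 3 * q ^ 6)"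
  proof (rule sum_mono)
    fix x
    have "card (?Ws (fst x) (snd x)) \<le> card {W. W \<subseteq> {1..n} \<and> card W = 3}"
      by (rule card_mono) (auto intro: finite_subset[of _ "Pow {1..n}"])
    also have "\<dots> = n choose 3" by (simp add: n_subsets)
    also have "\<dots> \<le> (n choose 3) * fact 3" by simp
    also have "\<dots> \<le> n ^ 3" by (rule binomial_fact_pow)
    finally have "real (card (?Ws (fst x) (snd x))) \<le> real n ^ 3" by (simp flip: of_nat_power)
    then show "(\<Sum>W\<in>?Ws (fst x) (snd x). q ^ 6) \<le> real n ^ 3 * q ^ 6"
      using q_nonneg by (simp add: mult_right_mono)
  qed
  also have "\<dots> \<le> (\<Sum>x\<in>{1..n} \<times> {1..n}. real n ^ 3 * q ^ 6)"
    using q_nonneg by (intro sum_mono2 subX) auto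
  also have "\<dots> = real n ^ 5 * q ^ 6" by (simp add: power_numeral_reduce)
  finally show ?thesis .
qed

text \<open>A pair (w, v) stands for the path u, w, v. All 2 k + 1 vertices of k such paths are
  distinct, so the 2 k edges are distinct too and their probabilities multiply.\<close>

definition disjoint_paths :: "nat \<Rightarrow> (nat \<times> nat) set \<Rightarrow> bool" where
  "disjoint_paths u P \<longleftrightarrow> P \<subseteq> ({1..n} - {u}) \<times> ({1..n} - {u}) \<and> inj_on fst P \<and> inj_on snd P \<and>
     fst ` P \<inter> snd ` P = {}"

definition many_high_paths :: "real \<Rightarrow> nat \<Rightarrow> (nat set \<Rightarrow> bool) \<Rightarrow> bool" where
  "many_high_paths \<tau> k G \<longleftrightarrow> (\<exists>u\<in>{1..n}. \<exists>P. disjoint_paths u P \<and> card P = k \<and>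
     (\<forall>(w, v)\<in>P. G {u, w} \<and> G {w, v} \<and> \<tau> < off_degree n G v))"

text \<open>The weights p u w * p w v sum to at most d^2, so x = 1 / d in
  \<open>sum_prod_subsets_le\<close> yields exp d * d^k: polylogarithmic apart from exp d, and free
  of a factor n per path.\<close>

lemma prob_many_high_paths_le:
  assumes \<theta>: "0 \<le> \<theta>" and d: "0 < d"
  shows "Pr (many_high_paths \<tau> k) \<le>
    real n * (exp d * d ^ k * exp (\<theta> * (real (2 * k + 1) - \<tau>) + d * (exp \<theta> - 1)) ^ k)"
proof -
  define Q where "Q = exp (\<theta> * (real (2 * k + 1) - \<tau>) + d * (exp \<theta> - 1)) ^ k"
  let ?Ps = "\<lambda>u. {P. disjoint_paths u P \<and> card P = k}"
  let ?A = "{1..n} \<times> {1..n}"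
  have subPs: "?Ps u \<subseteq> {P. P \<subseteq> ?A \<and> card P = k}" for u by (auto simp: disjoint_paths_def)
  have finA: "finite {P. P \<subseteq> ?A \<and> card P = k}" by (rule finite_subset[of _ "Pow ?A"]) auto
  have fin: "finite (?Ps u)" for u by (rule finite_subset[OF subPs finA])
  have one: "Pr (\<lambda>G. \<forall>(w, v)\<in>P. G {u, w} \<and> G {w, v} \<and> \<tau> < off_degree n G v) \<le>
      (\<Prod>(w, v)\<in>P. p u w * p w v) * Q"
    if u: "u \<in> {1..n}" and P: "P \<in> ?Ps u" for u P
  proof -
    have P': "P \<subseteq> ({1..n} - {u}) \<times> ({1..n} - {u})" "inj_on fst P" "inj_on snd P"
      "fst ` P \<inter> snd ` P = {}" "card P = k" using P by (auto simp: disjoint_paths_def)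
    have finP: "finite P" by (rule finite_subset[OF P'(1)]) auto
    let ?e1 = "\<lambda>x. {u, fst x}" and ?e2 = "\<lambda>x. {fst x, snd x}"
    let ?F = "insert u (fst ` P \<union> snd ` P)"
    have mem: "fst x \<in> {1..n}" "snd x \<in> {1..n}" "fst x \<noteq> u" "snd x \<noteq> u" if "x \<in> P" for x
      using that P'(1) by auto
    have inj1: "inj_on ?e1 P"
    proof (rule inj_onI)
      fix x y assume "x \<in> P" "y \<in> P" "?e1 x = ?e1 y"
      moreover from this have "fst x = fst y" by (auto simp: doubleton_eq_iff)
      ultimately show "x = y" using P'(2) by (simp add: inj_on_def)
    qed
    have inj2: "inj_on ?e2 P"
    proof (rule inj_onI)
      fix x y assume xy: "x \<in> P" "y \<in> P" "?e2 x = ?e2 y"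
      have "fst x \<noteq> snd y" using xy P'(4) by blast
      then have "fst x = fst y" using xy(3) by (auto simp: doubleton_eq_iff)
      then show "x = y" using P'(2) xy by (simp add: inj_on_def)
    qed
    have "u \<in> e" if "e \<in> ?e1 ` P" for e using that by auto
    moreover have "u \<notin> e" if "e \<in> ?e2 ` P" for e using that mem(3,4) by force
    ultimately have disj: "?e1 ` P \<inter> ?e2 ` P = {}" by blast
    have cardF: "card ?F = 2 * k + 1"
    proof -
      have "u \<notin> fst ` P \<union> snd ` P" using mem(3,4) by force
      then have "card ?F = Suc (card (fst ` P \<union> snd ` P))" using finP by simp
      also have "card (fst ` P \<union> snd ` P) = k + k"
        using finP P' by (subst card_Un_disjoint) (auto simp: card_image)
      finally show ?thesis by simp
    qed
    have "Pr (\<lambda>G. \<forall>(w, v)\<in>P. G {u, w} \<and> G {w, v} \<and> \<tau> < off_degree n G v) \<le>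
        Pr (\<lambda>G. (\<forall>e\<in>?e1 ` P \<union> ?e2 ` P. G e) \<and> (\<forall>h\<in>snd ` P. \<tau> < off_degree n G h))"
      by (rule prob_mono) auto
    also have "\<dots> \<le> (\<Prod>e\<in>?e1 ` P \<union> ?e2 ` P. edge_prob p e) *
        exp (\<theta> * (real (card ?F) - \<tau>) + d * (exp \<theta> - 1)) ^ card (snd ` P)"
    proof (intro prob_edges_and_high_le \<theta>)
      show "?F \<subseteq> {1..n}" using u P'(1) by auto
      show "?e1 ` P \<union> ?e2 ` P \<subseteq> {{i, j} |i j. i \<in> ?F \<and> j \<in> ?F}" by blast
    qed auto
    also have "card (snd ` P) = k" using P' by (simp add: card_image)
    also have "(\<Prod>e\<in>?e1 ` P \<union> ?e2 ` P. edge_prob p e) = (\<Prod>x\<in>P. p u (fst x)) * (\<Prod>x\<in>P. p (fst x) (snd x))"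
    proof -
      have "(\<Prod>e\<in>?e1 ` P \<union> ?e2 ` P. edge_prob p e) = (\<Prod>e\<in>?e1 ` P. edge_prob p e) * (\<Prod>e\<in>?e2 ` P. edge_prob p e)"
        using finP disj by (intro prod.union_disjoint) auto
      also have "(\<Prod>e\<in>?e1 ` P. edge_prob p e) = (\<Prod>x\<in>P. p u (fst x))"
        using u mem by (subst prod.reindex[OF inj1]) (auto simp: edge_prob_pair simp del: atLeastAtMost_iff intro!: prod.cong)
      also have "(\<Prod>e\<in>?e2 ` P. edge_prob p e) = (\<Prod>x\<in>P. p (fst x) (snd x))"
        using mem by (subst prod.reindex[OF inj2]) (auto simp: edge_prob_pair simp del: atLeastAtMost_iff intro!: prod.cong)
      finally show ?thesis .
    qed
    finally show ?thesis by (simp add: cardF Q_def prod.distrib case_prod_unfold)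
  qed
  have "Pr (many_high_paths \<tau> k) \<le> Pr (\<lambda>G. \<exists>u\<in>{1..n}. \<exists>P\<in>?Ps u.
      \<forall>(w, v)\<in>P. G {u, w} \<and> G {w, v} \<and> \<tau> < off_degree n G v)"
    by (rule prob_mono) (auto simp: many_high_paths_def)
  also have "\<dots> \<le> (\<Sum>u\<in>{1..n}. \<Sum>P\<in>?Ps u. Pr (\<lambda>G. \<forall>(w, v)\<in>P. G {u, w} \<and> G {w, v} \<and> \<tau> < off_degree n G v))"
    by (intro order.trans[OF prob_ex_le] sum_mono prob_ex_le fin) simp
  also have "\<dots> \<le> (\<Sum>u\<in>{1..n}. \<Sum>P\<in>?Ps u. (\<Prod>(w, v)\<in>P. p u w * p w v) * Q)"
    by (intro sum_mono one)
  also have "\<dots> \<le> (\<Sum>u\<in>{1..n}. exp d * d ^ k * Q)"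
  proof (rule sum_mono)
    fix u assume u: "u \<in> {1..n}"
    have nonneg: "0 \<le> (case x of (w, v) \<Rightarrow> p u w * p w v)" if "x \<in> ?A" for x
      using that u p_bounds by (auto intro!: mult_nonneg_nonneg)
    have "(\<Sum>P\<in>?Ps u. \<Prod>(w, v)\<in>P. p u w * p w v) \<le> (\<Sum>P | P \<subseteq> ?A \<and> card P = k. \<Prod>(w, v)\<in>P. p u w * p w v)"
      by (intro sum_mono2 finA subPs prod_nonneg nonneg) auto
    also have "\<dots> \<le> exp ((1 / d) * (\<Sum>(w, v)\<in>?A. p u w * p w v)) / (1 / d) ^ k"
      using d nonneg by (intro sum_prod_subsets_le) auto
    also have "\<dots> \<le> exp d / (1 / d) ^ k"
    proof -
      have "(\<Sum>(w, v)\<in>?A. p u w * p w v) = (\<Sum>w\<in>{1..n}. p u w * (\<Sum>v\<in>{1..n}. p w v))"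
        unfolding sum_distrib_left unfolding sum.cartesian_product case_prod_unfold ..
      also have "\<dots> \<le> (\<Sum>w\<in>{1..n}. p u w * d)"
        using u p_bounds by (intro sum_mono mult_left_mono degree_le) auto
      also have "\<dots> = (\<Sum>w\<in>{1..n}. p u w) * d" by (simp add: sum_distrib_right)
      also have "\<dots> \<le> d * d" using d by (intro mult_right_mono degree_le u) auto
      finally have "(1 / d) * (\<Sum>(w, v)\<in>?A. p u w * p w v) \<le> (1 / d) * (d * d)"
        using d by (intro mult_left_mono) auto
      then have "(1 / d) * (\<Sum>(w, v)\<in>?A. p u w * p w v) \<le> d" using d by simp
      then show ?thesis using d by (intro divide_right_mono) auto
    qed
    also have "\<dots> = exp d * d ^ k" using d by (simp add: power_divide)
    finally have "(\<Sum>P\<in>?Ps u. \<Prod>(w, v)\<in>P. p u w * p w v) * Q \<le> exp d * d ^ k * Q"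
      by (rule mult_right_mono) (simp add: Q_def)
    then show "(\<Sum>P\<in>?Ps u. (\<Prod>(w, v)\<in>P. p u w * p w v) * Q) \<le> exp d * d ^ k * Q"
      by (simp only: sum_distrib_right)
  qed
  finally show ?thesis by (simp add: Q_def)
qed

end


section \<open>Heavy couples\<close>

lemma edges_between_commute: "edges_between S T = edges_between T S"
  unfolding edges_between_def by (auto simp: insert_commute)

lemma edge_count_commute: "edge_count G S T = edge_count G T S"
  by (simp add: edge_count_def edges_between_commute)

lemma sum_adjacency_eq_card:
  "finite A \<Longrightarrow> (\<Sum>j\<in>A. adjacency G i j) = real (card {j \<in> A. G {i, j}})"
  by (simp add: adjacency_def Int_def)

lemma edge_count_le_sum_degree:
  assumes S: "S \<subseteq> {1..n}" and T: "T \<subseteq> {1..n}"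
  shows "real (edge_count G S T) \<le> (\<Sum>i\<in>S. off_degree n G i)"
proof -
  have fin: "finite S" "finite T" using S T by (auto intro: finite_subset)
  let ?X = "SIGMA i:S. {j \<in> {1..n} - {i}. G {i, j}}"
  have "{e \<in> edges_between S T. G e} \<subseteq> (\<lambda>(i, j). {i, j}) ` ?X"
  proof
    fix e assume "e \<in> {e \<in> edges_between S T. G e}"
    then obtain i j where "i \<in> S" "j \<in> T" "i \<noteq> j" "e = {i, j}" "G e"
      unfolding edges_between_def by blast
    then have "(i, j) \<in> ?X" "e = (case (i, j) of (i, j) \<Rightarrow> {i, j})" using T by auto
    then show "e \<in> (\<lambda>(i, j). {i, j}) ` ?X" by (rule rev_image_eqI)
  qed
  then have "edge_count G S T \<le> card ?X"
    unfolding edge_count_def by (rule surj_card_le[rotated]) (use fin in auto)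
  also have "card ?X = (\<Sum>i\<in>S. card {j \<in> {1..n} - {i}. G {i, j}})"
    using fin by (intro card_SigmaI) auto
  finally show ?thesis
    by (simp add: off_degree_def sum_adjacency_eq_card flip: of_nat_sum)
qed

text \<open>An edge with both ends in \<open>S\<close> \<inter> \<open>T\<close> is met by two
  ordered pairs, whence the factor 2.\<close>

lemma sum_adjacency_le_edge_count:
  assumes fin: "finite S" "finite T"
  shows "(\<Sum>i\<in>S. \<Sum>j\<in>T. if i \<noteq> j then adjacency G i j else 0) \<le> 2 * real (edge_count G S T)"
proof -
  let ?L = "{(i, j). i \<in> S \<and> j \<in> T \<and> i < j \<and> G {i, j}}"
  let ?U = "{(i, j). i \<in> S \<and> j \<in> T \<and> j < i \<and> G {i, j}}"
  let ?E = "{e \<in> edges_between S T. G e}"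
  have finE: "finite ?E" using finite_edges_between[OF fin] by simp
  have finLU: "finite ?L" "finite ?U" using fin by (auto intro: finite_subset[of _ "S \<times> T"])
  have "card ?L \<le> card ?E"
  proof (rule card_inj_on_le[OF _ _ finE])
    show "inj_on (\<lambda>(i, j). {i, j}) ?L" by (auto simp: inj_on_def doubleton_eq_iff)
  qed (auto simp: edges_between_def)
  moreover have "card ?U \<le> card ?E"
  proof (rule card_inj_on_le[OF _ _ finE])
    show "inj_on (\<lambda>(i, j). {i, j}) ?U" by (auto simp: inj_on_def doubleton_eq_iff)
  qed (auto simp: edges_between_def)
  moreover have "(\<Sum>i\<in>S. \<Sum>j\<in>T. if i \<noteq> j then adjacency G i j else 0) = real (card ?L) + real (card ?U)"
  proof -
    have "(\<Sum>i\<in>S. \<Sum>j\<in>T. if i \<noteq> j then adjacency G i j else 0) =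
        (\<Sum>x\<in>S \<times> T. of_bool (x \<in> ?L \<union> ?U))"
      unfolding sum.cartesian_product by (intro sum.cong) (auto simp: adjacency_def split: if_splits)
    also have "\<dots> = real (card (?L \<union> ?U))"
    proof -
      have "(\<Sum>x\<in>S \<times> T. of_bool (x \<in> ?L \<union> ?U)) = (\<Sum>x\<in>?L \<union> ?U. 1 :: real)"
        by (rule sum.mono_neutral_cong_right) (use fin in auto)
      then show ?thesis by simp
    qed
    also have "card (?L \<union> ?U) = card ?L + card ?U"
      using finLU by (intro card_Un_disjoint) auto
    finally show ?thesis by simp
  qed
  ultimately show ?thesis by (simp add: edge_count_def)
qed

lemma ex_power2_level:
  fixes y :: real
  assumes "1 \<le> y"
  shows "\<exists>a. 2 ^ a \<le> y \<and> y < 2 ^ (a + 1)"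
proof -
  obtain N where N: "y < 2 ^ N" using real_arch_pow[of 2 y] by auto
  define b where "b = (LEAST b. y < 2 ^ b)"
  have b: "y < 2 ^ b" unfolding b_def by (rule LeastI[of _ N]) (rule N)
  have "b \<noteq> 0" using b assms by (intro notI) simp
  then obtain a where a: "b = Suc a" by (cases b) auto
  have "\<not> y < 2 ^ a" using not_less_Least[of a "\<lambda>b. y < 2 ^ b"] a by (simp add: b_def)
  then show ?thesis using b a by (intro exI[of _ a]) auto
qed

lemma power2_level_unique:
  fixes y :: real
  assumes "2 ^ a \<le> y" "y < 2 ^ (a + 1)" "2 ^ b \<le> y" "y < 2 ^ (b + 1)"
  shows "a = b"
proof (rule ccontr)
  assume "a \<noteq> b"
  then consider "a + 1 \<le> b" | "b + 1 \<le> a" by linarith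
  then show False
  proof cases
    case 1
    then have "(2::real) ^ (a + 1) \<le> 2 ^ b" by (intro power_increasing) auto
    then show ?thesis using assms by linarith
  next
    case 2
    then have "(2::real) ^ (b + 1) \<le> 2 ^ a" by (intro power_increasing) auto
    then show ?thesis using assms by linarith
  qed
qed

text \<open>Nonzero integer entries have absolute value at least 1, so the dyadic levels start at 0.
  Replacing |z i z j| by its level costs a factor 4, which turns the cut-off 16 sqrt D into the 4 h
  of \<open>heavy_sum_le\<close>; ordered pairs cost another 2. Thus 336000 = 8 * 42000.\<close>

lemma heavy_adjacency_le:
  assumes disc: "discrepancy n D G" and D: "1 \<le> D" and n: "0 < n"
    and deg: "\<And>i. i \<in> {1..n} \<Longrightarrow> m i \<noteq> 0 \<Longrightarrow> off_degree n G i \<le> D"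
    and mass: "(\<Sum>i\<in>{1..n}. (real_of_int (m i))\<^sup>2) \<le> 16 * real n"
  defines "z \<equiv> \<lambda>i. real_of_int (m i)"
  shows "(\<Sum>i\<in>{1..n}. \<Sum>j\<in>{1..n}. if i \<noteq> j \<and> 16 * sqrt D < \<bar>z i * z j\<bar> then adjacency G i j * \<bar>z i * z j\<bar> else 0)
    \<le> 336000 * (real n * sqrt D)"
proof -
  define S where "S a = {i \<in> {1..n}. 2 ^ a \<le> \<bar>z i\<bar> \<and> \<bar>z i\<bar> < 2 ^ (a + 1)}" for a :: nat
  \<comment> \<open>A crude number of levels: a < 2^a \<le> |z i| \<le> 16 n on level a.\<close>
  define N where "N = 16 * n + 1"
  have SV: "S a \<subseteq> {1..n}" for a by (auto simp: S_def)
  have finS: "finite (S a)" for a by (rule finite_subset[OF SV]) simp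
  have disjS: "S a \<inter> S b = {}" if "a \<noteq> b" for a b
    using that power2_level_unique[of a _ b] by (auto simp: S_def)
  have big: "1 \<le> \<bar>z i\<bar>" if "z i \<noteq> 0" for i
  proof -
    have "1 \<le> \<bar>m i\<bar>" using that by (simp add: z_def)
    then have "real_of_int 1 \<le> real_of_int \<bar>m i\<bar>" by (simp only: of_int_le_iff)
    then show ?thesis by (simp add: z_def)
  qed
  have zn: "\<bar>z i\<bar> \<le> 16 * real n" if i: "i \<in> {1..n}" for i
  proof (cases "z i = 0")
    case False
    have "\<bar>z i\<bar> * 1 \<le> \<bar>z i\<bar> * \<bar>z i\<bar>" using big[OF False] by (intro mult_left_mono) auto
    also have "\<dots> = (z i)\<^sup>2" by (simp add: power2_eq_square)
    also have "\<dots> \<le> (\<Sum>i\<in>{1..n}. (z i)\<^sup>2)" using i by (intro member_le_sum) auto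
    finally show ?thesis using mass by (simp add: z_def)
  qed simp
  have cover: "\<exists>a<N. i \<in> S a" if i: "i \<in> {1..n}" and z0: "z i \<noteq> 0" for i
  proof -
    obtain a where a: "2 ^ a \<le> \<bar>z i\<bar>" "\<bar>z i\<bar> < 2 ^ (a + 1)"
      using ex_power2_level big[OF z0] by blast
    have "real a < 2 ^ a" using less_exp[of a] by (metis of_nat_less_iff of_nat_numeral of_nat_power)
    then have "real a < real N"  using a(1) zn[OF i] unfolding N_def by linarith
    then have "a < N" by simp
    then show ?thesis using a i by (auto simp: S_def)
  qed
  have split: "(\<Sum>i\<in>{1..n}. F i) = (\<Sum>a<N. \<Sum>i\<in>S a. F i)" if "\<And>i. z i = 0 \<Longrightarrow> F i = 0" for F :: "nat \<Rightarrow> real"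
  proof -
    have "(\<Sum>i\<in>{1..n}. F i) = (\<Sum>i\<in>(\<Union>a<N. S a). F i)"
    proof (rule sum.mono_neutral_right)
      show "\<forall>i\<in>{1..n} - (\<Union>a<N. S a). F i = 0" using that cover by blast
    qed (use SV in auto)
    also have "\<dots> = (\<Sum>a<N. \<Sum>i\<in>S a. F i)"
      using finS disjS by (intro sum.UNION_disjoint) auto
    finally show ?thesis .
  qed
  let ?g = "\<lambda>i j. if i \<noteq> j \<and> 16 * sqrt D < \<bar>z i * z j\<bar> then adjacency G i j * \<bar>z i * z j\<bar> else 0"
  let ?e = "\<lambda>a b. real (edge_count G (S a) (S b))"
  have inner: "(\<Sum>j\<in>{1..n}. ?g i j) = (\<Sum>b<N. \<Sum>j\<in>S b. ?g i j)" for i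
    by (rule split) simp
  have "(\<Sum>i\<in>{1..n}. \<Sum>j\<in>{1..n}. ?g i j) = (\<Sum>a<N. \<Sum>i\<in>S a. \<Sum>b<N. \<Sum>j\<in>S b. ?g i j)"
    unfolding inner by (rule split) (intro sum.neutral ballI, simp)
  also have "\<dots> = (\<Sum>a<N. \<Sum>b<N. \<Sum>i\<in>S a. \<Sum>j\<in>S b. ?g i j)"
    by (intro sum.cong refl sum.swap)
  also have "\<dots> \<le> (\<Sum>a<N. \<Sum>b<N. 8 * (if 4 * sqrt D \<le> 2 ^ (a + b) then 2 ^ (a + b) * ?e a b else 0))"
  proof (intro sum_mono)
    fix a b
    have prod: "\<bar>z i * z j\<bar> \<le> 4 * 2 ^ (a + b)" if "i \<in> S a" "j \<in> S b" for i j
    proof -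
      have "\<bar>z i\<bar> * \<bar>z j\<bar> \<le> 2 ^ (a + 1) * 2 ^ (b + 1)"
        using that by (intro mult_mono) (auto simp: S_def)
      then show ?thesis by (simp add: abs_mult power_add)
    qed
    show "(\<Sum>i\<in>S a. \<Sum>j\<in>S b. ?g i j) \<le> 8 * (if 4 * sqrt D \<le> 2 ^ (a + b) then 2 ^ (a + b) * ?e a b else 0)"
    proof (cases "4 * sqrt D \<le> 2 ^ (a + b)")
      case True
      have "(\<Sum>i\<in>S a. \<Sum>j\<in>S b. ?g i j) \<le>
          (\<Sum>i\<in>S a. \<Sum>j\<in>S b. 4 * 2 ^ (a + b) * (if i \<noteq> j then adjacency G i j else 0))"
      proof (intro sum_mono)
        fix i j assume ij: "i \<in> S a" "j \<in> S b"
        show "?g i j \<le> 4 * 2 ^ (a + b) * (if i \<noteq> j then adjacency G i j else 0)"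
          using mult_left_mono[OF prod[OF ij] adjacency_bounds(1)[of G i j]] adjacency_bounds(1)[of G i j]
          by (auto simp: mult_ac)
      qed
      also have "\<dots> = 4 * 2 ^ (a + b) * (\<Sum>i\<in>S a. \<Sum>j\<in>S b. if i \<noteq> j then adjacency G i j else 0)"
        by (simp add: sum_distrib_left)
      also have "\<dots> \<le> 4 * 2 ^ (a + b) * (2 * ?e a b)"
        by (intro mult_left_mono sum_adjacency_le_edge_count finS) auto
      finally show ?thesis using True by simp
    next
      case False
      have "?g i j = 0" if "i \<in> S a" "j \<in> S b" for i j
        using prod[OF that] False by auto
      then show ?thesis using False by (simp add: sum.neutral)
    qed
  qed
  also have "\<dots> = 8 * (\<Sum>a<N. \<Sum>b<N. if 4 * sqrt D \<le> 2 ^ (a + b) then 2 ^ (a + b) * ?e a b else 0)"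
    by (simp add: sum_distrib_left)
  also have "\<dots> \<le> 8 * (42000 * (real n * sqrt D))"
  proof (intro mult_left_mono heavy_sum_le)
    show "1 \<le> sqrt D" using D by simp
    show "0 < real n" using n by simp
    show "(\<Sum>a<N. real (card (S a)) * 4 ^ a) \<le> 16 * real n"
    proof -
      have "(\<Sum>a<N. real (card (S a)) * 4 ^ a) = (\<Sum>a<N. \<Sum>i\<in>S a. 4 ^ a)" by simp
      also have "\<dots> \<le> (\<Sum>a<N. \<Sum>i\<in>S a. (z i)\<^sup>2)"
      proof (intro sum_mono)
        fix a i assume "i \<in> S a"
        then have "(2 ^ a)\<^sup>2 \<le> \<bar>z i\<bar>\<^sup>2" by (intro power_mono) (auto simp: S_def)
        then show "4 ^ a \<le> (z i)\<^sup>2" by (simp add: power2_eq_square flip: power_mult_distrib)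
      qed
      also have "\<dots> = (\<Sum>i\<in>{1..n}. (z i)\<^sup>2)" by (subst split) auto
      finally show ?thesis using mass by (simp add: z_def)
    qed
    have degS: "?e a b \<le> (sqrt D)\<^sup>2 * real (card (S a))" for a b
    proof -
      have "?e a b \<le> (\<Sum>i\<in>S a. off_degree n G i)" by (rule edge_count_le_sum_degree[OF SV SV])
      also have "\<dots> \<le> (\<Sum>i\<in>S a. D)"
      proof (rule sum_mono)
        fix i assume i: "i \<in> S a"
        then have "2 ^ a \<le> \<bar>z i\<bar>" by (simp add: S_def)
        then have "0 < \<bar>z i\<bar>" using zero_less_power[of "2::real" a] by linarith
        then show "off_degree n G i \<le> D" using i by (intro deg) (auto simp: z_def S_def)
      qed
      finally show ?thesis using D by (simp add: mult.commute)
    qed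
    then show "?e a b \<le> (sqrt D)\<^sup>2 * real (card (S a))" for a b .
    show "?e a b \<le> (sqrt D)\<^sup>2 * real (card (S b))" for a b
      using degS[of b a] by (simp add: edge_count_commute)
    show "?e a b \<le> 8 * ((sqrt D)\<^sup>2 * real (card (S a)) * real (card (S b)) / real n) \<or>
      ?e a b * ln (?e a b / ((sqrt D)\<^sup>2 * real (card (S a)) * real (card (S b)) / real n)) \<le>
        20 * max (real (card (S a)) * ln (exp 1 * real n / real (card (S a))))
          (real (card (S b)) * ln (exp 1 * real n / real (card (S b))))"
      if "0 < real (card (S a))" "0 < real (card (S b))" for a b
    proof -
      have "S a \<noteq> {}" "S b \<noteq> {}" using that by auto
      then show ?thesis
        using disc[unfolded discrepancy_def, rule_format, of "S a" "S b"] SV D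
        by (simp add: set_entropy_def)
    qed
  qed auto
  finally show ?thesis by simp
qed

context sparse_graph
begin

text \<open>Light couples, heavy couples of the graph and heavy couples of the mean contribute 640,
  336000 and 16 times n sqrt D.\<close>

lemma low_form_le:
  assumes disc: "discrepancy n D G" and D: "1 \<le> D" "real n * q \<le> D" and n: "0 < n"
    and light: "\<And>m. m \<in> int_net n \<Longrightarrow> \<bar>light_form n p D G (\<lambda>i. real_of_int (m i))\<bar> \<le> 640 * real n * sqrt D"
    and deg: "\<And>i. i \<in> {1..n} \<Longrightarrow> m i \<noteq> 0 \<Longrightarrow> off_degree n G i \<le> D"
    and m: "m \<in> int_net n"
  defines "z \<equiv> \<lambda>i. real_of_int (m i)"
  shows "\<bar>\<Sum>i\<in>{1..n}. \<Sum>j\<in>{1..n}. if i \<noteq> j then (adjacency G i j - p i j) * z i * z j else 0\<bar>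
    \<le> 340000 * (real n * sqrt D)"
proof -
  have mass: "(\<Sum>i\<in>{1..n}. (z i)\<^sup>2) \<le> 16 * real n" using m by (simp add: int_net_def z_def)
  let ?hv = "\<lambda>i j. i \<noteq> j \<and> 16 * sqrt D < \<bar>z i * z j\<bar>"
  let ?A = "\<lambda>i j. if ?hv i j then adjacency G i j * \<bar>z i * z j\<bar> else 0"
  let ?P = "\<lambda>i j. q / (16 * sqrt D) * ((z i)\<^sup>2 * (z j)\<^sup>2)"
  have "(\<Sum>i\<in>{1..n}. \<Sum>j\<in>{1..n}. if i \<noteq> j then (adjacency G i j - p i j) * z i * z j else 0) =
      light_form n p D G z + (\<Sum>i\<in>{1..n}. \<Sum>j\<in>{1..n}. if ?hv i j then (adjacency G i j - p i j) * z i * z j else 0)"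
    unfolding light_form_def sum.distrib[symmetric] by (intro sum.cong) auto
  moreover have "\<bar>light_form n p D G z\<bar> \<le> 640 * real n * sqrt D" using light[OF m] by (simp add: z_def)
  moreover have "\<bar>\<Sum>i\<in>{1..n}. \<Sum>j\<in>{1..n}. if ?hv i j then (adjacency G i j - p i j) * z i * z j else 0\<bar>
      \<le> (\<Sum>i\<in>{1..n}. \<Sum>j\<in>{1..n}. ?A i j + ?P i j)"
  proof (intro order.trans[OF sum_abs] sum_mono)
    fix i j assume ij: "i \<in> {1..n}" "j \<in> {1..n}"
    show "\<bar>if ?hv i j then (adjacency G i j - p i j) * z i * z j else 0\<bar> \<le> ?A i j + ?P i j"
    proof (cases "?hv i j")
      case True
      have "\<bar>(adjacency G i j - p i j) * z i * z j\<bar> \<le> (adjacency G i j + p i j) * \<bar>z i * z j\<bar>"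
        using adjacency_bounds[of G i j] p_bounds[OF ij]
        by (auto simp: abs_mult mult.assoc intro!: mult_right_mono)
      moreover have "p i j * \<bar>z i * z j\<bar> \<le> ?P i j"
      proof -
        \<comment> \<open>On a heavy couple |z i z j| / (16 sqrt D) exceeds 1; inserting this factor
          yields squares whose double sum factorizes.\<close>
        have "p i j * \<bar>z i * z j\<bar> \<le> q * (\<bar>z i * z j\<bar> * (\<bar>z i * z j\<bar> / (16 * sqrt D)))"
        proof (rule mult_mono)
          show "p i j \<le> q" using True ij by (intro p_le_q) auto
          have "\<bar>z i * z j\<bar> * 1 \<le> \<bar>z i * z j\<bar> * (\<bar>z i * z j\<bar> / (16 * sqrt D))"
            using True D by (intro mult_left_mono) auto
          then show "\<bar>z i * z j\<bar> \<le> \<bar>z i * z j\<bar> * (\<bar>z i * z j\<bar> / (16 * sqrt D))" by simp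
        qed (use q_nonneg in auto)
        also have "\<dots> = q / (16 * sqrt D) * (\<bar>z i * z j\<bar> * \<bar>z i * z j\<bar>)" by simp
        also have "\<dots> = ?P i j" unfolding abs_mult_self_eq by (simp add: power2_eq_square)
        finally show ?thesis .
      qed
      ultimately show ?thesis using True by (simp add: distrib_right)
    next
      case False
      have "0 \<le> ?P i j" using q_nonneg D by simp
      then show ?thesis using False by auto
    qed
  qed
  moreover have "(\<Sum>i\<in>{1..n}. \<Sum>j\<in>{1..n}. ?A i j + ?P i j) =
      (\<Sum>i\<in>{1..n}. \<Sum>j\<in>{1..n}. ?A i j) + (\<Sum>i\<in>{1..n}. \<Sum>j\<in>{1..n}. ?P i j)"
    by (simp only: sum.distrib)
  moreover have "(\<Sum>i\<in>{1..n}. \<Sum>j\<in>{1..n}. ?A i j) \<le> 336000 * (real n * sqrt D)"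
    unfolding z_def using mass
    by (intro heavy_adjacency_le[OF disc D(1) n deg]) (auto simp: z_def)
  moreover have "(\<Sum>i\<in>{1..n}. \<Sum>j\<in>{1..n}. ?P i j) \<le> 16 * (real n * sqrt D)"
  proof -
    have "(\<Sum>i\<in>{1..n}. \<Sum>j\<in>{1..n}. ?P i j) = q / (16 * sqrt D) * ((\<Sum>i\<in>{1..n}. (z i)\<^sup>2) * (\<Sum>j\<in>{1..n}. (z j)\<^sup>2))"
      unfolding sum_product unfolding sum_distrib_left ..
    also have "\<dots> \<le> q / (16 * sqrt D) * ((16 * real n) * (16 * real n))"
      using mass D q_nonneg by (intro mult_left_mono mult_mono) (auto simp: sum_nonneg)
    also have "\<dots> = 16 * real n * (real n * q / sqrt D)" using D by simp
    also have "\<dots> \<le> 16 * real n * (D / sqrt D)"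
      using D by (intro mult_left_mono divide_right_mono) auto
    also have "D / sqrt D = sqrt D" using D by (simp add: real_div_sqrt)
    finally show ?thesis by simp
  qed
  ultimately show ?thesis using n D by (simp add: algebra_simps)
qed

end


section \<open>Low and high vertices\<close>

text \<open>Rounding toward zero increases neither the norm nor the support, so the net point of a vector
  supported on low vertices is again supported there.\<close>

definition toward_zero :: "real \<Rightarrow> int" where
  "toward_zero y = (if 0 \<le> y then \<lfloor>y\<rfloor> else - \<lfloor>- y\<rfloor>)"

lemma toward_zero_0 [simp]: "toward_zero 0 = 0"
  by (simp add: toward_zero_def)

lemma toward_zero_bounds:
  "(real_of_int (toward_zero y))\<^sup>2 \<le> y\<^sup>2" "(y - real_of_int (toward_zero y))\<^sup>2 \<le> 1"
proof -
  have "\<bar>real_of_int (toward_zero y)\<bar> \<le> \<bar>y\<bar>" unfolding toward_zero_def by (auto; linarith)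
  then show "(real_of_int (toward_zero y))\<^sup>2 \<le> y\<^sup>2" by (simp add: abs_le_square_iff)
  have "\<bar>y - real_of_int (toward_zero y)\<bar> \<le> \<bar>1\<bar>" unfolding toward_zero_def by (auto; linarith)
  then show "(y - real_of_int (toward_zero y))\<^sup>2 \<le> 1" by (subst (asm) abs_le_square_iff) simp
qed

context sparse_graph
begin

definition low_part :: "nat set \<Rightarrow> (nat set \<Rightarrow> bool) \<Rightarrow> nat \<Rightarrow> nat \<Rightarrow> real" where
  "low_part U G i j = (if i \<in> U \<and> j \<in> U \<and> i \<noteq> j then adjacency G i j - p i j else 0)"

text \<open>Rounding leaves an error \<open>w\<close> of norm at most 1/4, and the two error terms
  together cost at most half of the norm being bounded, which is finite and can be absorbed. The net
  value is 340000 / 16 = 21250 times sqrt D, doubled by the absorption.\<close>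

lemma op_norm_low_part_le:
  assumes disc: "discrepancy n D G" and D: "1 \<le> D" "real n * q \<le> D" and n: "0 < n"
    and light: "\<And>m. m \<in> int_net n \<Longrightarrow> \<bar>light_form n p D G (\<lambda>i. real_of_int (m i))\<bar> \<le> 640 * real n * sqrt D"
    and U: "U \<subseteq> {1..n}" and deg: "\<And>i. i \<in> U \<Longrightarrow> off_degree n G i \<le> D"
  shows "op_norm n (low_part U G) \<le> 42500 * sqrt D"
proof -
  let ?Y = "low_part U G"
  define r where "r = 4 * sqrt (real n)"
  have r: "0 < r" "r\<^sup>2 = 16 * real n" using n by (auto simp: r_def power_mult_distrib)
  have sym: "?Y i j = ?Y j i" for i j
    using U by (auto simp: low_part_def adjacency_commute subset_eq intro!: p_commute)
  have "op_norm n ?Y \<le> 21250 * sqrt D + op_norm n ?Y / 2"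
  proof (rule op_norm_leI[OF sym])
    fix x :: "nat \<Rightarrow> real" assume x: "(\<Sum>i\<in>{1..n}. (x i)\<^sup>2) \<le> 1"
    define y where "y i = (if i \<in> U then x i else 0)" for i
    define m where "m i = (if i \<in> {1..n} then toward_zero (r * y i) else undefined)" for i
    define z where "z i = real_of_int (m i) / r" for i
    define w where "w i = y i - z i" for i
    have y: "(\<Sum>i\<in>{1..n}. (y i)\<^sup>2) \<le> 1"
      by (rule order.trans[OF sum_mono x]) (auto simp: y_def)
    have mV: "m i = toward_zero (r * y i)" if "i \<in> {1..n}" for i using that by (simp add: m_def)
    have m_net: "m \<in> int_net n"
    proof -
      have "(\<Sum>i\<in>{1..n}. (real_of_int (m i))\<^sup>2) \<le> (\<Sum>i\<in>{1..n}. (r * y i)\<^sup>2)"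
        using toward_zero_bounds(1) by (intro sum_mono) (simp add: mV)
      also have "\<dots> = r\<^sup>2 * (\<Sum>i\<in>{1..n}. (y i)\<^sup>2)" by (simp add: sum_distrib_left power_mult_distrib)
      also have "\<dots> \<le> 16 * real n" using y r mult_left_mono[OF y, of "16 * real n"] by simp
      finally show ?thesis by (auto simp: int_net_def m_def)
    qed
    have z: "(\<Sum>i\<in>{1..n}. (z i)\<^sup>2) \<le> 1"
    proof -
      have "(\<Sum>i\<in>{1..n}. (z i)\<^sup>2) = (\<Sum>i\<in>{1..n}. (real_of_int (m i))\<^sup>2) / r\<^sup>2"
        by (simp add: z_def power_divide sum_divide_distrib)
      then show ?thesis using m_net n by (simp add: int_net_def r(2))
    qed
    have w: "(\<Sum>i\<in>{1..n}. (w i)\<^sup>2) \<le> (1 / 4)\<^sup>2"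
    proof -
      have "(\<Sum>i\<in>{1..n}. (w i)\<^sup>2) \<le> (\<Sum>i\<in>{1..n}. 1 / r\<^sup>2)"
      proof (rule sum_mono)
        fix i assume i: "i \<in> {1..n}"
        have "w i = (r * y i - real_of_int (m i)) / r" using r by (simp add: w_def z_def diff_divide_distrib)
        then have "(w i)\<^sup>2 = (r * y i - real_of_int (m i))\<^sup>2 / r\<^sup>2" by (simp add: power_divide)
        also have "\<dots> \<le> 1 / r\<^sup>2"
          using toward_zero_bounds(2)[of "r * y i"] by (intro divide_right_mono) (auto simp: mV[OF i])
        finally show "(w i)\<^sup>2 \<le> 1 / r\<^sup>2" .
      qed
      also have "\<dots> = (1 / 4)\<^sup>2" unfolding r(2) using n by (simp add: power2_eq_square)
      finally show ?thesis .
    qed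
    have L2: "L2_set y {1..n} \<le> 1" "L2_set z {1..n} \<le> 1" "L2_set w {1..n} \<le> 1 / 4"
      using y z real_sqrt_le_mono[OF w] by (simp_all add: L2_set_def)
    have "bilin n ?Y x x = bilin n ?Y y y"
      unfolding bilin_def by (intro sum.cong) (auto simp: low_part_def y_def)
    \<comment> \<open>Telescoping through z, so that each error term contains w exactly
      once.\<close>
    also have "\<dots> = bilin n ?Y z z + (bilin n ?Y z w + bilin n ?Y w y)"
    proof -
      have "bilin n ?Y w y = bilin n ?Y y y - bilin n ?Y z y"
        unfolding w_def by (rule bilin_diff_left)
      moreover have "bilin n ?Y z w = bilin n ?Y z y - bilin n ?Y z z"
        unfolding w_def by (rule bilin_diff_right)
      ultimately show ?thesis by simp
    qed
    finally have split: "bilin n ?Y x x = bilin n ?Y z z + (bilin n ?Y z w + bilin n ?Y w y)" .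
    let ?f = "\<Sum>i\<in>{1..n}. \<Sum>j\<in>{1..n}. if i \<noteq> j then (adjacency G i j - p i j) * real_of_int (m i) * real_of_int (m j) else 0"
    have mU: "m i = 0" if "i \<in> {1..n}" "i \<notin> U" for i
    proof -
      have "y i = 0" using that(2) by (simp add: y_def)
      then show ?thesis using mV[OF that(1)] by simp
    qed
    have "bilin n ?Y z z = ?f / r\<^sup>2"
      unfolding bilin_def sum_divide_distrib
    proof (intro sum.cong refl)
      fix i j assume ij: "i \<in> {1..n}" "j \<in> {1..n}"
      show "?Y i j * z i * z j =
        (if i \<noteq> j then (adjacency G i j - p i j) * real_of_int (m i) * real_of_int (m j) else 0) / r\<^sup>2"
      proof (cases "i \<in> U \<and> j \<in> U")
        case True then show ?thesis by (simp add: low_part_def z_def power2_eq_square)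
      next
        case False
        then have "m i = 0 \<or> m j = 0" using mU ij by blast
        then show ?thesis using False by (auto simp: low_part_def)
      qed
    qed
    moreover have "\<bar>?f\<bar> \<le> 340000 * (real n * sqrt D)"
    proof (rule low_form_le[OF disc D n light _ m_net])
      fix i assume "i \<in> {1..n}" "m i \<noteq> 0"
      then have "i \<in> U" using mU by blast
      then show "off_degree n G i \<le> D" by (rule deg)
    qed
    ultimately have "\<bar>bilin n ?Y z z\<bar> \<le> 340000 * (real n * sqrt D) / r\<^sup>2"
      by (simp add: abs_divide divide_right_mono)
    then have b1: "\<bar>bilin n ?Y z z\<bar> \<le> 21250 * sqrt D" using n by (simp add: r(2))
    have "\<bar>bilin n ?Y z w\<bar> \<le> op_norm n ?Y * L2_set z {1..n} * L2_set w {1..n}" by (rule bilin_le_op_norm)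
    also have "\<dots> \<le> op_norm n ?Y * 1 * (1 / 4)"
      using L2 by (intro mult_mono mult_nonneg_nonneg op_norm_nonneg L2_set_nonneg) auto
    finally have b2: "\<bar>bilin n ?Y z w\<bar> \<le> op_norm n ?Y * (1 / 4)" by simp
    have "\<bar>bilin n ?Y w y\<bar> \<le> op_norm n ?Y * L2_set w {1..n} * L2_set y {1..n}" by (rule bilin_le_op_norm)
    also have "\<dots> \<le> op_norm n ?Y * (1 / 4) * 1"
      using L2 by (intro mult_mono mult_nonneg_nonneg op_norm_nonneg L2_set_nonneg) auto
    finally have b3: "\<bar>bilin n ?Y w y\<bar> \<le> op_norm n ?Y * (1 / 4)" by simp
    show "\<bar>bilin n ?Y x x\<bar> \<le> 21250 * sqrt D + op_norm n ?Y / 2"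
      unfolding split using b1 b2 b3 by linarith
  qed
  then show ?thesis by simp
qed

section \<open>Counting paths to high vertices\<close>

definition high_vertices :: "real \<Rightarrow> (nat set \<Rightarrow> bool) \<Rightarrow> nat set" where
  "high_vertices \<tau> G = {i \<in> {1..n}. \<tau> < off_degree n G i}"

definition high_paths :: "real \<Rightarrow> (nat set \<Rightarrow> bool) \<Rightarrow> nat \<Rightarrow> (nat \<times> nat) set" where
  "high_paths \<tau> G u = {(w, v). w \<in> {1..n} - {u} \<and> v \<in> high_vertices \<tau> G - {u} \<and> w \<noteq> v \<and> G {u, w} \<and> G {w, v}}"

lemma card_high_neighbours_less:
  assumes no: "\<not> high_neighbours \<tau> k G" and v: "v \<in> {1..n}"
  shows "card {w \<in> high_vertices \<tau> G - {v}. G {v, w}} < k"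
proof (rule ccontr)
  assume "\<not> ?thesis"
  then have "k \<le> card {w \<in> high_vertices \<tau> G - {v}. G {v, w}}" by simp
  then obtain W where W: "W \<subseteq> {w \<in> high_vertices \<tau> G - {v}. G {v, w}}" "card W = k"
    by (rule obtain_subset_with_card_n)
  then have "W \<subseteq> {1..n} - {v} \<and> card W = k \<and> (\<forall>w\<in>W. G {v, w} \<and> \<tau> < off_degree n G w)"
    by (auto simp: high_vertices_def)
  then show False using no v unfolding high_neighbours_def by blast
qed

lemma card_common_neighbours_less:
  assumes no: "\<not> large_codegree G" and uv: "u \<in> {1..n}" "v \<in> {1..n}" "u \<noteq> v"
  shows "card {w \<in> {1..n} - {u, v}. G {u, w} \<and> G {v, w}} < 3"
proof (rule ccontr)
  assume "\<not> ?thesis"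
  then have "3 \<le> card {w \<in> {1..n} - {u, v}. G {u, w} \<and> G {v, w}}" by simp
  then obtain W where W: "W \<subseteq> {w \<in> {1..n} - {u, v}. G {u, w} \<and> G {v, w}}" "card W = 3"
    by (rule obtain_subset_with_card_n)
  then have "W \<subseteq> {1..n} - {u, v} \<and> card W = 3 \<and> (\<forall>w\<in>W. G {u, w} \<and> G {v, w})" by blast
  then show False using no uv unfolding large_codegree_def by blast
qed

text \<open>A maximal family of disjoint paths has fewer than \<open>k\<close> members, and every path meets one of them.\<close>

lemma card_high_paths_le:
  assumes hn: "\<not> high_neighbours \<tau> k G" and cd: "\<not> large_codegree G"
    and hp: "\<not> many_high_paths \<tau> k G" and u: "u \<in> {1..n}"
  shows "card (high_paths \<tau> G u) \<le> 2 * k * (k + 3)"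
proof -
  define Q where "Q = high_paths \<tau> G u"
  have QV: "Q \<subseteq> ({1..n} - {u}) \<times> ({1..n} - {u})"
    by (auto simp: Q_def high_paths_def high_vertices_def)
  have finQ: "finite Q" by (rule finite_subset[OF QV]) auto
  let ?M = "{P. P \<subseteq> Q \<and> disjoint_paths u P}"
  have finM: "finite ?M" using finQ by simp
  have "{} \<in> ?M" by (simp add: disjoint_paths_def)
  then have "Max (card ` ?M) \<in> card ` ?M" using finM by (intro Max_in finite_imageI) blast+
  then obtain P where P: "P \<in> ?M" "card P = Max (card ` ?M)" by (metis (no_types, lifting) imageE)
  have max: "card P' \<le> card P" if "P' \<in> ?M" for P'
    unfolding P(2) using finM that by (intro Max_ge finite_imageI imageI)
  have PQ: "P \<subseteq> Q" and Pd: "disjoint_paths u P" using P by auto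
  have finP: "finite P" by (rule finite_subset[OF PQ finQ])
  have "card P < k"
  proof (rule ccontr)
    assume "\<not> card P < k"
    then have "k \<le> card P" by simp
    then obtain P' where P': "P' \<subseteq> P" "card P' = k" by (rule obtain_subset_with_card_n)
    have "disjoint_paths u P'"
      using Pd P' unfolding disjoint_paths_def by (blast intro: inj_on_subset)
    moreover have "\<forall>(w, v)\<in>P'. G {u, w} \<and> G {w, v} \<and> \<tau> < off_degree n G v"
      using P' PQ by (auto simp: Q_def high_paths_def high_vertices_def)
    ultimately show False using hp u P'(2) unfolding many_high_paths_def by blast
  qed
  define X where "X = fst ` P \<union> snd ` P"
  have finX: "finite X" using finP by (simp add: X_def)
  have XV: "X \<subseteq> {1..n} - {u}" using PQ QV by (auto simp: X_def)
  have cardX: "card X \<le> 2 * k"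
  proof -
    have "card X \<le> card (fst ` P) + card (snd ` P)" unfolding X_def by (rule card_Un_le)
    also have "\<dots> \<le> card P + card P" by (intro add_mono card_image_le finP)
    finally show ?thesis using \<open>card P < k\<close> by simp
  qed
  let ?A = "\<lambda>f. {v \<in> high_vertices \<tau> G - {f}. G {f, v}}" and ?B = "\<lambda>f. {w \<in> {1..n} - {u, f}. G {u, w} \<and> G {f, w}}"
  have hit: "w \<in> X \<or> v \<in> X" if wv: "(w, v) \<in> Q" for w v
  proof (rule ccontr)
    assume no: "\<not> (w \<in> X \<or> v \<in> X)"
    then have out: "(w, v) \<notin> P" by (force simp: X_def)
    have "w \<noteq> v" using wv by (simp add: Q_def high_paths_def)
    then have "disjoint_paths u (insert (w, v) P)"
      using no wv QV Pd unfolding disjoint_paths_def X_def inj_on_insert by auto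
    then have "card (insert (w, v) P) \<le> card P" using wv PQ by (intro max) auto
    then show False using out finP by simp
  qed
  \<comment> \<open>A path that meets X in its middle vertex f continues to one of fewer than k high
    neighbours of f; one that ends in f has its middle among fewer than 3 common neighbours of u and
    f.\<close>
  have sub: "Q \<subseteq> (\<Union>f\<in>X. Pair f ` ?A f \<union> (\<lambda>w. (w, f)) ` ?B f)"
  proof
    fix x assume x: "x \<in> Q"
    obtain w v where wv: "x = (w, v)" by (cases x)
    have A: "v \<in> ?A w" and B: "w \<in> ?B v"
      using x wv by (auto simp: Q_def high_paths_def insert_commute)
    show "x \<in> (\<Union>f\<in>X. Pair f ` ?A f \<union> (\<lambda>w. (w, f)) ` ?B f)"
      using hit[of w v] x wv A B by blast
  qed
  have finAB: "finite (?A f)" "finite (?B f)" for f by (auto simp: high_vertices_def)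
  have "card Q \<le> card (\<Union>f\<in>X. Pair f ` ?A f \<union> (\<lambda>w. (w, f)) ` ?B f)"
    using finX finAB by (intro card_mono sub) auto
  also have "\<dots> \<le> (\<Sum>f\<in>X. card (Pair f ` ?A f \<union> (\<lambda>w. (w, f)) ` ?B f))"
    by (rule card_UN_le[OF finX])
  also have "\<dots> \<le> (\<Sum>f\<in>X. k + 3)"
  proof (rule sum_mono)
    fix f assume f: "f \<in> X"
    have "card (Pair f ` ?A f \<union> (\<lambda>w. (w, f)) ` ?B f) \<le> card (?A f) + card (?B f)"
      by (intro order.trans[OF card_Un_le] add_mono card_image_le finAB)
    also have "\<dots> \<le> k + 3"
      using f XV u card_high_neighbours_less[OF hn, of f] card_common_neighbours_less[OF cd u, of f]
      by (intro add_mono) (auto simp: subset_eq)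
    finally show "card (Pair f ` ?A f \<union> (\<lambda>w. (w, f)) ` ?B f) \<le> k + 3" .
  qed
  also have "\<dots> = card X * (k + 3)" by simp
  also have "\<dots> \<le> 2 * k * (k + 3)" using cardX by (rule mult_right_mono) simp
  finally show ?thesis by (simp add: Q_def)
qed

end

section \<open>Norm of the part at high vertices\<close>

lemma sum_abs_mult_le_L2:
  "\<bar>\<Sum>i\<in>A. f i * g i\<bar> \<le> L2_set f A * L2_set g A"
  by (rule order.trans[OF sum_abs]) (simp add: abs_mult L2_set_mult_ineq)

lemma sum_abs_le_sqrt_card:
  assumes "finite A"
  shows "(\<Sum>i\<in>A. \<bar>x i\<bar>) \<le> sqrt (real (card A)) * L2_set x A"
  using L2_set_mult_ineq[of "\<lambda>_. 1" x A] assms by (simp add: L2_set_def)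

text \<open>Schur's test applied to the Gram matrix c of the rows of \<open>a\<close>: c i k is
  nonnegative and symmetric, so x i x k \<le> (x i^2 + x k^2) / 2 reduces everything to its row
  sums.\<close>

lemma L2_bipartite_square_le:
  fixes a :: "nat \<Rightarrow> nat \<Rightarrow> real"
  assumes a: "\<And>i j. 0 \<le> a i j" and H: "finite H"
    and row: "\<And>i. i \<in> H \<Longrightarrow> (\<Sum>j\<in>U. \<Sum>k\<in>H. a i j * a k j) \<le> M"
  shows "(\<Sum>j\<in>U. (\<Sum>i\<in>H. a i j * x i)\<^sup>2) \<le> M * (\<Sum>i\<in>H. (x i)\<^sup>2)"
proof -
  define c where "c i k = (\<Sum>j\<in>U. a i j * a k j)" for i k
  have c0: "0 \<le> c i k" for i k using a by (simp add: c_def sum_nonneg)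
  have csym: "c i k = c k i" for i k by (simp add: c_def mult.commute)
  have crow: "(\<Sum>k\<in>H. c i k) \<le> M" if "i \<in> H" for i
    using row[OF that] unfolding c_def by (subst sum.swap)
  have "(\<Sum>j\<in>U. (\<Sum>i\<in>H. a i j * x i)\<^sup>2) = (\<Sum>j\<in>U. \<Sum>i\<in>H. \<Sum>k\<in>H. (a i j * a k j) * (x i * x k))"
    by (simp add: power2_eq_square sum_product mult_ac)
  also have "\<dots> = (\<Sum>i\<in>H. \<Sum>k\<in>H. \<Sum>j\<in>U. (a i j * a k j) * (x i * x k))"
    by (subst sum.swap) (intro sum.cong refl sum.swap)
  also have "\<dots> = (\<Sum>i\<in>H. \<Sum>k\<in>H. c i k * (x i * x k))"
    by (simp add: c_def sum_distrib_right)
  also have "\<dots> \<le> (\<Sum>i\<in>H. \<Sum>k\<in>H. c i k * ((x i)\<^sup>2 / 2) + c i k * ((x k)\<^sup>2 / 2))"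
  proof (intro sum_mono)
    fix i k
    have "x i * x k \<le> (x i)\<^sup>2 / 2 + (x k)\<^sup>2 / 2"
      using sum_squares_bound[of "x i" "x k"] by simp
    then show "c i k * (x i * x k) \<le> c i k * ((x i)\<^sup>2 / 2) + c i k * ((x k)\<^sup>2 / 2)"
      using c0 by (simp only: distrib_left[symmetric] mult_left_mono)
  qed
  also have "\<dots> = (\<Sum>i\<in>H. \<Sum>k\<in>H. c i k * ((x i)\<^sup>2 / 2)) + (\<Sum>i\<in>H. \<Sum>k\<in>H. c i k * ((x k)\<^sup>2 / 2))"
    by (simp only: sum.distrib)
  also have "(\<Sum>i\<in>H. \<Sum>k\<in>H. c i k * ((x k)\<^sup>2 / 2)) = (\<Sum>i\<in>H. \<Sum>k\<in>H. c i k * ((x i)\<^sup>2 / 2))"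
    by (subst sum.swap) (simp add: csym)
  also have "(\<Sum>i\<in>H. \<Sum>k\<in>H. c i k * ((x i)\<^sup>2 / 2)) = (\<Sum>i\<in>H. (\<Sum>k\<in>H. c i k) * ((x i)\<^sup>2 / 2))"
    by (simp only: sum_distrib_right)
  also have "(\<Sum>i\<in>H. (\<Sum>k\<in>H. c i k) * ((x i)\<^sup>2 / 2)) + \<dots> = (\<Sum>i\<in>H. (\<Sum>k\<in>H. c i k) * (x i)\<^sup>2)"
    by (simp flip: sum.distrib)
  also have "\<dots> \<le> (\<Sum>i\<in>H. M * (x i)\<^sup>2)" by (intro sum_mono mult_right_mono crow) auto
  finally show ?thesis by (simp add: sum_distrib_left)
qed

context sparse_graph
begin

text \<open>The term v = u is the degree of u into the low vertices; each other nonzero term is a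
  path of length two from u to a high vertex.\<close>

lemma two_path_row_le:
  assumes hn: "\<not> high_neighbours \<tau> k G" and cd: "\<not> large_codegree G"
    and hp: "\<not> many_high_paths \<tau> k G" and deg: "\<And>i. i \<in> {1..n} \<Longrightarrow> off_degree n G i \<le> \<Delta>"
    and u: "u \<in> high_vertices \<tau> G"
  shows "(\<Sum>w\<in>{1..n} - high_vertices \<tau> G. \<Sum>v\<in>high_vertices \<tau> G. adjacency G u w * adjacency G v w)
    \<le> \<Delta> + 2 * real k * real (k + 3)"
proof -
  let ?H = "high_vertices \<tau> G" and ?U = "{1..n} - high_vertices \<tau> G"
  have HV: "?H \<subseteq> {1..n}" by (auto simp: high_vertices_def)
  have finH: "finite ?H" by (rule finite_subset[OF HV]) simp
  have uV: "u \<in> {1..n}" using u HV by blast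
  have "(\<Sum>w\<in>?U. \<Sum>v\<in>?H. adjacency G u w * adjacency G v w) =
      (\<Sum>w\<in>?U. adjacency G u w) + (\<Sum>w\<in>?U. \<Sum>v\<in>?H - {u}. adjacency G u w * adjacency G v w)"
  proof -
    have "(\<Sum>v\<in>?H. adjacency G u w * adjacency G v w) =
        adjacency G u w + (\<Sum>v\<in>?H - {u}. adjacency G u w * adjacency G v w)" for w
      by (subst sum.remove[OF finH u]) (simp add: adjacency_def)
    then show ?thesis by (simp only: sum.distrib)
  qed
  also have "(\<Sum>w\<in>?U. adjacency G u w) \<le> off_degree n G u"
    unfolding off_degree_def using u by (intro sum_mono2) (auto simp: adjacency_bounds)
  also have "(\<Sum>w\<in>?U. \<Sum>v\<in>?H - {u}. adjacency G u w * adjacency G v w) \<le> real (card (high_paths \<tau> G u))"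
  proof -
    have "(\<Sum>w\<in>?U. \<Sum>v\<in>?H - {u}. adjacency G u w * adjacency G v w) =
        (\<Sum>x\<in>?U \<times> (?H - {u}). of_bool (x \<in> {(w, v). G {u, w} \<and> G {w, v}}))"
      unfolding sum.cartesian_product
      by (intro sum.cong) (auto simp: adjacency_def insert_commute)
    also have "\<dots> = real (card {x \<in> ?U \<times> (?H - {u}). x \<in> {(w, v). G {u, w} \<and> G {w, v}}})"
      using finH by (simp add: Int_def)
    also have "\<dots> \<le> real (card (high_paths \<tau> G u))"
    proof (intro of_nat_mono card_mono)
      show "finite (high_paths \<tau> G u)"
        by (rule finite_subset[of _ "{1..n} \<times> ?H"]) (use finH in \<open>auto simp: high_paths_def\<close>)
      show "{x \<in> ?U \<times> (?H - {u}). x \<in> {(w, v). G {u, w} \<and> G {w, v}}} \<subseteq> high_paths \<tau> G u"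
        using u by (auto simp: high_paths_def)
    qed
    finally show ?thesis .
  qed
  also have "real (card (high_paths \<tau> G u)) \<le> real (2 * k * (k + 3))"
    using card_high_paths_le[OF hn cd hp uV] by (rule of_nat_mono)
  finally show ?thesis using deg[OF uV] by simp
qed

text \<open>The block inside H has row sums at most k. The two off-diagonal blocks give 2 sqrt (M X
  Z), where X and Z are the masses on H and U; as 2 sqrt (X Z) \<le> X + Z \<le> 1, the factor 2
  disappears, which is what keeps the leading constant sharp.\<close>

lemma high_adjacency_form_le:
  assumes hn: "\<not> high_neighbours \<tau> k G" and cd: "\<not> large_codegree G"
    and hp: "\<not> many_high_paths \<tau> k G" and deg: "\<And>i. i \<in> {1..n} \<Longrightarrow> off_degree n G i \<le> \<Delta>"
    and \<Delta>: "0 \<le> \<Delta>" and x: "(\<Sum>i\<in>{1..n}. (x i)\<^sup>2) \<le> 1"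
  defines "H \<equiv> high_vertices \<tau> G"
  shows "\<bar>\<Sum>i\<in>{1..n}. \<Sum>j\<in>{1..n}. if i \<noteq> j \<and> (i \<in> H \<or> j \<in> H) then adjacency G i j * x i * x j else 0\<bar>
    \<le> real k + sqrt (\<Delta> + 2 * real k * real (k + 3))"
proof -
  define U where "U = {1..n} - H"
  define M where "M = \<Delta> + 2 * real k * real (k + 3)"
  have HV: "H \<subseteq> {1..n}" by (auto simp: H_def high_vertices_def)
  have fin: "finite H" "finite U" using HV by (auto simp: U_def intro: finite_subset)
  have V: "{1..n} = H \<union> U" "H \<inter> U = {}" using HV by (auto simp: U_def)
  have M0: "0 \<le> M" using \<Delta> by (simp add: M_def)
  define X where "X = (\<Sum>i\<in>H. (x i)\<^sup>2)"
  define Z where "Z = (\<Sum>i\<in>U. (x i)\<^sup>2)"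
  have XZ: "X + Z \<le> 1" "0 \<le> X" "0 \<le> Z"
    using x fin V by (simp_all add: X_def Z_def sum.union_disjoint sum_nonneg)
  let ?a = "adjacency G"
  let ?g = "\<lambda>i j. if i \<noteq> j \<and> (i \<in> H \<or> j \<in> H) then ?a i j * x i * x j else 0"
  define HH where "HH = (\<Sum>i\<in>H. \<Sum>j\<in>H - {i}. ?a i j * x i * x j)"
  define HU where "HU = (\<Sum>j\<in>U. x j * (\<Sum>i\<in>H. ?a i j * x i))"
  have "(\<Sum>i\<in>{1..n}. \<Sum>j\<in>{1..n}. ?g i j) = HH + 2 * HU"
  proof -
    have un: "(\<Sum>i\<in>{1..n}. F i) = (\<Sum>i\<in>H. F i) + (\<Sum>i\<in>U. F i)" for F :: "nat \<Rightarrow> real"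
      unfolding V(1) using fin V(2) by (rule sum.union_disjoint)
    have "(\<Sum>i\<in>H. \<Sum>j\<in>H. ?g i j) = HH"
      unfolding HH_def using fin by (intro sum.cong refl sum.mono_neutral_cong_right) auto
    moreover have "(\<Sum>i\<in>H. \<Sum>j\<in>U. ?g i j) = HU"
      unfolding HU_def sum_distrib_left
      by (subst sum.swap) (use V(2) in \<open>auto intro!: sum.cong simp: mult_ac\<close>)
    moreover have "(\<Sum>i\<in>U. \<Sum>j\<in>H. ?g i j) = HU"
      unfolding HU_def sum_distrib_left
      using V(2) by (auto intro!: sum.cong simp: mult_ac adjacency_commute)
    moreover have "(\<Sum>i\<in>U. \<Sum>j\<in>U. ?g i j) = 0"
      using V(2) by (intro sum.neutral ballI) auto
    moreover have "(\<Sum>i\<in>{1..n}. \<Sum>j\<in>{1..n}. ?g i j) =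
        ((\<Sum>i\<in>H. \<Sum>j\<in>H. ?g i j) + (\<Sum>i\<in>H. \<Sum>j\<in>U. ?g i j)) +
        ((\<Sum>i\<in>U. \<Sum>j\<in>H. ?g i j) + (\<Sum>i\<in>U. \<Sum>j\<in>U. ?g i j))"
      by (simp only: un sum.distrib)
    ultimately show ?thesis by linarith
  qed
  moreover have "\<bar>HH\<bar> \<le> real k * X"
  proof -
    have row: "(\<Sum>j\<in>H - {i}. ?a i j) \<le> real k" if "i \<in> H" for i
      using card_high_neighbours_less[OF hn, of i] that HV fin
      by (subst sum_adjacency_eq_card) (auto simp: H_def)
    have "\<bar>HH\<bar> \<le> (\<Sum>i\<in>H. \<Sum>j\<in>H - {i}. ?a i j * ((x i)\<^sup>2 / 2) + ?a i j * ((x j)\<^sup>2 / 2))"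
      unfolding HH_def
    proof (intro order.trans[OF sum_abs] sum_mono)
      fix i j
      have "\<bar>x i * x j\<bar> \<le> (x i)\<^sup>2 / 2 + (x j)\<^sup>2 / 2"
        using sum_squares_bound[of "\<bar>x i\<bar>" "\<bar>x j\<bar>"] by (simp add: abs_mult)
      then have "?a i j * \<bar>x i * x j\<bar> \<le> ?a i j * ((x i)\<^sup>2 / 2 + (x j)\<^sup>2 / 2)"
        by (intro mult_left_mono adjacency_bounds)
      then show "\<bar>?a i j * x i * x j\<bar> \<le> ?a i j * ((x i)\<^sup>2 / 2) + ?a i j * ((x j)\<^sup>2 / 2)"
        by (simp add: abs_mult adjacency_bounds mult.assoc distrib_left)
    qed
    also have "\<dots> = (\<Sum>i\<in>H. \<Sum>j\<in>H - {i}. ?a i j * ((x i)\<^sup>2 / 2)) + (\<Sum>i\<in>H. \<Sum>j\<in>H - {i}. ?a i j * ((x j)\<^sup>2 / 2))"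
      by (simp only: sum.distrib)
    also have "(\<Sum>i\<in>H. \<Sum>j\<in>H - {i}. ?a i j * ((x j)\<^sup>2 / 2)) = (\<Sum>i\<in>H. \<Sum>j\<in>H - {i}. ?a i j * ((x i)\<^sup>2 / 2))"
    proof -
      have *: "(\<Sum>i\<in>H. \<Sum>j\<in>H - {i}. F i j) = (\<Sum>i\<in>H. \<Sum>j\<in>H. if i \<noteq> j then F i j else 0)" for F :: "nat \<Rightarrow> nat \<Rightarrow> real"
        using fin by (intro sum.cong refl sum.mono_neutral_cong_left) auto
      show ?thesis
        unfolding * by (subst sum.swap) (intro sum.cong refl, auto simp: adjacency_commute)
    qed
    also have "(\<Sum>i\<in>H. \<Sum>j\<in>H - {i}. ?a i j * ((x i)\<^sup>2 / 2)) + \<dots> = (\<Sum>i\<in>H. (\<Sum>j\<in>H - {i}. ?a i j) * (x i)\<^sup>2)"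
      by (simp add: sum_distrib_right flip: sum.distrib)
    also have "\<dots> \<le> (\<Sum>i\<in>H. real k * (x i)\<^sup>2)"
      by (intro sum_mono mult_right_mono row) auto
    finally show ?thesis by (simp add: X_def sum_distrib_left)
  qed
  moreover have "2 * \<bar>HU\<bar> \<le> sqrt M"
  proof -
    have "\<bar>HU\<bar> \<le> L2_set x U * L2_set (\<lambda>j. \<Sum>i\<in>H. ?a i j * x i) U"
      unfolding HU_def by (rule sum_abs_mult_le_L2)
    also have "\<dots> \<le> sqrt Z * sqrt (M * X)"
    proof (intro mult_mono)
      show "L2_set x U \<le> sqrt Z" by (simp add: L2_set_def Z_def)
      have "(\<Sum>j\<in>U. (\<Sum>i\<in>H. ?a i j * x i)\<^sup>2) \<le> M * X"
        unfolding X_def using fin two_path_row_le[OF hn cd hp deg]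
        by (intro L2_bipartite_square_le) (auto simp: M_def H_def U_def adjacency_bounds)
      then show "L2_set (\<lambda>j. \<Sum>i\<in>H. ?a i j * x i) U \<le> sqrt (M * X)" by (simp add: L2_set_def)
    qed (auto simp: XZ)
    also have "\<dots> = sqrt M * (sqrt Z * sqrt X)" by (simp add: real_sqrt_mult)
    finally have "2 * \<bar>HU\<bar> \<le> sqrt M * (2 * sqrt Z * sqrt X)" by simp
    also have "\<dots> \<le> sqrt M * 1"
    proof (rule mult_left_mono)
      have "2 * sqrt Z * sqrt X \<le> (sqrt Z)\<^sup>2 + (sqrt X)\<^sup>2" by (rule sum_squares_bound)
      then show "2 * sqrt Z * sqrt X \<le> 1" using XZ by simp
    qed (use M0 in simp)
    finally show ?thesis by simp
  qed
  moreover have "real k * X \<le> real k * 1" using XZ by (intro mult_left_mono) auto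
  ultimately show ?thesis unfolding M_def by linarith
qed

text \<open>Cauchy-Schwarz over H in one index and over all vertices in the other gives q sqrt (card
  H) sqrt n, that is sqrt (q card H) * sqrt (n q); rows and columns account for the 2.\<close>

lemma high_mean_form_le:
  assumes H: "H \<subseteq> {1..n}" and card: "q * real (card H) \<le> 1" and x: "(\<Sum>i\<in>{1..n}. (x i)\<^sup>2) \<le> 1"
  shows "\<bar>\<Sum>i\<in>{1..n}. \<Sum>j\<in>{1..n}. if i \<noteq> j \<and> (i \<in> H \<or> j \<in> H) then p i j * x i * x j else 0\<bar>
    \<le> 2 * sqrt (real n * q)"
proof -
  define S where "S = (\<Sum>i\<in>H. \<bar>x i\<bar>) * (\<Sum>j\<in>{1..n}. \<bar>x j\<bar>)"
  have fin: "finite H" by (rule finite_subset[OF H]) simp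
  let ?h = "\<lambda>i. if i \<in> H then \<bar>x i\<bar> else 0"
  have hsum: "(\<Sum>i\<in>{1..n}. ?h i) = (\<Sum>i\<in>H. \<bar>x i\<bar>)"
    using H by (intro sum.mono_neutral_cong_right) auto
  have "\<bar>\<Sum>i\<in>{1..n}. \<Sum>j\<in>{1..n}. if i \<noteq> j \<and> (i \<in> H \<or> j \<in> H) then p i j * x i * x j else 0\<bar>
      \<le> (\<Sum>i\<in>{1..n}. \<Sum>j\<in>{1..n}. q * (?h i * \<bar>x j\<bar>) + q * (\<bar>x i\<bar> * ?h j))"
  proof (intro order.trans[OF sum_abs] sum_mono)
    fix i j assume ij: "i \<in> {1..n}" "j \<in> {1..n}"
    show "\<bar>if i \<noteq> j \<and> (i \<in> H \<or> j \<in> H) then p i j * x i * x j else 0\<bar> \<le> q * (?h i * \<bar>x j\<bar>) + q * (\<bar>x i\<bar> * ?h j)"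
    proof (cases "i \<noteq> j \<and> (i \<in> H \<or> j \<in> H)")
      case True
      then have "p i j \<le> q" using ij p_le_q by blast
      then have "p i j * (\<bar>x i\<bar> * \<bar>x j\<bar>) \<le> q * (\<bar>x i\<bar> * \<bar>x j\<bar>)" by (intro mult_right_mono) auto
      moreover have "0 \<le> q * (\<bar>x i\<bar> * \<bar>x j\<bar>)" using q_nonneg by simp
      ultimately show ?thesis using True p_bounds[OF ij] by (auto simp: abs_mult mult.assoc)
    next
      case False
      have "0 \<le> q * (?h i * \<bar>x j\<bar>) + q * (\<bar>x i\<bar> * ?h j)" using q_nonneg by simp
      then show ?thesis using False by (simp only: if_False abs_zero)
    qed
  qed
  also have "\<dots> = 2 * (q * S)"
  proof -
    have "(\<Sum>i\<in>{1..n}. \<Sum>j\<in>{1..n}. ?h i * \<bar>x j\<bar>) = S"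
      by (simp only: sum_product[symmetric] hsum S_def)
    moreover have "(\<Sum>i\<in>{1..n}. \<Sum>j\<in>{1..n}. \<bar>x i\<bar> * ?h j) = S"
      by (simp only: sum_product[symmetric] hsum S_def mult.commute)
    moreover have "(\<Sum>i\<in>{1..n}. \<Sum>j\<in>{1..n}. q * (?h i * \<bar>x j\<bar>) + q * (\<bar>x i\<bar> * ?h j)) =
        q * (\<Sum>i\<in>{1..n}. \<Sum>j\<in>{1..n}. ?h i * \<bar>x j\<bar>) + q * (\<Sum>i\<in>{1..n}. \<Sum>j\<in>{1..n}. \<bar>x i\<bar> * ?h j)"
      by (simp only: sum.distrib sum_distrib_left)
    ultimately show ?thesis by simp
  qed
  also have "S \<le> sqrt (real (card H)) * sqrt (real n)"
    unfolding S_def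
  proof (rule mult_mono)
    have "L2_set x H \<le> 1"
      unfolding L2_set_le_1_iff by (rule order.trans[OF sum_mono2 x]) (use H in auto)
    then have "sqrt (real (card H)) * L2_set x H \<le> sqrt (real (card H)) * 1" by (rule mult_left_mono) simp
    then show "(\<Sum>i\<in>H. \<bar>x i\<bar>) \<le> sqrt (real (card H))" using sum_abs_le_sqrt_card[OF fin, of x] by simp
    have "L2_set x {1..n} \<le> 1" using x by (simp add: L2_set_le_1_iff)
    then have "sqrt (real n) * L2_set x {1..n} \<le> sqrt (real n) * 1" by (rule mult_left_mono) simp
    then show "(\<Sum>j\<in>{1..n}. \<bar>x j\<bar>) \<le> sqrt (real n)" using sum_abs_le_sqrt_card[of "{1..n}" x] by simp
  qed (auto simp: sum_nonneg)
  also have "q * (sqrt (real (card H)) * sqrt (real n)) = sqrt (q * real (card H)) * sqrt (real n * q)"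
    using q_nonneg by (simp add: real_sqrt_mult)
  also have "\<dots> \<le> 1 * sqrt (real n * q)"
    using card q_nonneg by (intro mult_right_mono) auto
  finally show ?thesis using q_nonneg by (simp add: mult_left_mono)
qed

text \<open>The deterministic half of the argument. The summands of the bound come from the diagonal
  (1), the edges at high vertices, the low part and the mean at high vertices.\<close>

lemma op_norm_centered_le:
  assumes disc: "discrepancy n D G" and D: "1 \<le> D" "real n * q \<le> D" and n: "0 < n"
    and light: "\<And>m. m \<in> int_net n \<Longrightarrow> \<bar>light_form n p D G (\<lambda>i. real_of_int (m i))\<bar> \<le> 640 * real n * sqrt D"
    and hn: "\<not> high_neighbours \<tau> k G" and cd: "\<not> large_codegree G"
    and hp: "\<not> many_high_paths \<tau> k G" and deg: "\<And>i. i \<in> {1..n} \<Longrightarrow> off_degree n G i \<le> \<Delta>"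
    and \<Delta>: "0 \<le> \<Delta>" and \<tau>: "\<tau> \<le> D" and few: "q * real (card (high_vertices \<tau> G)) \<le> 1"
  shows "op_norm n (centered_adjacency n p G) \<le>
    1 + real k + sqrt (\<Delta> + 2 * real k * real (k + 3)) + 42500 * sqrt D + 2 * sqrt (real n * q)"
proof (rule op_norm_leI)
  show "centered_adjacency n p G i j = centered_adjacency n p G j i" for i j
    by (simp add: centered_adjacency_def mean_adjacency_def adjacency_commute)
next
  fix x :: "nat \<Rightarrow> real" assume x: "(\<Sum>i\<in>{1..n}. (x i)\<^sup>2) \<le> 1"
  define H where "H = high_vertices \<tau> G"
  define U where "U = {1..n} - H"
  let ?B = "centered_adjacency n p G"
  have HV: "H \<subseteq> {1..n}" by (auto simp: H_def high_vertices_def)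
  let ?c = "\<lambda>i j. i \<noteq> j \<and> (i \<in> H \<or> j \<in> H)"
  define SA where "SA = (\<Sum>i\<in>{1..n}. \<Sum>j\<in>{1..n}. if ?c i j then adjacency G i j * x i * x j else 0)"
  define SP where "SP = (\<Sum>i\<in>{1..n}. \<Sum>j\<in>{1..n}. if ?c i j then p i j * x i * x j else 0)"
  define SD where "SD = (\<Sum>i\<in>{1..n}. (adjacency G i i - p i i) * (x i)\<^sup>2)"
  have B: "?B i j = adjacency G i j - p i j" if "i \<in> {1..n}" "j \<in> {1..n}" for i j
    using that by (simp add: centered_adjacency_def mean_adjacency_eq[OF probs])
  have diag: "SD = (\<Sum>i\<in>{1..n}. \<Sum>j\<in>{1..n}. if i = j then (adjacency G i j - p i j) * x i * x j else 0)"
    unfolding SD_def by (intro sum.cong) (auto simp: power2_eq_square mult.assoc)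
  have "bilin n ?B x x = SD + (bilin n (low_part U G) x x + (SA - SP))"
    unfolding diag SA_def SP_def bilin_def sum.distrib[symmetric] sum_subtractf[symmetric]
    by (intro sum.cong refl) (auto simp: B low_part_def U_def algebra_simps simp del: atLeastAtMost_iff)
  moreover have "\<bar>SD\<bar> \<le> 1"
  proof -
    have "\<bar>SD\<bar> \<le> (\<Sum>i\<in>{1..n}. (x i)\<^sup>2)"
      unfolding SD_def
    proof (intro order.trans[OF sum_abs] sum_mono)
      fix i assume "i \<in> {1..n}"
      then have "\<bar>adjacency G i i - p i i\<bar> \<le> 1" using p_bounds[of i i] adjacency_bounds[of G i i] by auto
      then have "\<bar>adjacency G i i - p i i\<bar> * (x i)\<^sup>2 \<le> 1 * (x i)\<^sup>2" by (rule mult_right_mono) simp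
      then show "\<bar>(adjacency G i i - p i i) * (x i)\<^sup>2\<bar> \<le> (x i)\<^sup>2" by (simp add: abs_mult)
    qed
    then show ?thesis using x by linarith
  qed
  moreover have "\<bar>bilin n (low_part U G) x x\<bar> \<le> 42500 * sqrt D"
  proof -
    have low: "op_norm n (low_part U G) \<le> 42500 * sqrt D"
    proof (rule op_norm_low_part_le[OF disc D n light])
      fix i assume "i \<in> U"
      then show "off_degree n G i \<le> D" using \<tau> by (auto simp: U_def H_def high_vertices_def)
    qed (auto simp: U_def)
    have L2: "L2_set x {1..n} \<le> 1" using x by (simp add: L2_set_le_1_iff)
    have "\<bar>bilin n (low_part U G) x x\<bar> \<le> op_norm n (low_part U G) * L2_set x {1..n} * L2_set x {1..n}"
      by (rule bilin_le_op_norm)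
    also have "\<dots> \<le> op_norm n (low_part U G) * 1 * 1"
      using L2 by (intro mult_mono mult_nonneg_nonneg op_norm_nonneg L2_set_nonneg) auto
    finally show ?thesis using low by simp
  qed
  moreover have "\<bar>SA\<bar> \<le> real k + sqrt (\<Delta> + 2 * real k * real (k + 3))"
    unfolding SA_def H_def by (rule high_adjacency_form_le[OF hn cd hp deg \<Delta> x])
  moreover have "\<bar>SP\<bar> \<le> 2 * sqrt (real n * q)"
    unfolding SP_def using few by (intro high_mean_form_le[OF HV _ x]) (simp add: H_def)
  ultimately show "\<bar>bilin n ?B x x\<bar> \<le>
    1 + real k + sqrt (\<Delta> + 2 * real k * real (k + 3)) + 42500 * sqrt D + 2 * sqrt (real n * q)"
    by linarith
qed

end


section \<open>Asymptotics\<close>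

context sparse_graph
begin

lemma prob_op_norm_centered:
  fixes k :: nat
  assumes D: "1 \<le> D" "real n * q \<le> D" and n: "0 < n" and d: "0 < d" and \<theta>: "0 \<le> \<theta>" "0 \<le> \<theta>'"
    and \<Delta>: "0 \<le> \<Delta>" and \<tau>: "\<tau> \<le> D"
  defines "Q \<equiv> exp (\<theta> * (real (2 * k + 1) - \<tau>) + d * (exp \<theta> - 1))"
  shows "Pr (\<lambda>G. \<not> op_norm n (centered_adjacency n p G) \<le>
      1 + real k + sqrt (\<Delta> + 2 * real k * real (k + 3)) + 42500 * sqrt D + 2 * sqrt (real n * q)) \<le>
    2 * exp (- real n) + (1 / real n + (real n * exp (\<theta>' * (1 - \<Delta>) + d * (exp \<theta>' - 1)) +
    (real n * q * Q + (real n * exp d * Q ^ k + (real n ^ 5 * q ^ 6 + real n * exp d * d ^ k * Q ^ k)))))"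
proof -
  let ?net = "\<lambda>G. \<exists>m\<in>int_net n. 640 * real n * sqrt D < \<bar>light_form n p D G (\<lambda>i. real_of_int (m i))\<bar>"
  let ?few = "\<lambda>G. 1 < q * real (card {i \<in> {1..n}. \<tau> < off_degree n G i})"
  have D0: "0 < D" using D by simp
  \<comment> \<open>\<open>Q\<close> belongs to the largest exposed set, the 2 k + 1 vertices of the
    paths, and so dominates the factors of single vertices and of stars.\<close>
  have mono: "exp (\<theta> * (real l - \<tau>) + d * (exp \<theta> - 1)) \<le> Q" if "l \<le> 2 * k + 1" for l
    unfolding Q_def exp_le_cancel_iff using that \<theta> by (intro add_right_mono mult_left_mono) auto
  have "Pr (\<lambda>G. \<not> op_norm n (centered_adjacency n p G) \<le>
      1 + real k + sqrt (\<Delta> + 2 * real k * real (k + 3)) + 42500 * sqrt D + 2 * sqrt (real n * q)) \<le>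
    Pr (\<lambda>G. ?net G \<or> \<not> discrepancy n D G \<or> (\<exists>i\<in>{1..n}. \<Delta> < off_degree n G i) \<or> ?few G \<or>
      high_neighbours \<tau> k G \<or> large_codegree G \<or> many_high_paths \<tau> k G)"
  proof (rule prob_mono, rule ccontr)
    fix G
    assume bad: "\<not> op_norm n (centered_adjacency n p G) \<le>
      1 + real k + sqrt (\<Delta> + 2 * real k * real (k + 3)) + 42500 * sqrt D + 2 * sqrt (real n * q)"
    assume "\<not> (?net G \<or> \<not> discrepancy n D G \<or> (\<exists>i\<in>{1..n}. \<Delta> < off_degree n G i) \<or> ?few G \<or>
      high_neighbours \<tau> k G \<or> large_codegree G \<or> many_high_paths \<tau> k G)"
    then have "op_norm n (centered_adjacency n p G) \<le>
      1 + real k + sqrt (\<Delta> + 2 * real k * real (k + 3)) + 42500 * sqrt D + 2 * sqrt (real n * q)"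
      by (intro op_norm_centered_le[of D G \<tau> k \<Delta>] D n \<Delta> \<tau>)
        (auto simp: not_less high_vertices_def simp del: atLeastAtMost_iff)
    then show False using bad by contradiction
  qed
  also have "\<dots> \<le> 2 * exp (- real n) + (1 / real n + (real n * exp (\<theta>' * (1 - \<Delta>) + d * (exp \<theta>' - 1)) +
    (real n * q * Q + (real n * exp d * Q ^ k + (real n ^ 5 * q ^ 6 + real n * exp d * d ^ k * Q ^ k)))))"
  proof (intro order.trans[OF prob_disj_le] add_mono)
    show "Pr ?net \<le> 2 * exp (- real n)" by (rule prob_net_le[OF D0 D(2)])
    show "Pr (\<lambda>G. \<not> discrepancy n D G) \<le> 1 / real n" by (rule prob_not_discrepancy_le[OF D0 D(2) n])
    show "Pr (\<lambda>G. \<exists>i\<in>{1..n}. \<Delta> < off_degree n G i) \<le> real n * exp (\<theta>' * (1 - \<Delta>) + d * (exp \<theta>' - 1))"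
      by (rule prob_ex_high_le[OF \<theta>(2)])
    show "Pr ?few \<le> real n * q * Q"
      using mono[of 1] q_nonneg
      by (intro order.trans[OF prob_many_high_le[OF \<theta>(1)]] mult_left_mono) auto
    show "Pr large_codegree \<le> real n ^ 5 * q ^ 6" by (rule prob_large_codegree_le)
    have "Pr (high_neighbours \<tau> k) \<le> real n * (exp d * exp (\<theta> * (real (k + 1) - \<tau>) + d * (exp \<theta> - 1)) ^ k)"
      by (rule prob_high_neighbours_le[OF \<theta>(1)])
    also have "\<dots> \<le> real n * (exp d * Q ^ k)"
      by (intro mult_left_mono power_mono mono) auto
    finally show "Pr (high_neighbours \<tau> k) \<le> real n * exp d * Q ^ k" by (simp add: mult.assoc)
    show "Pr (many_high_paths \<tau> k) \<le> real n * exp d * d ^ k * Q ^ k"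
      using prob_many_high_paths_le[OF \<theta>(1) d, of \<tau> k] by (simp add: Q_def mult.assoc)
  qed
  finally show ?thesis .
qed

end

section \<open>Error terms and choice of the exponents\<close>

lemma sparse_graph_p_max_max_degree:
  assumes "edge_probabilities n p" "2 \<le> n"
  shows "sparse_graph n p (p_max n p) (max_degree n p)"
proof
  let ?S = "{p i j |i j. i \<in> {1..n} \<and> j \<in> {1..n} \<and> i \<noteq> j}"
  have fin: "finite ?S"
    by (rule finite_subset[of _ "(\<lambda>(i, j). p i j) ` ({1..n} \<times> {1..n})"]) auto
  show le: "p i j \<le> p_max n p" if "i \<in> {1..n}" "j \<in> {1..n}" "i \<noteq> j" for i j
    unfolding p_max_def using that by (intro Max_ge fin) blast
  have "0 \<le> p 1 2" using assms by (auto simp: edge_probabilities_def)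
  also have "\<dots> \<le> p_max n p" using assms by (intro le) auto
  finally show "0 \<le> p_max n p" .
  show "(\<Sum>j\<in>{1..n}. p i j) \<le> max_degree n p" if "i \<in> {1..n}" for i
    unfolding max_degree_def using that by (intro Max_ge) auto
qed (rule assms)

lemma ln_power_mult_powr_tendsto_0:
  assumes "0 < a"
  shows "(\<lambda>n. c * ln (real n) ^ j * real n powr (- a)) \<longlonglongrightarrow> 0"
  using assms by real_asymp

text \<open>A lower bound for \<open>L\<^sub>1\<close> that depends on p only through \<kappa>; its
  divergence absorbs all additive constants.\<close>

lemma ln_div_ln_ln_at_top:
  assumes "0 < \<kappa>"
  shows "filterlim (\<lambda>n. ln (real n) / ln (ln (real n) / \<kappa>)) at_top sequentially"
  using assms by real_asymp

text \<open>The summands correspond to those of \<open>prob_op_norm_centered\<close>, in the same order.\<close>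

definition tail_bound :: "real \<Rightarrow> real \<Rightarrow> nat \<Rightarrow> real \<Rightarrow> nat \<Rightarrow> real" where
  "tail_bound \<epsilon> \<delta> k \<kappa> n = 2 * exp (- real n) + (1 / real n +
     (1 / \<kappa> * ln (real n) ^ 1 * real n powr (- (\<epsilon> / 4)) +
     ((1 / \<kappa>) ^ (k + 1) * ln (real n) ^ (k + 1) * real n powr (- (\<delta> / 8)) +
     ((1 / \<kappa>) ^ ((k + 1) * k) * ln (real n) ^ ((k + 1) * k) * real n powr (- 2) +
     (real n powr (- (1 / 2)) +
      (1 / \<kappa>) ^ ((k + 1) * k) * ln (real n) ^ ((k + 1) * k + k) * real n powr (- 2))))))"

lemma tail_bound_tendsto_0:
  assumes "0 < \<epsilon>" "0 < \<delta>"
  shows "tail_bound \<epsilon> \<delta> k \<kappa> \<longlonglongrightarrow> 0"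
proof -
  have "(\<lambda>n. 2 * exp (- real n)) \<longlonglongrightarrow> 0" "(\<lambda>n. 1 / real n) \<longlonglongrightarrow> 0" "(\<lambda>n. real n powr (- (1 / 2))) \<longlonglongrightarrow> 0"
    by real_asymp+
  then show ?thesis
    unfolding tail_bound_def using assms
    by (intro tendsto_add_zero ln_power_mult_powr_tendsto_0) auto
qed

text \<open>Here \<open>L\<^sub>1\<close> = ln n / ln R, and ln R is the natural Chernoff exponent
  for degrees of that order. Staying below it by the factor 1 - \<gamma> reduces the Poisson term d
  exp \<theta> to \<eta>^\<gamma> ln n, which is negligible for small \<eta>.\<close>

lemma exponent_bounds:
  fixes n d \<kappa> \<eta> :: real
  assumes n: "1 < n" and \<kappa>: "0 < \<kappa>" "\<kappa> \<le> d" and d: "d \<le> \<eta> * ln n" and \<eta>: "0 < \<eta>" "\<eta> < 1"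
    and \<gamma>: "0 < \<gamma>" "\<gamma> < 1"
  defines "R \<equiv> ln n / d"
  shows "1 < R" "R \<le> ln n / \<kappa>" "0 < ln R" "d * exp ((1 - \<gamma>) * ln R) \<le> \<eta> powr \<gamma> * ln n"
proof -
  have ln: "0 < ln n" using n by simp
  have d0: "0 < d" using \<kappa> by linarith
  have R\<eta>: "1 / \<eta> \<le> R" using d d0 \<eta> by (simp add: R_def field_simps)
  moreover have "1 < 1 / \<eta>" using \<eta> by simp
  ultimately show R1: "1 < R" by linarith
  then show "0 < ln R" by simp
  show "R \<le> ln n / \<kappa>" unfolding R_def using ln \<kappa> by (intro divide_left_mono) auto
  have "exp ((1 - \<gamma>) * ln R) = R * R powr (- \<gamma>)"
    using R1 by (simp add: powr_def algebra_simps exp_diff exp_minus field_simps)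
  then have "d * exp ((1 - \<gamma>) * ln R) = ln n * R powr (- \<gamma>)" using d0 by (simp add: R_def)
  also have "\<dots> \<le> ln n * (1 / \<eta>) powr (- \<gamma>)"
    using R\<eta> \<eta> \<gamma> ln by (intro mult_left_mono powr_mono2') auto
  also have "(1 / \<eta>) powr (- \<gamma>) = \<eta> powr \<gamma>" using \<eta> by (simp add: powr_divide powr_minus field_simps)
  finally show "d * exp ((1 - \<gamma>) * ln R) \<le> \<eta> powr \<gamma> * ln n" by (simp add: mult.commute)
qed

text \<open>With \<theta> = ln R / 2 the threshold gains \<delta> / 2 * ln x and the Poisson term
  loses at most half of that. The exposed vertices cost only powers of R, hence powers of the
  logarithm.\<close>

lemma high_degree_factor_le:
  fixes x d \<kappa> \<eta> \<delta> :: real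
  assumes x: "1 < x" and \<kappa>: "0 < \<kappa>" "\<kappa> \<le> d" and d: "d \<le> \<eta> * ln x" and \<eta>: "0 < \<eta>" "\<eta> < 1"
    and \<eta>\<delta>: "\<eta> powr (1 / 2) \<le> \<delta> / 4"
  defines "R \<equiv> ln x / d"
  shows "exp (ln R / 2 * (real (2 * k + 1) - \<delta> * (ln x / ln R)) + d * (exp (ln R / 2) - 1)) \<le>
    (ln x / \<kappa>) ^ (k + 1) * x powr (- (\<delta> / 4))"
proof -
  note R = exponent_bounds[OF x \<kappa> d \<eta>, of "1 / 2", folded R_def]
  have R': "1 < R" "R \<le> ln x / \<kappa>" "0 < ln R" using R by auto
  have dR: "d * exp (ln R / 2) \<le> \<eta> powr (1 / 2) * ln x" using R(4) by simp
  have lnx: "0 < ln x" using x by simp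
  have "\<eta> powr (1 / 2) * ln x \<le> \<delta> / 4 * ln x" using \<eta>\<delta> lnx by (intro mult_right_mono) auto
  moreover have "ln R / 2 * (real (2 * k + 1) - \<delta> * (ln x / ln R)) = real k * ln R + ln R / 2 - \<delta> / 2 * ln x"
    using R'(3) by (simp add: field_simps)
  moreover have "d * (exp (ln R / 2) - 1) = d * exp (ln R / 2) - d" by (simp add: right_diff_distrib)
  ultimately have "ln R / 2 * (real (2 * k + 1) - \<delta> * (ln x / ln R)) + d * (exp (ln R / 2) - 1) \<le>
      real (k + 1) * ln R + - (\<delta> / 4) * ln x"
    using dR R'(3) \<kappa> by (simp add: algebra_simps)
  then have "exp (ln R / 2 * (real (2 * k + 1) - \<delta> * (ln x / ln R)) + d * (exp (ln R / 2) - 1)) \<le>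
      exp (real (k + 1) * ln R + - (\<delta> / 4) * ln x)" by simp
  also have "\<dots> = R ^ (k + 1) * x powr (- (\<delta> / 4))"
    using R'(1) x by (simp only: exp_add exp_of_nat_mult powr_def) simp
  also have "\<dots> \<le> (ln x / \<kappa>) ^ (k + 1) * x powr (- (\<delta> / 4))"
    using R' by (intro mult_right_mono power_mono) auto
  finally show ?thesis .
qed

text \<open>The exponent must exceed 1 to beat the union over n vertices: (1 - \<epsilon>/8) (1 +
  \<epsilon>/2) \<ge> 1 + 5 \<epsilon>/16, and the Poisson term takes away at most
  \<epsilon>/16.\<close>

lemma max_degree_factor_le:
  fixes x d \<kappa> \<eta> \<epsilon> :: real
  assumes x: "1 < x" and \<kappa>: "0 < \<kappa>" "\<kappa> \<le> d" and d: "d \<le> \<eta> * ln x" and \<eta>: "0 < \<eta>" "\<eta> < 1"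
    and \<epsilon>: "0 < \<epsilon>" "\<epsilon> < 1" and \<eta>\<epsilon>: "\<eta> powr (\<epsilon> / 8) \<le> \<epsilon> / 16"
  defines "R \<equiv> ln x / d"
  shows "exp ((1 - \<epsilon> / 8) * ln R * (1 - (1 + \<epsilon> / 2) * (ln x / ln R)) + d * (exp ((1 - \<epsilon> / 8) * ln R) - 1)) \<le>
    ln x / \<kappa> * x powr (- (1 + \<epsilon> / 4))"
proof -
  note R = exponent_bounds[OF x \<kappa> d \<eta>, of "\<epsilon> / 8", folded R_def]
  have R': "1 < R" "R \<le> ln x / \<kappa>" "0 < ln R" using R \<epsilon> by auto
  have dR: "d * exp ((1 - \<epsilon> / 8) * ln R) \<le> \<eta> powr (\<epsilon> / 8) * ln x" using R(4) \<epsilon> by simp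
  have lnx: "0 < ln x" using x by simp
  have "\<eta> powr (\<epsilon> / 8) * ln x \<le> \<epsilon> / 16 * ln x" using \<eta>\<epsilon> lnx by (intro mult_right_mono) auto
  moreover have "(1 - \<epsilon> / 8) * ln R * (1 - (1 + \<epsilon> / 2) * (ln x / ln R)) =
      (1 - \<epsilon> / 8) * ln R - (1 - \<epsilon> / 8) * (1 + \<epsilon> / 2) * ln x"
    using R'(3) by (simp add: field_simps)
  moreover have "(1 - \<epsilon> / 8) * ln R \<le> ln R" using \<epsilon> R'(3) by (simp add: algebra_simps)
  moreover have "(1 + 5 * \<epsilon> / 16) * ln x \<le> (1 - \<epsilon> / 8) * (1 + \<epsilon> / 2) * ln x"
  proof (rule mult_right_mono)
    have "\<epsilon> * \<epsilon> \<le> 1 * \<epsilon>" using \<epsilon> by (intro mult_right_mono) auto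
    then show "1 + 5 * \<epsilon> / 16 \<le> (1 - \<epsilon> / 8) * (1 + \<epsilon> / 2)" by (simp add: field_simps)
  qed (use lnx in simp)
  moreover have "d * (exp ((1 - \<epsilon> / 8) * ln R) - 1) = d * exp ((1 - \<epsilon> / 8) * ln R) - d"
    by (simp add: right_diff_distrib)
  ultimately have "(1 - \<epsilon> / 8) * ln R * (1 - (1 + \<epsilon> / 2) * (ln x / ln R)) + d * (exp ((1 - \<epsilon> / 8) * ln R) - 1)
      \<le> ln R + (\<epsilon> / 16 * ln x - (1 + 5 * \<epsilon> / 16) * ln x)"
    using dR \<kappa> by linarith
  also have "\<dots> = ln R + - (1 + \<epsilon> / 4) * ln x" by (simp add: algebra_simps)
  finally have "exp ((1 - \<epsilon> / 8) * ln R * (1 - (1 + \<epsilon> / 2) * (ln x / ln R)) + d * (exp ((1 - \<epsilon> / 8) * ln R) - 1))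
      \<le> exp (ln R + - (1 + \<epsilon> / 4) * ln x)" by simp
  also have "\<dots> = R * x powr (- (1 + \<epsilon> / 4))"
    using R'(1) x by (simp only: exp_add powr_def) simp
  also have "\<dots> \<le> ln x / \<kappa> * x powr (- (1 + \<epsilon> / 4))"
    using R' by (intro mult_right_mono) auto
  finally show ?thesis .
qed

text \<open>k \<delta> \<ge> 16 makes Q^k at most n^(-4) up to logarithms; the vertex u or v and exp
  d \<le> n use two of these powers. \<eta> \<le> \<delta>/8 controls n q Q, and \<eta> \<le> 1/12
  makes n^5 q^6 at most n^(-1/2).\<close>

lemma failure_terms_le:
  fixes d q \<kappa> \<eta> \<epsilon> \<delta> Q T :: real and n k :: nat
  assumes n: "1 < n" and \<kappa>: "0 < \<kappa>" "\<kappa> \<le> d" and d: "d \<le> \<eta> * ln (real n)" and \<eta>: "0 < \<eta>" "\<eta> \<le> 1 / 12" "\<eta> \<le> \<delta> / 8"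
    and q: "0 \<le> q" "q \<le> real n powr (- 1 + \<eta>)" and k: "16 \<le> real k * \<delta>"
    and Q: "0 \<le> Q" "Q \<le> (ln (real n) / \<kappa>) ^ (k + 1) * real n powr (- (\<delta> / 4))"
    and T: "T \<le> ln (real n) / \<kappa> * real n powr (- (1 + \<epsilon> / 4))"
  shows "2 * exp (- real n) + (1 / real n + (real n * T + (real n * q * Q + (real n * exp d * Q ^ k +
    (real n ^ 5 * q ^ 6 + real n * exp d * d ^ k * Q ^ k))))) \<le> tail_bound \<epsilon> \<delta> k \<kappa> n"
proof -
  define x where "x = real n"
  have x: "1 < x" using n by (simp add: x_def)
  have lnx: "0 < ln x" using x by simp
  define W where "W = ln x / \<kappa>"
  have W: "0 < W" using lnx \<kappa> by (simp add: W_def)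
  have Wp: "W ^ j = (1 / \<kappa>) ^ j * ln x ^ j" for j by (simp add: W_def power_divide)
  have xp: "x powr a * x powr b = x powr (a + b)" for a b by (simp add: powr_add)
  have x1: "x = x powr 1" using x by simp
  have mono: "x powr a \<le> x powr b" if "a \<le> b" for a b using that x by (intro powr_mono) auto
  have d0: "0 < d" using \<kappa> by linarith
  have Qk: "Q ^ k \<le> W ^ ((k + 1) * k) * x powr (- 4)"
  proof -
    have "Q ^ k \<le> (W ^ (k + 1) * x powr (- (\<delta> / 4))) ^ k"
      using Q by (intro power_mono) (auto simp: W_def x_def)
    also have "\<dots> = W ^ ((k + 1) * k) * x powr (real k * - (\<delta> / 4))"
      using x by (simp only: power_mult_distrib power_mult powr_power)
    also have "\<dots> \<le> W ^ ((k + 1) * k) * x powr (- 4)"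
      using W k by (intro mult_left_mono mono) auto
    finally show ?thesis .
  qed
  have ed: "exp d \<le> x powr 1"
  proof -
    have "exp d \<le> x powr \<eta>" using d x by (simp add: powr_def x_def)
    also have "\<dots> \<le> x powr 1" using \<eta> by (intro mono) auto
    finally show ?thesis .
  qed
  have xed: "x * exp d * Q ^ k \<le> W ^ ((k + 1) * k) * x powr (- 2)"
  proof -
    have "x * exp d * Q ^ k \<le> x * x powr 1 * (W ^ ((k + 1) * k) * x powr (- 4))"
      using ed Qk Q x W by (intro mult_mono) auto
    also have "\<dots> = W ^ ((k + 1) * k) * (x powr 1 * x powr 1 * x powr (- 4))" using x by simp
    also have "\<dots> = W ^ ((k + 1) * k) * x powr (- 2)" unfolding xp by simp
    finally show ?thesis .
  qed
  have t2: "x * T \<le> W * x powr (- (\<epsilon> / 4))"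
  proof -
    have "x * T \<le> x * (W * x powr (- (1 + \<epsilon> / 4)))"
      using T x by (intro mult_left_mono) (auto simp: W_def x_def)
    also have "\<dots> = W * (x powr 1 * x powr (- (1 + \<epsilon> / 4)))" using x by simp
    also have "\<dots> = W * x powr (- (\<epsilon> / 4))" unfolding xp by simp
    finally show ?thesis .
  qed
  have t3: "x * q * Q \<le> W ^ (k + 1) * x powr (- (\<delta> / 8))"
  proof -
    have "x * q * Q \<le> x * x powr (- 1 + \<eta>) * (W ^ (k + 1) * x powr (- (\<delta> / 4)))"
      using q Q x W by (intro mult_mono mult_left_mono) (auto simp: W_def x_def)
    also have "\<dots> = W ^ (k + 1) * (x powr 1 * x powr (- 1 + \<eta>) * x powr (- (\<delta> / 4)))"
      using x by (simp add: mult_ac)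
    also have "\<dots> = W ^ (k + 1) * x powr (\<eta> - \<delta> / 4)" unfolding xp by simp
    also have "\<dots> \<le> W ^ (k + 1) * x powr (- (\<delta> / 8))" using W \<eta> by (intro mult_left_mono mono) auto
    finally show ?thesis .
  qed
  have t5: "x ^ 5 * q ^ 6 \<le> x powr (- (1 / 2))"
  proof -
    have "x ^ 5 * q ^ 6 \<le> x ^ 5 * (x powr (- 1 + \<eta>)) ^ 6"
      using q x by (intro mult_left_mono power_mono) (auto simp: x_def)
    also have "\<dots> = x powr 5 * x powr (6 * (- 1 + \<eta>))"
      using x by (simp add: powr_power powr_numeral mult.commute)
    also have "\<dots> = x powr (5 + 6 * (- 1 + \<eta>))" by (rule xp)
    also have "\<dots> \<le> x powr (- (1 / 2))" using \<eta> by (intro mono) auto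
    finally show ?thesis .
  qed
  have t6: "x * exp d * d ^ k * Q ^ k \<le> W ^ ((k + 1) * k) * ln x ^ k * x powr (- 2)"
  proof -
    have "\<eta> * ln x \<le> 1 * ln x" using \<eta> lnx by (intro mult_right_mono) auto
    then have dk: "d ^ k \<le> ln x ^ k" using d d0 by (intro power_mono) (auto simp: x_def)
    have "(x * exp d * Q ^ k) * d ^ k \<le> (W ^ ((k + 1) * k) * x powr (- 2)) * ln x ^ k"
      by (rule mult_mono[OF xed dk]) (use d0 W in auto)
    then show ?thesis by (simp add: mult_ac)
  qed
  have "2 * exp (- x) + (1 / x + (x * T + (x * q * Q + (x * exp d * Q ^ k +
      (x ^ 5 * q ^ 6 + x * exp d * d ^ k * Q ^ k))))) \<le>
    2 * exp (- x) + (1 / x + (W * x powr (- (\<epsilon> / 4)) + (W ^ (k + 1) * x powr (- (\<delta> / 8)) +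
      (W ^ ((k + 1) * k) * x powr (- 2) + (x powr (- (1 / 2)) + W ^ ((k + 1) * k) * ln x ^ k * x powr (- 2))))))"
    by (intro add_mono order.refl t2 t3 xed t5 t6)
  also have "\<dots> = tail_bound \<epsilon> \<delta> k \<kappa> n"
    unfolding tail_bound_def x_def[symmetric] Wp by (simp add: W_def power_add mult.assoc)
  finally show ?thesis by (simp add: x_def)
qed

text \<open>The surplus \<epsilon> sqrt L is spent in three parts: \<epsilon>/2 on the constants
  depending on k, \<epsilon>/4 on sqrt (1 + \<epsilon>/2), and \<epsilon>/4 = 42500 *
  \<epsilon>/170000 on the low vertices. The final constant is 42502 = 42500 + 2.\<close>

lemma norm_bound_le:
  fixes \<epsilon> L y :: real and k :: nat
  assumes \<epsilon>: "0 < \<epsilon>" "\<epsilon> < 1" and L: "0 \<le> L" and y: "0 \<le> y"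
    and big: "(2 * (1 + real k + sqrt (2 * real k * real (k + 3))) / \<epsilon>)\<^sup>2 \<le> L"
  shows "1 + real k + sqrt ((1 + \<epsilon> / 2) * L + 2 * real k * real (k + 3)) +
      42500 * sqrt (max ((\<epsilon> / 170000)\<^sup>2 * L) y) + 2 * sqrt y
    \<le> (1 + \<epsilon>) * sqrt L + 42502 * sqrt y"
proof -
  define c where "c = 1 + real k + sqrt (2 * real k * real (k + 3))"
  have c0: "0 \<le> c" by (simp add: c_def)
  have "2 * c / \<epsilon> \<le> sqrt L" using big by (intro real_le_rsqrt) (simp add: c_def)
  then have "c \<le> \<epsilon> / 2 * sqrt L" using \<epsilon> by (simp add: field_simps)
  moreover have "sqrt ((1 + \<epsilon> / 2) * L + 2 * real k * real (k + 3)) \<le>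
      sqrt ((1 + \<epsilon> / 2) * L) + sqrt (2 * real k * real (k + 3))"
    using L \<epsilon> by (intro sqrt_add_le_add_sqrt) auto
  moreover have "sqrt ((1 + \<epsilon> / 2) * L) \<le> (1 + \<epsilon> / 4) * sqrt L"
  proof -
    have "sqrt (1 + \<epsilon> / 2) \<le> 1 + \<epsilon> / 4"
      using \<epsilon> by (intro real_le_lsqrt) (auto simp: power2_eq_square algebra_simps)
    then show ?thesis using L by (simp add: real_sqrt_mult mult_right_mono)
  qed
  moreover have "42500 * sqrt (max ((\<epsilon> / 170000)\<^sup>2 * L) y) \<le> \<epsilon> / 4 * sqrt L + 42500 * sqrt y"
  proof -
    have "max ((\<epsilon> / 170000)\<^sup>2 * L) y \<le> (\<epsilon> / 170000)\<^sup>2 * L + y" using L y by simp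
    then have "sqrt (max ((\<epsilon> / 170000)\<^sup>2 * L) y) \<le> sqrt ((\<epsilon> / 170000)\<^sup>2 * L + y)" by simp
    also have "\<dots> \<le> sqrt ((\<epsilon> / 170000)\<^sup>2 * L) + sqrt y"
      using L y by (intro sqrt_add_le_add_sqrt) auto
    also have "sqrt ((\<epsilon> / 170000)\<^sup>2 * L) = \<epsilon> / 170000 * sqrt L" using \<epsilon> by (simp add: real_sqrt_mult)
    finally show ?thesis by simp
  qed
  ultimately show ?thesis unfolding c_def by (simp add: algebra_simps)
qed

lemma prob_corollary:
  fixes \<epsilon> \<kappa> \<eta> :: real and n k :: nat
  assumes \<epsilon>: "0 < \<epsilon>" "\<epsilon> < 1" and \<kappa>: "0 < \<kappa>" and p: "edge_probabilities n p"
    and deg: "\<kappa> \<le> max_degree n p" "max_degree n p \<le> \<eta> * ln (real n)"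
    and pm: "p_max n p \<le> real n powr (- 1 + \<eta>)"
    and k: "16 \<le> real k * (\<epsilon> / 170000)\<^sup>2"
    and n: "1 < n" "max (1 / (\<epsilon> / 170000)\<^sup>2) ((2 * (1 + real k + sqrt (2 * real k * real (k + 3))) / \<epsilon>)\<^sup>2)
      \<le> ln (real n) / ln (ln (real n) / \<kappa>)"
    and \<eta>: "0 < \<eta>" "\<eta> \<le> 1 / 12" "\<eta> \<le> (\<epsilon> / 170000)\<^sup>2 / 8" "\<eta> powr (1 / 2) \<le> (\<epsilon> / 170000)\<^sup>2 / 4"
      "\<eta> powr (\<epsilon> / 8) \<le> \<epsilon> / 16"
  shows "1 - tail_bound \<epsilon> ((\<epsilon> / 170000)\<^sup>2) k \<kappa> n \<le>
    measure_pmf.prob (random_graph n p) {G. op_norm n (centered_adjacency n p G)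
      \<le> (1 + \<epsilon>) * sqrt (L\<^sub>1 n p) + 42502 * sqrt (real n * p_max n p)}"
proof -
  define \<delta> where "\<delta> = (\<epsilon> / 170000)\<^sup>2"
  define d where "d = max_degree n p"
  define q where "q = p_max n p"
  define R where "R = ln (real n) / d"
  define L where "L = L\<^sub>1 n p"
  interpret sparse_graph n p q d
    unfolding q_def d_def using p n(1) by (intro sparse_graph_p_max_max_degree) auto
  have \<delta>: "0 < \<delta>" using \<epsilon> by (simp add: \<delta>_def)
  have x: "1 < real n" using n(1) by simp
  have lnx: "0 < ln (real n)" using x by simp
  have dk: "\<kappa> \<le> d" "d \<le> \<eta> * ln (real n)" using deg by (auto simp: d_def)
  have d0: "0 < d" using dk \<kappa> by linarith
  have \<eta>1: "\<eta> < 1" using \<eta> by linarith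
  have R: "1 < R" "R \<le> ln (real n) / \<kappa>" "0 < ln R"
    using exponent_bounds[OF x \<kappa> dk \<eta>(1) \<eta>1, of "1 / 2", folded R_def] by auto
  have L: "L = ln (real n) / ln R" by (simp add: L_def L\<^sub>1_def R_def d_def)
  \<comment> \<open>The lower bound \<kappa> on the degree makes L large uniformly in p; L \<ge>
    1/\<delta> also yields D \<ge> 1.\<close>
  have "ln R \<le> ln (ln (real n) / \<kappa>)" using R by (intro ln_mono) auto
  then have "ln (real n) / ln (ln (real n) / \<kappa>) \<le> L"
    unfolding L using R(3) lnx by (intro divide_left_mono) auto
  with n(2) have Lbig: "1 / \<delta> \<le> L" "(2 * (1 + real k + sqrt (2 * real k * real (k + 3))) / \<epsilon>)\<^sup>2 \<le> L"
    by (auto simp: \<delta>_def)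
  have L0: "0 \<le> L" unfolding L using lnx R(3) by simp
  define D where "D = max (\<delta> * L) (real n * q)"
  have "1 \<le> \<delta> * L" using Lbig(1) \<delta> by (simp add: field_simps)
  then have D: "1 \<le> D" "real n * q \<le> D" "\<delta> * L \<le> D" by (auto simp: D_def)
  define \<theta> where "\<theta> = ln R / 2"
  define \<theta>' where "\<theta>' = (1 - \<epsilon> / 8) * ln R"
  define \<Delta> where "\<Delta> = (1 + \<epsilon> / 2) * L"
  define B where "B = 1 + real k + sqrt (\<Delta> + 2 * real k * real (k + 3)) + 42500 * sqrt D + 2 * sqrt (real n * q)"
  have \<theta>: "0 \<le> \<theta>" "0 \<le> \<theta>'" using R(3) \<epsilon> by (auto simp: \<theta>_def \<theta>'_def)
  have \<Delta>: "0 \<le> \<Delta>" using \<epsilon> L0 by (simp add: \<Delta>_def)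
  have n0: "0 < n" using n by simp
  have "Pr (\<lambda>G. \<not> op_norm n (centered_adjacency n p G) \<le> B) \<le> tail_bound \<epsilon> \<delta> k \<kappa> n"
    unfolding B_def
  proof (rule order.trans[OF prob_op_norm_centered[OF D(1,2) n0 d0 \<theta> \<Delta> D(3)]], rule failure_terms_le)
    show "exp (\<theta> * (real (2 * k + 1) - \<delta> * L) + d * (exp \<theta> - 1)) \<le>
        (ln (real n) / \<kappa>) ^ (k + 1) * real n powr (- (\<delta> / 4))"
      unfolding \<theta>_def L R_def
      by (rule high_degree_factor_le[OF x \<kappa> dk \<eta>(1) \<eta>1]) (use \<eta>(4) in \<open>simp add: \<delta>_def\<close>)
    show "exp (\<theta>' * (1 - \<Delta>) + d * (exp \<theta>' - 1)) \<le> ln (real n) / \<kappa> * real n powr (- (1 + \<epsilon> / 4))"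
      unfolding \<theta>'_def \<Delta>_def L R_def by (rule max_degree_factor_le[OF x \<kappa> dk \<eta>(1) \<eta>1 \<epsilon> \<eta>(5)])
    show "16 \<le> real k * \<delta>" using k by (simp add: \<delta>_def)
    show "\<eta> \<le> \<delta> / 8" using \<eta>(3) by (simp add: \<delta>_def)
    show "q \<le> real n powr (- 1 + \<eta>)" using pm by (simp add: q_def)
  qed (use n(1) \<kappa> dk \<eta> q_nonneg in auto)
  moreover have "Pr (\<lambda>G. op_norm n (centered_adjacency n p G) \<le> B) = 1 - Pr (\<lambda>G. \<not> op_norm n (centered_adjacency n p G) \<le> B)"
  proof -
    have "{G. \<not> op_norm n (centered_adjacency n p G) \<le> B} = UNIV - {G. op_norm n (centered_adjacency n p G) \<le> B}" by auto
    then show ?thesis using measure_pmf.prob_compl[of "{G. op_norm n (centered_adjacency n p G) \<le> B}"] by simp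
  qed
  moreover have "Pr (\<lambda>G. op_norm n (centered_adjacency n p G) \<le> B) \<le>
      Pr (\<lambda>G. op_norm n (centered_adjacency n p G) \<le> (1 + \<epsilon>) * sqrt L + 42502 * sqrt (real n * q))"
  proof (rule prob_mono)
    fix G assume "op_norm n (centered_adjacency n p G) \<le> B"
    also have "B \<le> (1 + \<epsilon>) * sqrt L + 42502 * sqrt (real n * q)"
      unfolding B_def \<Delta>_def D_def \<delta>_def
      by (rule norm_bound_le[OF \<epsilon> L0 _ Lbig(2)]) (use q_nonneg in simp)
    finally show "op_norm n (centered_adjacency n p G) \<le> (1 + \<epsilon>) * sqrt L + 42502 * sqrt (real n * q)" .
  qed
  ultimately show ?thesis unfolding L_def q_def \<delta>_def by linarith
qed

text \<open>The error function is f where the estimate holds for every p and 1 elsewhere, where the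
  claim is trivial. The exceptional pairs (n, \<eta>) are eventually avoided, so the limit is that
  of f, chosen separately for each \<kappa>.\<close>

lemma holds_whp_underI:
  assumes "\<And>\<kappa>. 0 < \<kappa> \<Longrightarrow> \<exists>f :: nat \<Rightarrow> real. f \<longlonglongrightarrow> 0 \<and>
    (\<forall>\<^sub>F (n, \<eta>) in sequentially \<times>\<^sub>F at_right 0. \<forall>p. edge_probabilities n p \<and> cond n \<kappa> \<eta> p \<longrightarrow>
      1 - f n \<le> measure_pmf.prob (random_graph n p) {G. E n p G})"
  shows "holds_whp_under cond E"
proof -
  define ok where "ok f n \<kappa> \<eta> \<longleftrightarrow> (\<forall>p. edge_probabilities n p \<and> cond n \<kappa> \<eta> p \<longrightarrow>
    1 - f n \<le> measure_pmf.prob (random_graph n p) {G. E n p G})" for f :: "nat \<Rightarrow> real" and n \<kappa> \<eta>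
  have "\<forall>\<kappa>. \<exists>f :: nat \<Rightarrow> real. 0 < \<kappa> \<longrightarrow> f \<longlonglongrightarrow> 0 \<and>
    (\<forall>\<^sub>F (n, \<eta>) in sequentially \<times>\<^sub>F at_right 0. ok f n \<kappa> \<eta>)"
    using assms unfolding ok_def by blast
  then obtain f :: "real \<Rightarrow> nat \<Rightarrow> real" where
    f: "\<And>\<kappa>. 0 < \<kappa> \<Longrightarrow> f \<kappa> \<longlonglongrightarrow> 0"
      "\<And>\<kappa>. 0 < \<kappa> \<Longrightarrow> \<forall>\<^sub>F (n, \<eta>) in sequentially \<times>\<^sub>F at_right 0. ok (f \<kappa>) n \<kappa> \<eta>"
    by metis
  define \<psi> where "\<psi> n \<kappa> \<eta> = (if ok (f \<kappa>) n \<kappa> \<eta> then f \<kappa> n else 1)" for n \<kappa> \<eta>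
  have "admissible_error \<psi>"
    unfolding admissible_error_def
  proof (intro allI impI)
    fix \<kappa> :: real assume \<kappa>: "0 < \<kappa>"
    have "((\<lambda>x. f \<kappa> (fst x)) \<longlongrightarrow> 0) (sequentially \<times>\<^sub>F at_right (0::real))"
      by (rule filterlim_compose[OF f(1)[OF \<kappa>] filterlim_fst])
    moreover have "\<forall>\<^sub>F x in sequentially \<times>\<^sub>F at_right 0. f \<kappa> (fst x) = (case x of (n, \<eta>) \<Rightarrow> \<psi> n \<kappa> \<eta>)"
      using f(2)[OF \<kappa>] by eventually_elim (auto simp: \<psi>_def)
    ultimately show "((\<lambda>(n, \<eta>). \<psi> n \<kappa> \<eta>) \<longlongrightarrow> 0) (sequentially \<times>\<^sub>F at_right 0)"
      by (rule Lim_transform_eventually)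
  qed
  moreover have "1 - \<psi> n \<kappa> \<eta> \<le> measure_pmf.prob (random_graph n p) {G. E n p G}"
    if "edge_probabilities n p" "cond n \<kappa> \<eta> p" for n \<kappa> \<eta> p
    using that by (auto simp: \<psi>_def ok_def)
  ultimately show ?thesis unfolding holds_whp_under_def by blast
qed

theorem corollary1p3:
  "\<exists>C::real. C > 0 \<and>
     (\<forall>\<epsilon>::real. 0 < \<epsilon> \<and> \<epsilon> < 1 \<longrightarrow>
        holds_whp_under
          (\<lambda>n \<kappa> \<eta> p. \<kappa> \<le> max_degree n p \<and> max_degree n p \<le> \<eta> * ln (real n) \<and>
             p_max n p \<le> real n powr (- 1 + \<eta>))
          (\<lambda>n p G. op_norm n (centered_adjacency n p G)
             \<le> (1 + \<epsilon>) * sqrt (L\<^sub>1 n p) + C * sqrt (real n * p_max n p)))"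
proof (intro exI[of _ 42502] conjI allI impI)
  fix \<epsilon> :: real assume "0 < \<epsilon> \<and> \<epsilon> < 1"
  then have \<epsilon>: "0 < \<epsilon>" "\<epsilon> < 1" by auto
  define \<delta> where "\<delta> = (\<epsilon> / 170000)\<^sup>2"
  have \<delta>: "0 < \<delta>" using \<epsilon> by (simp add: \<delta>_def)
  \<comment> \<open>k depends on \<epsilon> alone, so it stays fixed while n grows and \<eta>
    shrinks.\<close>
  obtain k :: nat where "16 / \<delta> \<le> real k" using real_arch_simple by blast
  then have k: "16 \<le> real k * \<delta>" using \<delta> by (simp add: field_simps)
  show "holds_whp_under
          (\<lambda>n \<kappa> \<eta> p. \<kappa> \<le> max_degree n p \<and> max_degree n p \<le> \<eta> * ln (real n) \<and>
             p_max n p \<le> real n powr (- 1 + \<eta>))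
          (\<lambda>n p G. op_norm n (centered_adjacency n p G)
             \<le> (1 + \<epsilon>) * sqrt (L\<^sub>1 n p) + 42502 * sqrt (real n * p_max n p))"
  proof (rule holds_whp_underI)
    fix \<kappa> :: real assume \<kappa>: "0 < \<kappa>"
    let ?M = "max (1 / \<delta>) ((2 * (1 + real k + sqrt (2 * real k * real (k + 3))) / \<epsilon>)\<^sup>2)"
    let ?N = "\<lambda>n. 1 < n \<and> ?M \<le> ln (real n) / ln (ln (real n) / \<kappa>)"
    let ?H = "\<lambda>\<eta>. 0 < \<eta> \<and> \<eta> \<le> 1 / 12 \<and> \<eta> \<le> \<delta> / 8 \<and> \<eta> powr (1 / 2) \<le> \<delta> / 4 \<and> \<eta> powr (\<epsilon> / 8) \<le> \<epsilon> / 16"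
    have N: "\<forall>\<^sub>F n in sequentially. ?N n"
      using ln_div_ln_ln_at_top[OF \<kappa>] eventually_gt_at_top[of 1]
      by (auto simp: filterlim_at_top eventually_conj_iff)
    have small: "\<forall>\<^sub>F \<eta> in at_right (0::real). \<eta> powr a \<le> b" if "0 < a" "0 < b" for a b :: real
    proof -
      have "((\<lambda>\<eta>. \<eta> powr a) \<longlongrightarrow> 0) (at_right (0::real))" using that(1) by real_asymp
      then have "\<forall>\<^sub>F \<eta> in at_right (0::real). \<eta> powr a < b" using that(2) by (rule order_tendstoD)
      then show ?thesis by eventually_elim simp
    qed
    have pos: "\<forall>\<^sub>F \<eta> in at_right (0::real). 0 < \<eta>" by (rule eventually_at_right_less)
    have le: "\<forall>\<^sub>F \<eta> in at_right (0::real). \<eta> \<le> b" if "0 < b" for b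
      using small[of 1 b] pos that by (auto elim: eventually_elim2)
    have H: "\<forall>\<^sub>F \<eta> in at_right 0. ?H \<eta>"
      using \<epsilon> \<delta> by (intro eventually_conj pos le small) auto
    show "\<exists>f :: nat \<Rightarrow> real. f \<longlonglongrightarrow> 0 \<and>
      (\<forall>\<^sub>F (n, \<eta>) in sequentially \<times>\<^sub>F at_right 0. \<forall>p. edge_probabilities n p \<and>
        (\<kappa> \<le> max_degree n p \<and> max_degree n p \<le> \<eta> * ln (real n) \<and> p_max n p \<le> real n powr (- 1 + \<eta>)) \<longrightarrow>
        1 - f n \<le> measure_pmf.prob (random_graph n p) {G. op_norm n (centered_adjacency n p G)
          \<le> (1 + \<epsilon>) * sqrt (L\<^sub>1 n p) + 42502 * sqrt (real n * p_max n p)})"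
    proof (intro exI conjI)
      show "tail_bound \<epsilon> \<delta> k \<kappa> \<longlonglongrightarrow> 0" by (rule tail_bound_tendsto_0[OF \<epsilon>(1) \<delta>])
      have "\<forall>\<^sub>F x in sequentially \<times>\<^sub>F at_right 0. ?N (fst x) \<and> ?H (snd x)"
        using eventually_prodI[OF N H] .
      then show "\<forall>\<^sub>F (n, \<eta>) in sequentially \<times>\<^sub>F at_right 0. \<forall>p. edge_probabilities n p \<and>
        (\<kappa> \<le> max_degree n p \<and> max_degree n p \<le> \<eta> * ln (real n) \<and> p_max n p \<le> real n powr (- 1 + \<eta>)) \<longrightarrow>
        1 - tail_bound \<epsilon> \<delta> k \<kappa> n \<le> measure_pmf.prob (random_graph n p) {G. op_norm n (centered_adjacency n p G)
          \<le> (1 + \<epsilon>) * sqrt (L\<^sub>1 n p) + 42502 * sqrt (real n * p_max n p)}"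
      proof eventually_elim
        case (elim x)
        obtain n \<eta> where x: "x = (n, \<eta>)" by (cases x)
        with elim have n: "1 < n" "?M \<le> ln (real n) / ln (ln (real n) / \<kappa>)" and \<eta>: "?H \<eta>" by auto
        show ?case
          unfolding x prod.case
        proof (intro allI impI, elim conjE)
          fix p assume p: "edge_probabilities n p" "\<kappa> \<le> max_degree n p" "max_degree n p \<le> \<eta> * ln (real n)"
            "p_max n p \<le> real n powr (- 1 + \<eta>)"
          show "1 - tail_bound \<epsilon> \<delta> k \<kappa> n \<le> measure_pmf.prob (random_graph n p) {G. op_norm n (centered_adjacency n p G)
              \<le> (1 + \<epsilon>) * sqrt (L\<^sub>1 n p) + 42502 * sqrt (real n * p_max n p)}"
            using prob_corollary[OF \<epsilon> \<kappa> p, folded \<delta>_def, OF k n] \<eta> by blast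
        qed
      qed
    qed
  qed
qed simp

end
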